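(* Let $d\in\mathbb N\cup\{\infty\}$, and let $(\mathbf b=(b_j)_{j=1}^d,\mathbf n=(n_j)_{j=1}^d)$ be a pair of weight and frequency data of length $d$ such that $\sigma_a(\sum_{j=1}^db_jn_j^{-s})<\infty$. Then there exists $\rho\in\mathbb R$ such that the kernel $$K_{\mathbf b,\mathbf n}(s,u)=\frac1{1-\sum_{j=1}^db_jn_j^{-s-\overline u}},\qquad s,u\in\mathbb H_\rho,$$ is a CNP kernel. Conversely, if $K$ is a non-constant normalized CNP Dirichlet series kernel defined on some right half-plane, then $K$ is of the form $K_{\mathbf b,\mathbf n}$ for some pair $(\mathbf b,\mathbf n)$ of weight and frequency data of length $d\in\mathbb N\cup\{\infty\}$ satisfying $\sigma_a(\sum_{j=1}^db_jn_j^{-s})<\infty$.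
   Context: $\mathbb H_\rho=\{s\in\mathbb C:\operatorname{Re}(s)>\rho\}$. A pair of weight and frequency data of length $d$ consists of a $d$-tuple $\mathbf b=(b_j)_{j=1}^d$ of positive reals and a $d$-tuple $\mathbf n=(n_j)_{j=1}^d$ of distinct integers $\ge2$ (sequences if $d=\infty$). For a Dirichlet series $f(s)=\sum_n a_nn^{-s}$, $\sigma_a(f)=\inf\{\operatorname{Re}(s):\sum_n|a_n|n^{-\operatorname{Re}(s)}<\infty\}$. A Dirichlet series kernel is a kernel of the form $K_{\mathbf w}(s,u)=\sum_{n=1}^\infty w_nn^{-s-\overline u}$, where $\mathbf w=(w_n)_{n\ge1}$ is a sequence of non-negative reals with $\rho_{\mathbf w}:=\sigma_a(\sum_nw_nn^{-s})<\infty$; it converges absolutely and is positive semi-definite on $\mathbb H_{\rho_{\mathbf w}/2}$. It is normalized if $w_1=1$. A positive semi-definite kernel $K$ on a set $\Omega$, with reproducing kernel Hilbert space $\mathcal H(K)$, is a complete Nevanlinna–Pick (CNP) kernel if for all $p,q\in\mathbb N$, all finite sets $\{x_1,\dots,x_n\}\subseteq\Omega$ and all complex $p\times q$ matrices $W_1,\dots,W_n$ such that the block matrix $[(I-W_iW_j^* )K(x_i,x_j)]_{i,j=1}^n$ is positive semi-definite, there is a multiplier $\varphi:\Omega\to M_{p,q}(\mathbb C)$ from $\mathcal H(K)\otimes\mathbb C^q$ to $\mathcal H(K)\otimes\mathbb C^p$ with $\varphi(x_i)=W_i$ for all $i$ and $\|M_\varphi\|\le1$. *)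

theory Defs
  imports
    "HOL-Analysis.Analysis"
    "HOL-Library.Extended_Nat"
    "HOL-Library.Extended_Real"
    "HOL-Library.Nonpos_Ints"
    "Jordan_Normal_Form.Schur_Decomposition"
begin

section \<open>Positive semi-definite kernels and their reproducing kernel Hilbert spaces\<close>

text \<open>Over the complex numbers, nonnegativity of the quadratic form already forces
  \<open>K x y = cnj (K y x)\<close> on \<open>\<Omega>\<close>.\<close>

definition psd_kernel :: "'a set \<Rightarrow> ('a \<Rightarrow> 'a \<Rightarrow> complex) \<Rightarrow> bool" where
  "psd_kernel \<Omega> K \<longleftrightarrow>
     (\<forall>F c. finite F \<longrightarrow> F \<subseteq> \<Omega> \<longrightarrow>
        (\<Sum>x\<in>F. \<Sum>y\<in>F. cnj (c x) * c y * K x y) \<in> \<real>\<^sub>\<ge>\<^sub>0)"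

definition ip_norm :: "('v \<Rightarrow> 'v \<Rightarrow> complex) \<Rightarrow> 'v \<Rightarrow> real" where
  "ip_norm ip f = sqrt (Re (ip f f))"

text \<open>\<open>rkhs \<Omega> K H ip\<close>: the set \<open>H\<close> of functions on \<open>\<Omega>\<close> is, with the inner product \<open>ip\<close>, a complex
  Hilbert space with reproducing kernel \<open>K\<close>. A function on \<open>\<Omega>\<close> is represented by its extension
  by zero to the whole type. The inner product is linear in its first argument.\<close>

locale rkhs =
  fixes \<Omega> :: "'a set"
    and K :: "'a \<Rightarrow> 'a \<Rightarrow> complex"
    and H :: "('a \<Rightarrow> complex) set"
    and ip :: "('a \<Rightarrow> complex) \<Rightarrow> ('a \<Rightarrow> complex) \<Rightarrow> complex"
  assumes outside: "f \<in> H \<Longrightarrow> x \<notin> \<Omega> \<Longrightarrow> f x = 0"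
    and zero_mem: "(\<lambda>x. 0) \<in> H"
    and add_mem: "f \<in> H \<Longrightarrow> g \<in> H \<Longrightarrow> (\<lambda>x. f x + g x) \<in> H"
    and scale_mem: "f \<in> H \<Longrightarrow> (\<lambda>x. a * f x) \<in> H"
    and ip_add: "f \<in> H \<Longrightarrow> g \<in> H \<Longrightarrow> h \<in> H \<Longrightarrow> ip (\<lambda>x. f x + g x) h = ip f h + ip g h"
    and ip_scale: "f \<in> H \<Longrightarrow> h \<in> H \<Longrightarrow> ip (\<lambda>x. a * f x) h = a * ip f h"
    and ip_commute: "f \<in> H \<Longrightarrow> g \<in> H \<Longrightarrow> ip g f = cnj (ip f g)"
    and ip_nonneg: "f \<in> H \<Longrightarrow> ip f f \<in> \<real>\<^sub>\<ge>\<^sub>0"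
    and ip_definite: "f \<in> H \<Longrightarrow> ip f f = 0 \<Longrightarrow> f = (\<lambda>x. 0)"
    and complete:
      "(\<And>m. F m \<in> H) \<Longrightarrow>
       (\<And>\<epsilon>. \<epsilon> > 0 \<Longrightarrow> \<exists>N. \<forall>m\<ge>N. \<forall>k\<ge>N. ip_norm ip (\<lambda>x. F m x - F k x) < \<epsilon>) \<Longrightarrow>
       \<exists>g\<in>H. (\<lambda>m. ip_norm ip (\<lambda>x. F m x - g x)) \<longlonglongrightarrow> 0"
    and kernel_mem: "y \<in> \<Omega> \<Longrightarrow> (\<lambda>x. if x \<in> \<Omega> then K x y else 0) \<in> H"
    and reproducing: "f \<in> H \<Longrightarrow> y \<in> \<Omega> \<Longrightarrow> ip f (\<lambda>x. if x \<in> \<Omega> then K x y else 0) = f y"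

section \<open>Multipliers and complete Nevanlinna--Pick kernels\<close>

text \<open>An element of \<open>H \<otimes> \<complex>\<^sup>q\<close> is a \<open>\<complex>\<^sup>q\<close>-valued function whose components \<open>f 0, \<dots>, f (q - 1)\<close> lie
  in \<open>H\<close>.\<close>

definition tuple_norm ::
  "(('a \<Rightarrow> complex) \<Rightarrow> ('a \<Rightarrow> complex) \<Rightarrow> complex) \<Rightarrow> nat \<Rightarrow> (nat \<Rightarrow> 'a \<Rightarrow> complex) \<Rightarrow> real" where
  "tuple_norm ip q f = sqrt (\<Sum>k<q. (ip_norm ip (f k))\<^sup>2)"

definition mult_op ::
  "nat \<Rightarrow> ('a \<Rightarrow> complex mat) \<Rightarrow> (nat \<Rightarrow> 'a \<Rightarrow> complex) \<Rightarrow> nat \<Rightarrow> 'a \<Rightarrow> complex" where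
  "mult_op q \<phi> f = (\<lambda>i x. \<Sum>k<q. \<phi> x $$ (i, k) * f k x)"

definition is_multiplier ::
  "'a set \<Rightarrow> ('a \<Rightarrow> complex) set \<Rightarrow> nat \<Rightarrow> nat \<Rightarrow> ('a \<Rightarrow> complex mat) \<Rightarrow> bool" where
  "is_multiplier \<Omega> H p q \<phi> \<longleftrightarrow>
     (\<forall>x\<in>\<Omega>. \<phi> x \<in> carrier_mat p q) \<and>
     (\<forall>f. (\<forall>k<q. f k \<in> H) \<longrightarrow> (\<forall>i<p. mult_op q \<phi> f i \<in> H))"

definition mult_norm_le_one ::
  "('a \<Rightarrow> complex) set \<Rightarrow> (('a \<Rightarrow> complex) \<Rightarrow> ('a \<Rightarrow> complex) \<Rightarrow> complex) \<Rightarrow>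
   nat \<Rightarrow> nat \<Rightarrow> ('a \<Rightarrow> complex mat) \<Rightarrow> bool" where
  "mult_norm_le_one H ip p q \<phi> \<longleftrightarrow>
     (\<forall>f. (\<forall>k<q. f k \<in> H) \<longrightarrow> tuple_norm ip p (mult_op q \<phi> f) \<le> tuple_norm ip q f)"

text \<open>The \<open>p \<times> p\<close> block matrix with blocks \<open>K x y (I - W x (W y)\<^sup>*)\<close> for \<open>x, y\<close> in a finite set \<open>F\<close>
  is a scalar kernel on \<open>F \<times> {..<p}\<close>.\<close>

definition pick_matrix ::
  "('a \<Rightarrow> 'a \<Rightarrow> complex) \<Rightarrow> nat \<Rightarrow> ('a \<Rightarrow> complex mat) \<Rightarrow> 'a \<times> nat \<Rightarrow> 'a \<times> nat \<Rightarrow> complex" where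
  "pick_matrix K p W = (\<lambda>(x, i) (y, k). (1\<^sub>m p - W x * mat_adjoint (W y)) $$ (i, k) * K x y)"

text \<open>By the Moore--Aronszajn theorem a positive semi-definite kernel has exactly one reproducing
  kernel Hilbert space, so the existential quantifier over \<open>H\<close> and \<open>ip\<close> (whose values off \<open>H\<close> are
  irrelevant) only names it.\<close>

definition cnp_kernel :: "'a set \<Rightarrow> ('a \<Rightarrow> 'a \<Rightarrow> complex) \<Rightarrow> bool" where
  "cnp_kernel \<Omega> K \<longleftrightarrow> psd_kernel \<Omega> K \<and>
     (\<exists>H ip. rkhs \<Omega> K H ip \<and>
       (\<forall>p\<ge>1. \<forall>q\<ge>1. \<forall>F W. finite F \<longrightarrow> F \<subseteq> \<Omega> \<longrightarrow> (\<forall>x\<in>F. W x \<in> carrier_mat p q) \<longrightarrow>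
          psd_kernel (F \<times> {..<p}) (pick_matrix K p W) \<longrightarrow>
          (\<exists>\<phi>. is_multiplier \<Omega> H p q \<phi> \<and> mult_norm_le_one H ip p q \<phi> \<and> (\<forall>x\<in>F. \<phi> x = W x))))"

section \<open>Dirichlet series kernels\<close>

definition half_plane :: "real \<Rightarrow> complex set" where
  "half_plane \<rho> = {s. Re s > \<rho>}"

text \<open>The abscissa of absolute convergence of \<open>\<Sum>i\<in>I. a i * (\<nu> i) powr (-s)\<close>. For an ordinary
  Dirichlet series, \<open>I = {1..}\<close> and \<open>\<nu>\<close> is the identity. It is \<open>\<infinity>\<close> if the series converges
  absolutely nowhere, and \<open>-\<infinity>\<close> if it does so everywhere.\<close>

definition sigma_a :: "nat set \<Rightarrow> (nat \<Rightarrow> real) \<Rightarrow> (nat \<Rightarrow> nat) \<Rightarrow> ereal" where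
  "sigma_a I a \<nu> = Inf {ereal \<sigma> |\<sigma>. (\<lambda>i. \<bar>a i\<bar> * real (\<nu> i) powr (- \<sigma>)) summable_on I}"

definition dirichlet_kernel :: "(nat \<Rightarrow> real) \<Rightarrow> complex \<Rightarrow> complex \<Rightarrow> complex" where
  "dirichlet_kernel w s u = (\<Sum>\<^sub>\<infinity>n\<in>{1..}. of_real (w n) * of_nat n powr (- s - cnj u))"

definition indices :: "enat \<Rightarrow> nat set" where
  "indices d = {j. 1 \<le> j \<and> enat j \<le> d}"

definition weight_frequency_data :: "enat \<Rightarrow> (nat \<Rightarrow> real) \<Rightarrow> (nat \<Rightarrow> nat) \<Rightarrow> bool" where
  "weight_frequency_data d b n \<longleftrightarrow>
     1 \<le> d \<and> (\<forall>j\<in>indices d. b j > 0) \<and> (\<forall>j\<in>indices d. n j \<ge> 2) \<and> inj_on n (indices d)"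

definition data_series ::
  "enat \<Rightarrow> (nat \<Rightarrow> real) \<Rightarrow> (nat \<Rightarrow> nat) \<Rightarrow> complex \<Rightarrow> complex \<Rightarrow> complex" where
  "data_series d b n s u = (\<Sum>\<^sub>\<infinity>j\<in>indices d. of_real (b j) * of_nat (n j) powr (- s - cnj u))"

definition data_kernel ::
  "enat \<Rightarrow> (nat \<Rightarrow> real) \<Rightarrow> (nat \<Rightarrow> nat) \<Rightarrow> complex \<Rightarrow> complex \<Rightarrow> complex" where
  "data_kernel d b n s u = 1 / (1 - data_series d b n s u)"

text \<open>Guards against the conventions that a divergent sum is \<open>0\<close> and \<open>1 / 0 = 0\<close>.\<close>

definition data_kernel_defined_on ::
  "real \<Rightarrow> enat \<Rightarrow> (nat \<Rightarrow> real) \<Rightarrow> (nat \<Rightarrow> nat) \<Rightarrow> bool" where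
  "data_kernel_defined_on \<rho> d b n \<longleftrightarrow>
     (\<forall>s\<in>half_plane \<rho>. \<forall>u\<in>half_plane \<rho>.
        (\<lambda>j. of_real (b j) * of_nat (n j) powr (- s - cnj u) :: complex) summable_on indices d \<and>
        data_series d b n s u \<noteq> 1)"

end

theory Submission
  imports Defs
begin

text \<open>Write \<open>g\<close> for the sequence carrying the weight \<open>b\<^sub>j\<close> at the frequency \<open>n\<^sub>j\<close> and \<open>G\<close> for its
  Dirichlet series. Then \<open>\<Sum>\<^sub>n w\<^sub>n n\<^sup>-\<^sup>s = 1 / (1 - G)\<close> means \<open>w = \<delta>\<^sub>1 + g * w\<close> for Dirichlet convolution.

  If \<open>g \<ge> 0\<close>, the Hilbert space consists of the series \<open>\<Sum> a\<^sub>n n\<^sup>-\<^sup>s\<close> with \<open>\<Sum> \<bar>a\<^sub>n\<bar>\<^sup>2 / w\<^sub>n < \<infinity>\<close>, and the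
  renewal equation makes the row \<open>(\<surd>(g d) d\<^sup>-\<^sup>s)\<^sub>d\<close> a contractive multiplier. A lurking isometry turns
  a positive Pick matrix into a contractive column, whose transfer function is a contractive
  multiplier solving the Pick problem.

  Conversely, the complete Pick property makes \<open>1 - K(s,a) K(a,u) / (K(a,a) K(s,u))\<close> positive
  semi-definite for every base point \<open>a\<close> (McCullough--Quiggin, by the induction of Knese). Letting
  \<open>a \<rightarrow> +\<infinity>\<close> gives that \<open>1 - 1 / K = G\<close> is positive semi-definite on a remote half-plane, which
  forces \<open>g \<ge> 0\<close>. Then \<open>g \<le> w\<close>, so \<open>G\<close> converges wherever the series of \<open>w\<close> does.\<close>

section \<open>Positive semi-definite kernels\<close>

text \<open>The half-plane has to be fixed before any Pick problem is posed, while the number of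
  states of the transfer function, the length of a Gram factorisation, is unbounded. No estimate may
  therefore involve that number. Each block of the column is a contraction, so the Euclidean norm v
  of a state vector satisfies an inequality v \<le> sqrt g + sqrt g * v without any dimension in it,
  and one bound on the series of sqrt g serves all Pick problems. The square root arises because the
  isometry splits the weight g d between the two factors of an inner product.

  In the converse the series of g has to converge before the sign of g is known. The recursion is
  first controlled by absolute values far to the right. There the identity W (1 - G) = 1 also shows
  that K has no zeros, which is why the quotient theorem is stated on a subset of the domain. The
  limit in the base point exists because w 1 = 1 makes K(s,a), K(a,u) and K(a,a) tend to 1.\<close>

lemma psd_kernelD:
  "psd_kernel \<Omega> K \<Longrightarrow> finite F \<Longrightarrow> F \<subseteq> \<Omega> \<Longrightarrow>
     (\<Sum>x\<in>F. \<Sum>y\<in>F. cnj (c x) * c y * K x y) \<in> \<real>\<^sub>\<ge>\<^sub>0"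
  unfolding psd_kernel_def by blast

lemma psd_kernel_subset: "psd_kernel \<Omega> K \<Longrightarrow> \<Omega>' \<subseteq> \<Omega> \<Longrightarrow> psd_kernel \<Omega>' K"
  unfolding psd_kernel_def by (meson subset_trans)

lemma psd_kernel_cong:
  assumes "psd_kernel \<Omega> K" "\<And>x y. x \<in> \<Omega> \<Longrightarrow> y \<in> \<Omega> \<Longrightarrow> K x y = L x y"
  shows "psd_kernel \<Omega> L"
  unfolding psd_kernel_def
proof (intro allI impI)
  fix F and c :: "'a \<Rightarrow> complex" assume F: "finite F" "F \<subseteq> \<Omega>"
  have "(\<Sum>x\<in>F. \<Sum>y\<in>F. cnj (c x) * c y * L x y) = (\<Sum>x\<in>F. \<Sum>y\<in>F. cnj (c x) * c y * K x y)"
    using F assms(2) by (intro sum.cong refl arg_cong2[where f="(*)"]) (auto simp: subset_iff)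
  then show "(\<Sum>x\<in>F. \<Sum>y\<in>F. cnj (c x) * c y * L x y) \<in> \<real>\<^sub>\<ge>\<^sub>0"
    using psd_kernelD[OF assms(1) F] by simp
qed

lemma psd_kernel_finiteI:
  assumes "finite F" "\<And>c. (\<Sum>x\<in>F. \<Sum>y\<in>F. cnj (c x) * c y * K x y) \<in> \<real>\<^sub>\<ge>\<^sub>0"
  shows "psd_kernel F K"
  unfolding psd_kernel_def
proof (intro allI impI)
  fix G and c :: "'a \<Rightarrow> complex" assume G: "finite G" "G \<subseteq> F"
  define c' where "c' x = (if x \<in> G then c x else 0)" for x
  have "(\<Sum>x\<in>F. \<Sum>y\<in>F. cnj (c' x) * c' y * K x y) = (\<Sum>x\<in>G. \<Sum>y\<in>G. cnj (c x) * c y * K x y)"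
    using G assms(1)
    by (intro sum.mono_neutral_cong_right) (auto simp: c'_def intro!: sum.mono_neutral_cong_right)
  then show "(\<Sum>x\<in>G. \<Sum>y\<in>G. cnj (c x) * c y * K x y) \<in> \<real>\<^sub>\<ge>\<^sub>0"
    using assms(2)[of c'] by simp
qed

lemma sum_sum_insert:
  fixes f :: "'a \<Rightarrow> 'a \<Rightarrow> complex"
  assumes "finite F" "a \<notin> F"
  shows "(\<Sum>x\<in>insert a F. \<Sum>y\<in>insert a F. f x y) =
    f a a + (\<Sum>y\<in>F. f a y) + (\<Sum>x\<in>F. f x a) + (\<Sum>x\<in>F. \<Sum>y\<in>F. f x y)"
  using assms by (simp add: sum.distrib add_ac)

lemma psd_kernel_diag:
  assumes "psd_kernel \<Omega> K" "x \<in> \<Omega>"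
  shows "K x x \<in> \<real>\<^sub>\<ge>\<^sub>0"
  using psd_kernelD[OF assms(1), of "{x}" "\<lambda>_. 1"] assms(2) by simp

lemma psd_kernel_pair:
  assumes "psd_kernel \<Omega> K" "x \<in> \<Omega>" "y \<in> \<Omega>" "x \<noteq> y"
  shows "cnj a * a * K x x + cnj a * b * K x y + cnj b * a * K y x + cnj b * b * K y y \<in> \<real>\<^sub>\<ge>\<^sub>0"
  using psd_kernelD[OF assms(1), of "{x,y}" "\<lambda>z. if z = x then a else b"] assms(2-)
  by (simp add: add_ac)

text \<open>The test vectors (1, 1) and (1, i) make K x y + K y x real and K x y - K y x purely
  imaginary.\<close>

lemma psd_kernel_hermitian:
  assumes "psd_kernel \<Omega> K" "x \<in> \<Omega>" "y \<in> \<Omega>"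
  shows "K y x = cnj (K x y)"
proof (cases "x = y")
  case True
  then show ?thesis using psd_kernel_diag[OF assms(1,2)]
    by (auto simp: complex_nonneg_Reals_iff complex_eq_iff)
next
  case False
  have 1: "Im (K x x) = 0" "Im (K y y) = 0"
    using psd_kernel_diag[OF assms(1)] assms(2,3) by (auto simp: complex_nonneg_Reals_iff)
  show ?thesis
    using psd_kernel_pair[OF assms False, of 1 1] psd_kernel_pair[OF assms False, of 1 \<i>] 1
    by (auto simp: complex_nonneg_Reals_iff complex_eq_iff)
qed

lemma psd_kernel_null_row:
  assumes "psd_kernel \<Omega> K" "x \<in> \<Omega>" "y \<in> \<Omega>" "K x x = 0"
  shows "K x y = 0"
proof (cases "x = y")
  case False
  show ?thesis
  proof (rule ccontr)
    assume nz: "K x y \<noteq> 0"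
    \<comment> \<open>With coefficients - t K x y at x and 1 at y the form is -2 t |K x y|^2 + K y
      y. This t turns it into - K y y - 2, which is negative.\<close>
    define t where "t = (Re (K y y) + 1) / (cmod (K x y))\<^sup>2"
    have "cnj (- of_real t * K x y) * 1 * K x y + cnj 1 * (- of_real t * K x y) * K y x + K y y \<in> \<real>\<^sub>\<ge>\<^sub>0"
      using psd_kernel_pair[OF assms(1-3) False, of "- of_real t * K x y" 1] assms(4) by simp
    then have "0 \<le> Re (cnj (- of_real t * K x y) * 1 * K x y + cnj 1 * (- of_real t * K x y) * K y x + K y y)"
      by (auto simp: complex_nonneg_Reals_iff)
    also have "\<dots> = - 2 * (t * (cmod (K x y))\<^sup>2) + Re (K y y)"
      unfolding psd_kernel_hermitian[OF assms(1-3)] cmod_power2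
      by (simp add: algebra_simps power2_eq_square)
    also have "t * (cmod (K x y))\<^sup>2 = Re (K y y) + 1" using nz by (simp add: t_def)
    finally have "Re (K y y) \<le> -2" by simp
    moreover have "Re (K y y) \<ge> 0"
      using psd_kernel_diag[OF assms(1,3)] by (auto simp: complex_nonneg_Reals_iff)
    ultimately show False by simp
  qed
qed (use assms in simp)

lemma psd_kernel_schur_complement:
  assumes "psd_kernel (insert a F) K" "finite F" "a \<notin> F" "K a a \<noteq> 0"
  shows "psd_kernel F (\<lambda>x y. K x y - K x a * K a y / K a a)"
proof (rule psd_kernel_finiteI[OF assms(2)])
  fix c :: "'a \<Rightarrow> complex"
  define t where "t = (\<Sum>y\<in>F. c y * K a y)"
  define S where "S = (\<Sum>x\<in>F. \<Sum>y\<in>F. cnj (c x) * c y * K x y)"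
  have k: "cnj (K a a) = K a a"
    using psd_kernel_hermitian[OF assms(1), of a a] by simp
  have t': "(\<Sum>x\<in>F. cnj (c x) * K x a) = cnj t"
    unfolding t_def cnj_sum using psd_kernel_hermitian[OF assms(1), of a]
    by (intro sum.cong) auto
  \<comment> \<open>Completing the square: this value at \<open>a\<close> minimises the form for
    given coefficients on \<open>F\<close>, and the minimum is the form of the Schur
    complement.\<close>
  define c' where "c' x = (if x = a then - t / K a a else c x)" for x
  have "(\<Sum>x\<in>insert a F. \<Sum>y\<in>insert a F. cnj (c' x) * c' y * K x y) =
      cnj (- t / K a a) * (- t / K a a) * K a a + cnj (- t / K a a) * (\<Sum>y\<in>F. c y * K a y)
      + (\<Sum>x\<in>F. cnj (c x) * K x a) * (- t / K a a) + S"
    unfolding sum_sum_insert[OF assms(2,3)] S_def sum_distrib_left sum_distrib_right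
    using assms(3) by (intro arg_cong2[where f="(+)"] sum.cong) (auto simp: c'_def)
  also have "\<dots> = S - cnj t * t / K a a"
    unfolding t' t_def[symmetric] using assms(4) k by (simp add: field_simps)
  also have "cnj t * t / K a a = (\<Sum>x\<in>F. \<Sum>y\<in>F. cnj (c x) * K x a * (c y * K a y)) / K a a"
    unfolding t'[symmetric] unfolding t_def sum_product ..
  also have "S - \<dots> = (\<Sum>x\<in>F. \<Sum>y\<in>F. cnj (c x) * c y * (K x y - K x a * K a y / K a a))"
    unfolding S_def sum_divide_distrib sum_subtractf[symmetric]
    by (intro sum.cong) (auto simp: algebra_simps)
  finally show "(\<Sum>x\<in>F. \<Sum>y\<in>F. cnj (c x) * c y * (K x y - K x a * K a y / K a a)) \<in> \<real>\<^sub>\<ge>\<^sub>0"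
    using psd_kernelD[OF assms(1), of "insert a F" c'] assms(2) by simp
qed

text \<open>Cholesky factorisation, one Schur complement per point; a point with
  \<open>K a a = 0\<close> has a zero row and gets the zero vector. The bound
  \<open>r \<ge> 1\<close> is recorded because \<open>r\<close> later serves as the number of
  columns of a Pick problem.\<close>

lemma psd_kernel_gram:
  assumes "finite F" "psd_kernel F K"
  shows "\<exists>r\<ge>1. \<exists>L :: 'a \<Rightarrow> nat \<Rightarrow> complex. \<forall>x\<in>F. \<forall>y\<in>F. K x y = (\<Sum>l<r. L x l * cnj (L y l))"
  using assms
proof (induction F arbitrary: K rule: finite_induct)
  case (insert a F)
  show ?case
  proof (cases "K a a = 0")
    case True
    obtain r :: nat and L where r: "r \<ge> 1"
      and L: "\<And>x y. x \<in> F \<Longrightarrow> y \<in> F \<Longrightarrow> K x y = (\<Sum>l<r. L x l * cnj (L y l))"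
      using insert.IH[OF psd_kernel_subset[OF insert.prems subset_insertI]] by blast
    have 0: "K a x = 0 \<and> K x a = 0" if "x \<in> insert a F" for x
      using psd_kernel_null_row[OF insert.prems, of a x] that True
        psd_kernel_hermitian[OF insert.prems, of a x] by auto
    define M where "M x l = (if x = a then 0 else L x l)" for x l
    have "K x y = (\<Sum>l<r. M x l * cnj (M y l))"
      if "x \<in> insert a F" "y \<in> insert a F" for x y
    proof (cases "x = a \<or> y = a")
      case False
      then show ?thesis using that L[of x y] by (simp add: M_def)
    qed (use 0 that in \<open>auto simp: M_def\<close>)
    then show ?thesis using r by (intro exI[of _ r] conjI exI[of _ M]) auto
  next
    case False
    define k where "k = sqrt (Re (K a a))"
    have kk: "complex_of_real k * of_real k = K a a"
      using psd_kernel_diag[OF insert.prems, of a]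
      by (auto simp: k_def complex_nonneg_Reals_iff complex_eq_iff)
    obtain r :: nat and L where r: "r \<ge> 1"
      and L: "\<And>x y. x \<in> F \<Longrightarrow> y \<in> F \<Longrightarrow>
        K x y - K x a * K a y / K a a = (\<Sum>l<r. L x l * cnj (L y l))"
      using insert.IH[OF psd_kernel_schur_complement[OF insert.prems insert.hyps False]] by blast
    \<comment> \<open>The new column \<open>r\<close> carries the rank-one part split off at
      \<open>a\<close>; the older columns vanish at \<open>a\<close>.\<close>
    define M where "M x l = (if l = r then K x a / of_real k else if x = a then 0 else L x l)" for x l
    have M: "(\<Sum>l<Suc r. M x l * cnj (M y l)) =
        (if x = a \<or> y = a then 0 else \<Sum>l<r. L x l * cnj (L y l)) + K x a * K a y / K a a"
      if "x \<in> insert a F" "y \<in> insert a F" for x y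
      using psd_kernel_hermitian[OF insert.prems, of y a] that kk by (auto simp: M_def)
    have "K x y = (\<Sum>l<Suc r. M x l * cnj (M y l))" if "x \<in> insert a F" "y \<in> insert a F" for x y
      unfolding M[OF that] using that False L[of x y] by (auto simp: diff_eq_eq)
    then show ?thesis by (intro exI[of _ "Suc r"]) auto
  qed
qed auto

text \<open>A solution expands the orthogonal projection of \<open>x\<close> onto the span of the
  \<open>r a\<close>. One Gram-Schmidt step per vector produces it without inverting the Gram
  matrix, which may be singular: the vectors on which the lurking isometry is defined can be
  dependent.\<close>

lemma normal_equations_solvable:
  fixes r :: "'a \<Rightarrow> 'j \<Rightarrow> complex"
  assumes "finite S" "finite X"
  defines "ip \<equiv> \<lambda>u v :: 'j \<Rightarrow> complex. \<Sum>j\<in>S. u j * cnj (v j)"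
  shows "\<exists>\<gamma>. \<forall>b\<in>X. (\<Sum>a\<in>X. \<gamma> a * ip (r a) (r b)) = ip x (r b)"
  using assms(2)
proof (induction X arbitrary: x rule: finite_induct)
  case (insert c X)
  obtain \<delta> where \<delta>: "\<And>b. b \<in> X \<Longrightarrow> (\<Sum>a\<in>X. \<delta> a * ip (r a) (r b)) = ip (r c) (r b)"
    using insert.IH[of "r c"] by blast
  obtain \<gamma> where \<gamma>: "\<And>b. b \<in> X \<Longrightarrow> (\<Sum>a\<in>X. \<gamma> a * ip (r a) (r b)) = ip x (r b)"
    using insert.IH[of x] by blast
  have sub: "ip (\<lambda>j. u j - v j) w = ip u w - ip v w" for u v w
    by (simp add: ip_def algebra_simps sum_subtractf)
  have lin: "ip (\<lambda>j. \<Sum>a\<in>X. k a * r a j) w = (\<Sum>a\<in>X. k a * ip (r a) w)" for k w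
    unfolding ip_def sum_distrib_left sum_distrib_right
    by (subst sum.swap) (simp add: mult_ac)
  have cnj_ip: "ip u v = cnj (ip v u)" for u v by (simp add: ip_def mult_ac)
  \<comment> \<open>The part of \<open>r c\<close> orthogonal to the earlier vectors. If its length
    is 0, \<open>r c\<close> adds nothing to the span and gets coefficient 0.\<close>
  define e where "e = (\<lambda>j. r c j - (\<Sum>a\<in>X. \<delta> a * r a j))"
  have e_b: "ip e (r b) = 0" if "b \<in> X" for b
    using \<delta>[OF that] by (simp add: e_def sub lin)
  define y where "y = (\<lambda>j. x j - (\<Sum>a\<in>X. \<gamma> a * r a j))"
  have y_b: "ip y (r b) = 0" if "b \<in> X" for b
    using \<gamma>[OF that] by (simp add: y_def sub lin)
  have orth: "ip u e = ip u (r c)" if "\<And>b. b \<in> X \<Longrightarrow> ip u (r b) = 0" for u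
  proof -
    have "ip e u = ip (r c) u"
      unfolding e_def sub lin using that cnj_ip[of _ u] by simp
    then show ?thesis using cnj_ip by metis
  qed
  show ?case
  proof (cases "ip e e = 0")
    case True
    have "(\<Sum>j\<in>S. (cmod (e j))\<^sup>2) = 0"
      unfolding cmod_power2 using arg_cong[OF True, of Re]
      by (simp add: ip_def power2_eq_square)
    then have "\<forall>j\<in>S. e j = 0" using assms(1) by (subst (asm) sum_nonneg_eq_0_iff) auto
    then have "ip y e = 0" by (simp add: ip_def)
    then have "ip y (r c) = 0" using orth[OF y_b] by simp
    then have "(\<Sum>a\<in>X. \<gamma> a * ip (r a) (r b)) = ip x (r b)" if "b \<in> insert c X" for b
      using \<gamma>[of b] that by (auto simp: y_def sub lin)
    moreover have "(\<Sum>a\<in>insert c X. (\<gamma>(c := 0)) a * w a) = (\<Sum>a\<in>X. \<gamma> a * w a)" for w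
      using insert.hyps by (auto intro!: sum.cong)
    ultimately show ?thesis by (intro exI[of _ "\<gamma>(c := 0)"]) auto
  next
    case False
    define t where "t = ip y e / ip e e"
    \<comment> \<open>The projection gains \<open>t * e\<close>, rewritten in terms of
      \<open>r c\<close> and the earlier vectors.\<close>
    define \<gamma>' where "\<gamma>' = (\<lambda>a. if a = c then t else \<gamma> a - t * \<delta> a)"
    have "(\<Sum>a\<in>insert c X. \<gamma>' a * ip (r a) w) = t * ip e w + ip x w - ip y w" for w
    proof -
      have "(\<Sum>a\<in>insert c X. \<gamma>' a * ip (r a) w) =
          t * ip (r c) w + (\<Sum>a\<in>X. \<gamma> a * ip (r a) w - t * (\<delta> a * ip (r a) w))"
        using insert.hyps
        by (auto simp: \<gamma>'_def algebra_simps intro!: sum.cong)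
      also have "\<dots> = t * ip e w + ip x w - ip y w"
        by (simp add: e_def y_def sub lin sum_subtractf sum_distrib_left algebra_simps)
      finally show ?thesis .
    qed
    moreover have "t * ip e (r b) = ip y (r b)" if "b \<in> insert c X" for b
      using that e_b y_b orth[OF e_b] orth[OF y_b] False by (auto simp: t_def)
    ultimately show ?thesis by (intro exI[of _ \<gamma>']) auto
  qed
qed auto

lemma psd_kernel_insert_zero:
  assumes "psd_kernel F G" "finite F" "z \<notin> F"
    and "\<And>y. y \<in> insert z F \<Longrightarrow> G z y = 0 \<and> G y z = 0"
  shows "psd_kernel (insert z F) G"
  by (rule psd_kernel_finiteI)
    (use assms psd_kernelD[OF assms(1,2) subset_refl] in \<open>auto simp: sum_sum_insert[OF assms(2,3)]\<close>)

lemma psd_kernel_rank_one: "psd_kernel \<Omega> (\<lambda>x y. a x * cnj (a y))"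
  unfolding psd_kernel_def
proof (intro allI impI)
  fix F and c :: "'a \<Rightarrow> complex"
  have "(\<Sum>x\<in>F. \<Sum>y\<in>F. cnj (c x) * c y * (a x * cnj (a y))) =
      (\<Sum>x\<in>F. cnj (c x) * a x) * cnj (\<Sum>x\<in>F. cnj (c x) * a x)"
    by (simp add: sum_product mult_ac)
  also have "\<dots> = of_real ((cmod (\<Sum>x\<in>F. cnj (c x) * a x))\<^sup>2)"
    by (rule complex_norm_square[symmetric])
  finally show "(\<Sum>x\<in>F. \<Sum>y\<in>F. cnj (c x) * c y * (a x * cnj (a y))) \<in> \<real>\<^sub>\<ge>\<^sub>0"
    by (simp add: complex_nonneg_Reals_iff del: of_real_power)
qed

lemma psd_kernel_rescale:
  assumes "psd_kernel \<Omega> N"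
  shows "psd_kernel \<Omega> (\<lambda>x y. N x y / (a x * cnj (a y)))"
  unfolding psd_kernel_def
proof (intro allI impI)
  fix F and c :: "'a \<Rightarrow> complex" assume F: "finite F" "F \<subseteq> \<Omega>"
  show "(\<Sum>x\<in>F. \<Sum>y\<in>F. cnj (c x) * c y * (N x y / (a x * cnj (a y)))) \<in> \<real>\<^sub>\<ge>\<^sub>0"
    using psd_kernelD[OF assms F, of "\<lambda>x. c x / cnj (a x)"] by (simp add: mult_ac)
qed

lemma psd_kernel_LIMSEQ:
  assumes "finite F" "\<And>n :: nat. psd_kernel F (N n)"
    and "\<And>x y. x \<in> F \<Longrightarrow> y \<in> F \<Longrightarrow> (\<lambda>n. N n x y) \<longlonglongrightarrow> L x y"
  shows "psd_kernel F L"
proof (rule psd_kernel_finiteI[OF assms(1)])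
  fix c :: "'a \<Rightarrow> complex"
  have "(\<lambda>n. \<Sum>x\<in>F. \<Sum>y\<in>F. cnj (c x) * c y * N n x y) \<longlonglongrightarrow> (\<Sum>x\<in>F. \<Sum>y\<in>F. cnj (c x) * c y * L x y)"
    by (intro tendsto_sum tendsto_mult_left assms(3))
  moreover have "(\<Sum>x\<in>F. \<Sum>y\<in>F. cnj (c x) * c y * N n x y) \<in> \<real>\<^sub>\<ge>\<^sub>0" for n
    by (rule psd_kernelD[OF assms(2,1) subset_refl])
  ultimately show "(\<Sum>x\<in>F. \<Sum>y\<in>F. cnj (c x) * c y * L x y) \<in> \<real>\<^sub>\<ge>\<^sub>0"
    by (intro Lim_in_closed_set[OF closed_nonneg_Reals_complex _ trivial_limit_sequentially]) auto
qed

lemma index_one_minus_mult_adjoint: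
  fixes A B :: "complex mat"
  assumes "A \<in> carrier_mat p q" "B \<in> carrier_mat p q" "i < p" "k < p"
  shows "(1\<^sub>m p - A * mat_adjoint B) $$ (i, k) =
    (if i = k then 1 else 0) - (\<Sum>l<q. A $$ (i, l) * cnj (B $$ (k, l)))"
proof -
  have *: "col (mat_adjoint B) k = conjugate (row B k)"
    using assms by (auto simp: mat_adjoint_def mat_of_rows_def intro!: eq_vecI)
  have "dim_col (mat_adjoint B) = p" "dim_row (mat_adjoint B) = q"
    using assms by (auto simp: mat_adjoint_def)
  with assms show ?thesis
    by (simp add: * scalar_prod_def lessThan_atLeast0)
qed

section \<open>The necessity half of the McCullough--Quiggin theorem\<close>

context rkhs
begin

lemma sum_mem:
  assumes "finite X" "\<And>y. y \<in> X \<Longrightarrow> f y \<in> H"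
  shows "(\<lambda>x. \<Sum>y\<in>X. c y * f y x) \<in> H"
  using assms
proof (induction X rule: finite_induct)
  case (insert a X)
  then show ?case using add_mem[OF scale_mem, of "f a" _ "c a"] by simp
qed (simp add: zero_mem)

lemma ip_sum_left:
  assumes "finite X" "\<And>y. y \<in> X \<Longrightarrow> f y \<in> H" "h \<in> H"
  shows "ip (\<lambda>x. \<Sum>y\<in>X. c y * f y x) h = (\<Sum>y\<in>X. c y * ip (f y) h)"
  using assms
proof (induction X rule: finite_induct)
  case empty
  then show ?case using ip_scale[OF zero_mem, of h 0] by simp
next
  case (insert a X)
  then show ?case
    using ip_add[OF scale_mem sum_mem, of "f a" X f h "c a" c] ip_scale[of "f a" h "c a"] by simp
qed

lemma ip_sum_right:
  assumes "finite X" "\<And>y. y \<in> X \<Longrightarrow> f y \<in> H" "h \<in> H"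
  shows "ip h (\<lambda>x. \<Sum>y\<in>X. c y * f y x) = (\<Sum>y\<in>X. cnj (c y) * ip h (f y))"
proof -
  have "ip h (\<lambda>x. \<Sum>y\<in>X. c y * f y x) = cnj (\<Sum>y\<in>X. c y * ip (f y) h)"
    using ip_commute[OF sum_mem[OF assms(1,2)] assms(3)] ip_sum_left[OF assms] by simp
  also have "\<dots> = (\<Sum>y\<in>X. cnj (c y) * ip h (f y))"
    unfolding cnj_sum complex_cnj_mult using ip_commute[OF assms(2,3)] by (intro sum.cong) auto
  finally show ?thesis .
qed

lemma psd_kernel: "psd_kernel \<Omega> K"
  unfolding psd_kernel_def
proof (intro allI impI)
  fix F and c :: "'a \<Rightarrow> complex" assume F: "finite F" "F \<subseteq> \<Omega>"
  define e where "e y = (\<lambda>x. if x \<in> \<Omega> then K x y else 0)" for y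
  have e: "e y \<in> H" if "y \<in> F" for y using kernel_mem[of y] that F by (auto simp: e_def)
  define g where "g = (\<lambda>x. \<Sum>y\<in>F. c y * e y x)"
  have g: "g \<in> H" unfolding g_def by (rule sum_mem[OF F(1) e])
  have "ip g g = (\<Sum>x\<in>F. cnj (c x) * ip g (e x))"
    using ip_sum_right[OF F(1) e g, where c = c] by (simp add: g_def)
  also have "\<dots> = (\<Sum>x\<in>F. cnj (c x) * g x)"
    using reproducing[OF g] F(2) by (intro sum.cong) (auto simp: e_def)
  also have "\<dots> = (\<Sum>x\<in>F. \<Sum>y\<in>F. cnj (c x) * c y * K x y)"
    unfolding g_def sum_distrib_left using F(2) by (intro sum.cong) (auto simp: e_def mult_ac)
  finally show "(\<Sum>x\<in>F. \<Sum>y\<in>F. cnj (c x) * c y * K x y) \<in> \<real>\<^sub>\<ge>\<^sub>0"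
    using ip_nonneg[OF g] by simp
qed

text \<open>Functions vanishing at \<open>a\<close> are preserved by multipliers, and the reproducing kernel of the
  subspace they form is the Schur complement of \<open>K\<close> at \<open>a\<close>.\<close>

lemma psd_kernel_compress:
  assumes mult: "is_multiplier \<Omega> H 1 q \<phi>" "mult_norm_le_one H ip 1 q \<phi>"
    and a: "a \<in> \<Omega>" "K a a \<noteq> 0" and F: "finite F" "F \<subseteq> \<Omega>"
  shows "psd_kernel F (\<lambda>x y. (1 - (\<Sum>k<q. \<phi> x $$ (0,k) * cnj (\<phi> y $$ (0,k)))) *
    (K x y - K x a * K a y / K a a))"
proof (rule psd_kernel_finiteI[OF F(1)])
  fix c :: "'a \<Rightarrow> complex"
  define D where "D x y = K x y - K x a * K a y / K a a" for x y
  define kf where "kf y = (\<lambda>x. if x \<in> \<Omega> then K x y else 0)" for y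
  have kf: "kf y \<in> H" if "y \<in> \<Omega>" for y using kernel_mem[OF that] by (simp add: kf_def)
  have rep: "ip h (kf y) = h y" if "h \<in> H" "y \<in> \<Omega>" for h y
    using reproducing[OF that] by (simp add: kf_def)
  \<comment> \<open>The kernel section at \<open>y\<close> of the subspace of functions vanishing at
    \<open>a\<close>.\<close>
  define e where "e y = (\<lambda>x. kf y x + (- (K a y / K a a)) * kf a x)" for y
  have e: "e y \<in> H" if "y \<in> \<Omega>" for y
    unfolding e_def by (intro add_mem scale_mem kf that a(1))
  have eD: "e y x = D x y" if "x \<in> \<Omega>" for x y
    using that by (simp add: e_def kf_def D_def)
  have ea: "e y a = 0" for y using a by (simp add: e_def kf_def)
  have rep_e: "ip h (e y) = h y" if "h \<in> H" "y \<in> \<Omega>" "h a = 0" for h y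
  proof -
    have "ip (e y) h = ip (kf y) h + (- (K a y / K a a)) * ip (kf a) h"
      unfolding e_def using that a
      by (simp only: ip_add[OF kf scale_mem[OF kf] that(1)] ip_scale[OF kf that(1)])
    then have "cnj (ip (e y) h) = ip h (kf y) + cnj (- (K a y / K a a)) * ip h (kf a)"
      unfolding ip_commute[OF kf[OF that(2)] that(1)] ip_commute[OF kf[OF a(1)] that(1)] by simp
    then show ?thesis
      unfolding ip_commute[OF e[OF that(2)] that(1)] using rep that a(1) by simp
  qed
  have eF: "e y \<in> H" if "y \<in> F" for y using e F(2) that by blast
  \<comment> \<open>The adjoint of the compressed multiplication, applied to the \<open>g\<close>
    defined below, written out by hand. Hence \<open>ip h g\<close> equals the squared norm
    \<open>A\<close> of \<open>f\<close>.\<close>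
  define f where "f k = (\<lambda>x. \<Sum>y\<in>F. (c y * cnj (\<phi> y $$ (0,k))) * e y x)" for k
  have f: "f k \<in> H" for k unfolding f_def by (rule sum_mem[OF F(1) eF])
  have fa: "f k a = 0" for k by (simp add: f_def ea)
  define h where "h = mult_op q \<phi> f 0"
  have h: "h \<in> H" using mult(1) f by (auto simp: is_multiplier_def h_def)
  have ha: "h a = 0" by (simp add: h_def mult_op_def fa)
  define g where "g = (\<lambda>x. \<Sum>y\<in>F. c y * e y x)"
  have g: "g \<in> H" unfolding g_def by (rule sum_mem[OF F(1) eF])
  have ga: "g a = 0" by (simp add: g_def ea)
  have ip_g: "ip u g = (\<Sum>x\<in>F. cnj (c x) * u x)" if "u \<in> H" "u a = 0" for u
    unfolding g_def using ip_sum_right[OF F(1) eF that(1)] rep_e[OF that(1) _ that(2)] F(2)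
    by (auto intro!: sum.cong)
  have ip_f: "ip u (f k) = (\<Sum>x\<in>F. cnj (c x) * \<phi> x $$ (0,k) * u x)" if "u \<in> H" "u a = 0" for u k
    unfolding f_def using ip_sum_right[OF F(1) eF that(1)] rep_e[OF that(1) _ that(2)] F(2)
    by (auto intro!: sum.cong)
  define A where "A = (\<Sum>k<q. ip (f k) (f k))"
  have hg: "ip h g = A"
    unfolding ip_g[OF h ha] A_def ip_f[OF f fa] unfolding h_def mult_op_def sum_distrib_left
    by (subst sum.swap) (simp add: mult_ac)
  have "A \<in> \<real>\<^sub>\<ge>\<^sub>0" unfolding A_def
    using ip_nonneg[OF f] by (auto simp: complex_nonneg_Reals_iff intro: sum_nonneg)
  then have A: "Im A = 0" "Re A \<ge> 0" by (auto simp: complex_nonneg_Reals_iff)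
  have norm_sq: "(ip_norm ip u)\<^sup>2 = Re (ip u u)" if "u \<in> H" for u
    using ip_nonneg[OF that] by (simp add: ip_norm_def complex_nonneg_Reals_iff)
  have "tuple_norm ip 1 (mult_op q \<phi> f) \<le> tuple_norm ip q f"
    using mult(2) f by (auto simp: mult_norm_le_one_def)
  then have hh: "Re (ip h h) \<le> Re A"
    unfolding tuple_norm_def real_sqrt_le_iff
    by (simp add: h_def[symmetric] norm_sq h f A_def)
  \<comment> \<open>The squared norm of h - g is |h|^2 - 2 A + |g|^2, and contractivity gives |h|^2
    \<le> A. What remains is A \<le> |g|^2.\<close>
  define v where "v = (\<lambda>x. h x + (-1) * g x)"
  have v: "v \<in> H" unfolding v_def by (intro add_mem scale_mem h g)
  have left: "ip v u = ip h u - ip g u" if "u \<in> H" for u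
    unfolding v_def using ip_add[OF h scale_mem[OF g] that, of "-1"] ip_scale[OF g that, of "-1"] by simp
  have "ip g h = cnj A" "cnj (ip h h) = ip h h" "cnj (ip g g) = ip g g"
    using ip_commute[OF h g] ip_commute[OF h h] ip_commute[OF g g] hg by simp_all
  then have "ip v v = ip h h - A - cnj A + ip g g"
    unfolding left[OF v] ip_commute[OF v h] ip_commute[OF v g] left[OF h] left[OF g] hg by simp
  moreover have "0 \<le> Re (ip v v)" using ip_nonneg[OF v] by (simp add: complex_nonneg_Reals_iff)
  ultimately have "0 \<le> Re (ip g g - A)" using hh by simp
  moreover have "Im (ip g g - A) = 0" using A ip_nonneg[OF g] by (simp add: complex_nonneg_Reals_iff)
  ultimately have "ip g g - A \<in> \<real>\<^sub>\<ge>\<^sub>0" by (simp add: complex_nonneg_Reals_iff)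
  also have "ip g g = (\<Sum>x\<in>F. \<Sum>y\<in>F. cnj (c x) * c y * D x y)"
    unfolding ip_g[OF g ga] unfolding g_def sum_distrib_left using F(2)
    by (intro sum.cong) (auto simp: eD mult_ac)
  also have "A = (\<Sum>k<q. \<Sum>x\<in>F. \<Sum>y\<in>F. cnj (c x) * c y * (\<phi> x $$ (0,k) * cnj (\<phi> y $$ (0,k))) * D x y)"
    unfolding A_def ip_f[OF f fa] unfolding f_def sum_distrib_left using F(2)
    by (intro sum.cong) (auto simp: eD mult_ac)
  also have "\<dots> = (\<Sum>x\<in>F. \<Sum>y\<in>F. cnj (c x) * c y * (\<Sum>k<q. \<phi> x $$ (0,k) * cnj (\<phi> y $$ (0,k))) * D x y)"
    by (subst sum.swap, intro sum.cong refl, subst sum.swap)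
      (simp add: sum_distrib_left sum_distrib_right)
  finally show "(\<Sum>x\<in>F. \<Sum>y\<in>F. cnj (c x) * c y * ((1 - (\<Sum>k<q. \<phi> x $$ (0,k) * cnj (\<phi> y $$ (0,k)))) *
      (K x y - K x a * K a y / K a a))) \<in> \<real>\<^sub>\<ge>\<^sub>0"
    unfolding D_def[symmetric] sum_subtractf[symmetric]
    by (elim back_subst[of "\<lambda>s. s \<in> \<real>\<^sub>\<ge>\<^sub>0"], intro sum.cong refl) (simp add: algebra_simps)
qed

end

text \<open>The induction hypothesis with base point \<open>z\<close> makes
  \<open>1 - K x z * K z y / (K z z * K x y)\<close> a Gram matrix of row vectors \<open>W x\<close>, for which the Pick
  matrix is the rank-one kernel \<open>K x z * K z y / K z z\<close>. Compressing a solution of this Pick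
  problem at \<open>a\<close> and dividing by the rank-one kernel gives the claim (Knese).\<close>

theorem cnp_kernel_quotient_psd:
  assumes cnp: "cnp_kernel \<Omega> K" and sub: "\<Omega>' \<subseteq> \<Omega>"
    and nz: "\<And>x y. x \<in> \<Omega>' \<Longrightarrow> y \<in> \<Omega>' \<Longrightarrow> K x y \<noteq> 0"
    and F: "finite F" "F \<subseteq> \<Omega>'" and a: "a \<in> \<Omega>'"
  shows "psd_kernel F (\<lambda>x y. 1 - K x a * K a y / (K a a * K x y))"
  using F a
proof (induction F arbitrary: a rule: finite_induct)
  case empty
  then show ?case by (simp add: psd_kernel_def)
next
  case (insert z F)
  define G where "G = (\<lambda>x y. 1 - K x z * K z y / (K z z * K x y))"
  let ?F = "insert z F"
  have F: "finite ?F" "?F \<subseteq> \<Omega>'" "z \<in> \<Omega>'" using insert by auto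
  have psdK: "psd_kernel \<Omega> K" using cnp by (simp add: cnp_kernel_def)
  have "psd_kernel ?F G"
  \<comment> \<open>With base point \<open>z\<close> the row and column of \<open>G\<close> at
    \<open>z\<close> vanish, so the induction hypothesis on \<open>F\<close> extends to
    \<open>insert z F\<close>.\<close>
  proof (rule psd_kernel_insert_zero[OF _ insert.hyps])
    show "psd_kernel F G" unfolding G_def using insert.IH[of z] insert.prems by auto
    show "G z y = 0 \<and> G y z = 0" if "y \<in> ?F" for y
      using nz[of z z] nz[of y z] nz[of z y] that F by (auto simp: G_def)
  qed
  from psd_kernel_gram[OF F(1) this] obtain r :: nat and L where r: "r \<ge> 1"
    and L: "\<And>x y. x \<in> ?F \<Longrightarrow> y \<in> ?F \<Longrightarrow> G x y = (\<Sum>l<r. L x l * cnj (L y l))" by blast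
  define W where "W x = mat 1 r (\<lambda>(_,l). L x l)" for x
  have W: "W x \<in> carrier_mat 1 r" for x by (simp add: W_def)
  define k where "k = sqrt (Re (K z z))"
  have kk: "of_real k * of_real k = K z z" "k \<noteq> 0"
    using psd_kernel_diag[OF psdK, of z] nz[of z z] F sub
    by (auto simp: k_def complex_nonneg_Reals_iff complex_eq_iff)
  define \<alpha> where "\<alpha> x = K x z / of_real k" for x
  have \<alpha>: "\<alpha> x * cnj (\<alpha> y) = K x z * K z y / K z z" if "y \<in> ?F" for x y
  proof -
    have "K z y = cnj (K y z)" using psd_kernel_hermitian[OF psdK, of y z] that F sub by blast
    then show ?thesis using kk by (simp add: \<alpha>_def)
  qed
  have pick: "pick_matrix K 1 W (x, i) (y, j) = \<alpha> x * cnj (\<alpha> y)"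
    if "x \<in> ?F" "y \<in> ?F" "i = 0" "j = 0" for x y i j
  proof -
    have "pick_matrix K 1 W (x, i) (y, j) = (1 - G x y) * K x y"
      using that L index_one_minus_mult_adjoint[OF W W, of 0 0 x y] by (simp add: pick_matrix_def W_def)
    then show ?thesis using nz[of x y] that F \<alpha>[OF that(2)] by (auto simp: G_def)
  qed
  have "psd_kernel (?F \<times> {..<1}) (pick_matrix K 1 W)"
    by (rule psd_kernel_cong[OF psd_kernel_rank_one[of _ "\<lambda>p. \<alpha> (fst p)"]])
      (auto simp: pick simp flip: One_nat_def)
  moreover obtain H ip where rk: "rkhs \<Omega> K H ip" and
    "\<forall>p\<ge>1. \<forall>q\<ge>1. \<forall>F W. finite F \<longrightarrow> F \<subseteq> \<Omega> \<longrightarrow> (\<forall>x\<in>F. W x \<in> carrier_mat p q) \<longrightarrow>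
      psd_kernel (F \<times> {..<p}) (pick_matrix K p W) \<longrightarrow>
      (\<exists>\<phi>. is_multiplier \<Omega> H p q \<phi> \<and> mult_norm_le_one H ip p q \<phi> \<and> (\<forall>x\<in>F. \<phi> x = W x))"
    using cnp unfolding cnp_kernel_def by (elim conjE exE) (rule that)
  from this(2)[rule_format, of 1 r ?F W] obtain \<phi> where mult: "is_multiplier \<Omega> H 1 r \<phi>"
    "mult_norm_le_one H ip 1 r \<phi>" and \<phi>: "\<And>x. x \<in> ?F \<Longrightarrow> \<phi> x = W x"
    using calculation r F(1) subset_trans[OF F(2) sub] W by auto
  have "psd_kernel ?F (\<lambda>x y. (1 - (\<Sum>k<r. \<phi> x $$ (0,k) * cnj (\<phi> y $$ (0,k)))) *
      (K x y - K x a * K a y / K a a))"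
    using rkhs.psd_kernel_compress[OF rk mult, of a ?F] insert.prems sub F nz[of a a] by blast
  then have "psd_kernel ?F (\<lambda>x y. ((1 - (\<Sum>k<r. \<phi> x $$ (0,k) * cnj (\<phi> y $$ (0,k)))) *
      (K x y - K x a * K a y / K a a)) / (\<alpha> x * cnj (\<alpha> y)))"
    by (rule psd_kernel_rescale)
  then show ?case
  proof (rule psd_kernel_cong)
    fix x y assume xy: "x \<in> ?F" "y \<in> ?F"
    have GG: "(\<Sum>k<r. \<phi> x $$ (0,k) * cnj (\<phi> y $$ (0,k))) = G x y"
      using xy L \<phi> by (simp add: W_def)
    have "x \<in> \<Omega>'" "y \<in> \<Omega>'" "a \<in> \<Omega>'" using xy F insert.prems by auto
    then have nz': "K x y \<noteq> 0" "K x z \<noteq> 0" "K z y \<noteq> 0" "K z z \<noteq> 0" "K a a \<noteq> 0"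
      using F by (simp_all add: nz)
    show "((1 - (\<Sum>k<r. \<phi> x $$ (0,k) * cnj (\<phi> y $$ (0,k)))) *
      (K x y - K x a * K a y / K a a)) / (\<alpha> x * cnj (\<alpha> y)) = 1 - K x a * K a y / (K a a * K x y)"
      unfolding GG \<alpha>[OF xy(2)] G_def using nz' by (simp add: field_simps)
  qed
qed

section \<open>Dirichlet series and Dirichlet convolution\<close>

text \<open>The index 0 is harmless because \<open>0 powr x = 0\<close>, so the sums run over the
  whole type.\<close>

definition dabs :: "(nat \<Rightarrow> 'a::real_normed_vector) \<Rightarrow> real \<Rightarrow> bool" where
  "dabs a \<sigma> \<longleftrightarrow> (\<lambda>n. norm (a n) * real n powr (- \<sigma>)) summable_on UNIV"

definition dser :: "(nat \<Rightarrow> complex) \<Rightarrow> complex \<Rightarrow> complex" where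
  "dser a s = (\<Sum>\<^sub>\<infinity>n. a n * of_nat n powr (- s))"

text \<open>Every number divides 0 and a sum over an infinite set is 0, so a convolution has no
  coefficient at 0.\<close>

definition dconv :: "(nat \<Rightarrow> 'a::comm_ring_1) \<Rightarrow> (nat \<Rightarrow> 'a) \<Rightarrow> nat \<Rightarrow> 'a" where
  "dconv a b n = (\<Sum>d | d dvd n. a d * b (n div d))"

definition delta1 :: "nat \<Rightarrow> 'a::comm_ring_1" where
  "delta1 n = (if n = 1 then 1 else 0)"

lemma norm_of_nat_powr: "norm (of_nat n powr s :: complex) = real n powr Re s"
  by (subst norm_powr_real_powr) auto

lemma of_nat_mult_powr: "(of_nat (m * n) :: complex) powr s = of_nat m powr s * of_nat n powr s"
  unfolding of_nat_mult by (rule powr_times_real) auto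

lemma dabs_iff_norm_summable:
  "dabs a (Re s) \<longleftrightarrow> (\<lambda>n. norm (a n * of_nat n powr (- s) :: complex)) summable_on UNIV"
  by (simp add: dabs_def norm_mult norm_of_nat_powr)

lemma dser_summable: "dabs a (Re s) \<Longrightarrow> (\<lambda>n. a n * of_nat n powr (- s)) summable_on UNIV"
  unfolding dabs_iff_norm_summable by (rule abs_summable_summable)

lemma dser_has_sum: "dabs a (Re s) \<Longrightarrow> ((\<lambda>n. a n * of_nat n powr (- s)) has_sum dser a s) UNIV"
  unfolding dser_def by (intro has_sum_infsum dser_summable)

lemma dabs_comparison:
  assumes "dabs b \<sigma>" "\<And>n. n \<ge> 1 \<Longrightarrow> norm (a n) \<le> norm (b n)"
  shows "dabs a \<sigma>"
  unfolding dabs_def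
proof (rule summable_on_comparison_test[OF assms(1)[unfolded dabs_def]])
  fix n :: nat
  show "norm (a n) * real n powr - \<sigma> \<le> norm (b n) * real n powr - \<sigma>"
    by (cases "n = 0") (auto intro!: mult_right_mono assms(2))
qed auto

lemma dabs_mono:
  assumes "dabs a \<sigma>" "\<sigma> \<le> \<sigma>'"
  shows "dabs a \<sigma>'"
  unfolding dabs_def
proof (rule summable_on_comparison_test[OF assms(1)[unfolded dabs_def]])
  fix n :: nat
  show "norm (a n) * real n powr - \<sigma>' \<le> norm (a n) * real n powr - \<sigma>"
    using assms(2) by (cases "n = 0") (auto intro!: mult_left_mono powr_mono)
qed auto

lemma dabs_zero: "dabs (\<lambda>_. 0) \<sigma>"
  by (simp add: dabs_def)

lemma dabs_add:
  assumes "dabs a \<sigma>" "dabs b \<sigma>"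
  shows "dabs (\<lambda>n. a n + b n) \<sigma>"
  unfolding dabs_def
proof (rule summable_on_comparison_test[OF summable_on_add[OF assms[unfolded dabs_def]]])
  fix n :: nat
  show "norm (a n + b n) * real n powr - \<sigma> \<le> norm (a n) * real n powr - \<sigma> + norm (b n) * real n powr - \<sigma>"
    using mult_right_mono[OF norm_triangle_ineq[of "a n" "b n"], of "real n powr - \<sigma>"]
    by (simp add: distrib_right)
qed auto

lemma dabs_cmult: "dabs a \<sigma> \<Longrightarrow> dabs (\<lambda>n. c * a n :: complex) \<sigma>"
  unfolding dabs_def norm_mult mult.assoc by (rule summable_on_cmult_right)

lemma dabs_sum:
  "(\<And>i. i \<in> I \<Longrightarrow> dabs (a i) \<sigma>) \<Longrightarrow> dabs (\<lambda>n. \<Sum>i\<in>I. a i n) \<sigma>"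
  by (induction I rule: infinite_finite_induct) (auto simp: dabs_zero intro!: dabs_add)

lemma dabs_of_real: "dabs (\<lambda>n. of_real (a n) :: complex) \<sigma> \<longleftrightarrow> dabs a \<sigma>"
  by (simp add: dabs_def)

lemma has_sum_finite_sum:
  fixes f :: "'i \<Rightarrow> 'a \<Rightarrow> 'b::real_normed_vector"
  assumes "\<And>i. i \<in> I \<Longrightarrow> (f i has_sum s i) A"
  shows "((\<lambda>x. \<Sum>i\<in>I. f i x) has_sum (\<Sum>i\<in>I. s i)) A"
  using assms by (induction I rule: infinite_finite_induct) (auto intro!: has_sum_add)

lemma dser_sum:
  assumes "\<And>i. i \<in> I \<Longrightarrow> dabs (a i) (Re s)"
  shows "dser (\<lambda>n. \<Sum>i\<in>I. a i n) s = (\<Sum>i\<in>I. dser (a i) s)"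
proof -
  have "((\<lambda>n. \<Sum>i\<in>I. a i n * of_nat n powr (- s)) has_sum (\<Sum>i\<in>I. dser (a i) s)) UNIV"
    by (intro has_sum_finite_sum dser_has_sum assms)
  then show ?thesis unfolding dser_def sum_distrib_right by (rule infsumI)
qed

lemma dser_add:
  assumes "dabs a (Re s)" "dabs b (Re s)"
  shows "dser (\<lambda>n. a n + b n) s = dser a s + dser b s"
  using has_sum_add[OF assms[THEN dser_has_sum]] unfolding dser_def
  by (intro infsumI) (simp add: distrib_right)

lemma dser_cmult: "dser (\<lambda>n. c * a n) s = c * dser a s"
  unfolding dser_def mult.assoc by (rule infsum_cmult_right')

lemma dser_delta1: "dser delta1 s = 1"
proof -
  have "dser delta1 s = (\<Sum>\<^sub>\<infinity>n\<in>{1::nat}. 1)"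
    unfolding dser_def by (rule infsum_cong_neutral) (auto simp: delta1_def)
  then show ?thesis by simp
qed

lemma dabs_delta1: "dabs (delta1 :: nat \<Rightarrow> 'a::real_normed_field) \<sigma>"
  unfolding dabs_def by (rule finite_nonzero_values_imp_summable_on)
    (rule finite_subset[of _ "{1}"], auto simp: delta1_def)

section \<open>Formal Dirichlet convolution\<close>

lemma dconv_0 [simp]: "dconv a b 0 = 0"
  by (simp add: dconv_def)

lemma dconv_delta1_right: "dconv a delta1 n = (if n = 0 then 0 else a n)"
proof (cases "n = 0")
  case False
  have "dconv a delta1 n = (\<Sum>d\<in>{n}. a d)"
    unfolding dconv_def using False
    by (intro sum.mono_neutral_cong_right)
      (auto simp: delta1_def dvd_div_eq_iff elim!: dvdE)
  then show ?thesis using False by simp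
qed simp

lemma dconv_commute: "dconv a b n = dconv b a n"
proof (cases "n = 0")
  case False
  then show ?thesis unfolding dconv_def
    by (intro sum.reindex_bij_witness[of _ "\<lambda>d. n div d" "\<lambda>d. n div d"]) (auto elim!: dvdE)
qed simp

lemma dconv_assoc: "dconv (dconv a b) c n = dconv a (dconv b c) n"
proof (cases "n = 0")
  case False
  have "dconv (dconv a b) c n = (\<Sum>(d,e)\<in>Sigma {d. d dvd n} (\<lambda>d. {e. e dvd d}). a e * b (d div e) * c (n div d))"
    unfolding dconv_def sum_distrib_right using False
    by (subst sum.Sigma) (auto intro: finite_divisors_nat dvd_pos_nat)
  also have "\<dots> = (\<Sum>(e,f)\<in>Sigma {e. e dvd n} (\<lambda>e. {f. f dvd n div e}). a e * (b f * c (n div e div f)))"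
    using False
    by (intro sum.reindex_bij_witness[of _ "\<lambda>(e,f). (e * f, e)" "\<lambda>(d,e). (e, d div e)"])
      (auto elim!: dvdE simp: mult_ac div_mult2_eq)
  also have "\<dots> = dconv a (dconv b c) n"
    unfolding dconv_def sum_distrib_left using False
    by (subst sum.Sigma) (auto intro!: finite_divisors_nat elim!: dvdE)
  finally show ?thesis .
qed simp

lemma dconv_sum_left: "dconv (\<lambda>n. \<Sum>i\<in>I. a i n) b n = (\<Sum>i\<in>I. dconv (a i) b n)"
  unfolding dconv_def sum_distrib_right by (rule sum.swap)

lemma dconv_sum_right: "dconv a (\<lambda>n. \<Sum>i\<in>I. b i n) n = (\<Sum>i\<in>I. dconv a (b i) n)"
  unfolding dconv_def sum_distrib_left by (rule sum.swap)

lemma dconv_add_left: "dconv (\<lambda>n. a n + b n) c n = dconv a c n + dconv b c n"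
  by (simp add: dconv_def distrib_right sum.distrib)

lemma dconv_add_right: "dconv c (\<lambda>n. a n + b n) n = dconv c a n + dconv c b n"
  by (simp add: dconv_def distrib_left sum.distrib)

lemma dconv_cmult_left: "dconv (\<lambda>n. k * a n) b n = k * dconv a b n"
  by (simp add: dconv_def sum_distrib_left mult.assoc)

lemma dconv_of_real: "dconv (\<lambda>n. of_real (a n)) (\<lambda>n. of_real (b n)) n = (of_real (dconv a b n) :: complex)"
  by (simp add: dconv_def)

text \<open>The absolutely convergent double series is regrouped by m = d e. Pairs with a zero index
  contribute nothing and are discarded first, because (d, e) to (d e, d) is a bijection onto the
  pairs of a number and a divisor only for positive d and e.\<close>

lemma
  assumes "dabs a (Re s)" "dabs b (Re s)"
  shows dabs_dconv: "dabs (dconv a b) (Re s)"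
    and dser_dconv: "dser (dconv a b) s = dser a s * dser b s"
proof -
  define \<alpha> where "\<alpha> n = a n * of_nat n powr (- s)" for n
  define \<beta> where "\<beta> n = b n * of_nat n powr (- s)" for n
  have \<alpha>: "(\<lambda>n. norm (\<alpha> n)) summable_on UNIV" and \<beta>: "(\<lambda>n. norm (\<beta> n)) summable_on UNIV"
    using assms unfolding dabs_iff_norm_summable \<alpha>_def \<beta>_def by auto
  define f where "f = (\<lambda>(d,e). \<alpha> d * \<beta> e)"
  define g where "g = (\<lambda>(m,d). a d * b (m div d) * of_nat m powr (- s))"
  define S where "S = Sigma {1::nat..} (\<lambda>m. {d. d dvd m})"
  have gf: "f (case p of (m, d) \<Rightarrow> (d, m div d)) = g p" if "p \<in> S" for p
  proof -
    obtain d e where "p = (d * e, d)" "d \<ge> 1"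
      using \<open>p \<in> S\<close> by (cases p) (auto simp: S_def elim!: dvdE)
    then show ?thesis
      by (simp add: f_def g_def \<alpha>_def \<beta>_def of_nat_mult_powr del: of_nat_mult)
  qed
  have f: "(\<lambda>p. norm (f p)) summable_on UNIV \<times> UNIV"
    unfolding Infinite_Sum.abs_summable_on_Sigma_iff using \<alpha> \<beta>
    by (auto simp: f_def norm_mult infsum_cmult_right' abs_mult intro!: summable_on_cmult_right summable_on_cmult_left)
  have "infsum f (UNIV \<times> UNIV) = (\<Sum>\<^sub>\<infinity>d. \<Sum>\<^sub>\<infinity>e. f (d, e))"
    by (rule infsum_Sigma_banach[symmetric]) (rule abs_summable_summable[OF f])
  also have "\<dots> = infsum \<alpha> UNIV * infsum \<beta> UNIV"
    by (simp add: f_def infsum_cmult_right' infsum_cmult_left')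
  finally have prod: "infsum f (UNIV \<times> UNIV) = infsum \<alpha> UNIV * infsum \<beta> UNIV" .
  have "infsum f (UNIV \<times> UNIV) = infsum f ({1..} \<times> {1..})"
    by (rule infsum_cong_neutral) (auto simp: f_def \<alpha>_def \<beta>_def not_le)
  also have "\<dots> = infsum g S"
    by (rule infsum_reindex_bij_witness[of S "\<lambda>(d,e). (d * e, d)" "\<lambda>(m,d). (d, m div d)", symmetric])
      (auto simp: gf, auto simp: S_def elim!: dvdE)
  finally have eq: "infsum g S = dser a s * dser b s"
    using prod by (simp add: dser_def \<alpha>_def[abs_def] \<beta>_def[abs_def])
  have "(\<lambda>p. norm (f p)) summable_on {1..} \<times> {1..}"
    by (rule summable_on_subset[OF f]) auto
  also have "?this \<longleftrightarrow> (\<lambda>p. norm (g p)) summable_on S"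
    by (rule summable_on_reindex_bij_witness[of S "\<lambda>(d,e). (d * e, d)" "\<lambda>(m,d). (d, m div d)", symmetric])
      (auto simp: gf, auto simp: S_def elim!: dvdE)
  finally have g: "(\<lambda>p. norm (g p)) summable_on S" .
  have inner: "(\<Sum>\<^sub>\<infinity>d\<in>{d. d dvd m}. g (m, d)) = dconv a b m * of_nat m powr (- s)" if "m \<ge> 1" for m
    using that by (simp add: g_def dconv_def sum_distrib_right finite_divisors_nat)
  have "dser (dconv a b) s = (\<Sum>\<^sub>\<infinity>m\<in>{1..}. dconv a b m * of_nat m powr (- s))"
    unfolding dser_def by (rule infsum_cong_neutral) (auto simp: not_le)
  also have "\<dots> = (\<Sum>\<^sub>\<infinity>m\<in>{1..}. \<Sum>\<^sub>\<infinity>d\<in>{d. d dvd m}. g (m, d))"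
    by (rule infsum_cong, rule inner[symmetric]) auto
  also have "\<dots> = infsum g S"
    unfolding S_def by (rule infsum_Sigma_banach) (use g in \<open>auto simp: S_def intro: abs_summable_summable\<close>)
  finally show "dser (dconv a b) s = dser a s * dser b s" using eq by simp
  have "(\<lambda>m. norm (\<Sum>\<^sub>\<infinity>d\<in>{d. d dvd m}. norm (g (m, d)))) summable_on {1..}"
    using g unfolding S_def Infinite_Sum.abs_summable_on_Sigma_iff by blast
  then have "(\<lambda>m. norm (dconv a b m * of_nat m powr (- s))) summable_on {1..}"
  proof (rule summable_on_comparison_test)
    fix m :: nat assume "m \<in> {1..}"
    then have m: "m \<ge> 1" by simp
    show "norm (dconv a b m * of_nat m powr (- s)) \<le> norm (\<Sum>\<^sub>\<infinity>d\<in>{d. d dvd m}. norm (g (m, d)))"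
      unfolding inner[OF m, symmetric] using m
      by (simp add: finite_divisors_nat norm_sum sum_nonneg)
  qed auto
  also have "?this \<longleftrightarrow> (\<lambda>m. norm (dconv a b m * of_nat m powr (- s))) summable_on UNIV"
    by (rule summable_on_cong_neutral) (auto simp: not_le)
  finally show "dabs (dconv a b) (Re s)" by (simp add: dabs_iff_norm_summable)
qed

text \<open>Multiplicativity turns the convolution equation into W = 1 + G W. The product form shows
  at once that neither factor vanishes.\<close>

lemma dser_renewal:
  fixes w g :: "nat \<Rightarrow> real"
  assumes "dabs g (Re s)" "dabs w (Re s)" "\<And>n. w n = delta1 n + dconv g w n"
  shows "dser (\<lambda>n. of_real (w n)) s * (1 - dser (\<lambda>n. of_real (g n)) s) = 1"
proof -
  have abs: "dabs (\<lambda>n. complex_of_real (g n)) (Re s)" "dabs (\<lambda>n. complex_of_real (w n)) (Re s)"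
    using assms(1,2) by (simp_all add: dabs_of_real)
  have "complex_of_real (w n) = delta1 n + dconv (\<lambda>n. of_real (g n)) (\<lambda>n. of_real (w n)) n" for n
    unfolding dconv_of_real by (subst assms(3)) (auto simp: delta1_def)
  then have "dser (\<lambda>n. of_real (w n)) s =
      dser (\<lambda>n. delta1 n + dconv (\<lambda>n. of_real (g n)) (\<lambda>n. of_real (w n)) n) s"
    by (intro arg_cong[where f = "\<lambda>a. dser a s"] ext)
  also have "\<dots> = 1 + dser (\<lambda>n. of_real (g n)) s * dser (\<lambda>n. of_real (w n)) s"
    by (simp add: dser_add[OF dabs_delta1 dabs_dconv[OF abs]] dser_dconv[OF abs] dser_delta1)
  finally show ?thesis by (simp add: algebra_simps)
qed

text \<open>The pairs with 1 \<le> d e \<le> N lie under a hyperbola inside the square of side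
  N.\<close>

lemma sum_divisors_le_sum_square:
  fixes f :: "nat \<Rightarrow> nat \<Rightarrow> real"
  assumes "\<And>d e. f d e \<ge> 0"
  shows "(\<Sum>n\<in>{1..N}. \<Sum>d | d dvd n. f d (n div d)) \<le> (\<Sum>d\<in>{1..N}. \<Sum>e\<in>{1..N}. f d e)"
proof -
  have "(\<Sum>n\<in>{1..N}. \<Sum>d | d dvd n. f d (n div d)) =
      (\<Sum>(n,d)\<in>Sigma {1..N} (\<lambda>n. {d. d dvd n}). f d (n div d))"
    by (subst sum.Sigma) (auto intro!: finite_divisors_nat)
  also have "\<dots> = (\<Sum>(d,e)\<in>{(d,e). 1 \<le> d * e \<and> d * e \<le> N}. f d e)"
    by (rule sum.reindex_bij_witness[of _ "\<lambda>(d,e). (d * e, d)" "\<lambda>(n,d). (d, n div d)"])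
      (auto elim!: dvdE)
  also have "\<dots> \<le> (\<Sum>(d,e)\<in>{1..N} \<times> {1..N}. f d e)"
  proof (rule sum_mono2)
    show "{(d,e). 1 \<le> d * e \<and> d * e \<le> N} \<subseteq> {1..N} \<times> {1..N}"
    proof
      fix p assume "p \<in> {(d,e). 1 \<le> d * e \<and> d * e \<le> N}"
      then obtain d e where p: "p = (d, e)" and *: "1 \<le> d * e" "d * e \<le> N" by auto
      then have "d \<ge> 1" "e \<ge> 1" by (cases "d = 0 \<or> e = 0"; auto)+
      then have "d * 1 \<le> d * e" "1 * e \<le> d * e" by (intro mult_le_mono; simp)+
      then have "d \<le> N" "e \<le> N" using *(2) by linarith+
      then show "p \<in> {1..N} \<times> {1..N}" using p \<open>d \<ge> 1\<close> \<open>e \<ge> 1\<close> by auto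
    qed
  qed (use assms in auto)
  also have "\<dots> = (\<Sum>d\<in>{1..N}. \<Sum>e\<in>{1..N}. f d e)" by (simp add: sum.cartesian_product)
  finally show ?thesis .
qed

lemma summable_on_nat_bounded:
  fixes f :: "nat \<Rightarrow> real"
  assumes "\<And>n. f n \<ge> 0" "f 0 = 0" "\<And>N. (\<Sum>n\<in>{1..N}. f n) \<le> C"
  shows "f summable_on UNIV"
proof -
  have "sum f F \<le> C" if F: "finite F" for F
  proof -
    obtain N where N: "F \<subseteq> {..N}" using F finite_nat_iff_bounded_le by blast
    have "sum f F \<le> sum f {..N}" using N assms(1) by (intro sum_mono2) auto
    also have "\<dots> = sum f {1..N}"
      using assms(2) by (intro sum.mono_neutral_right) (auto simp: not_le)
    finally show ?thesis using assms(3)[of N] by simp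
  qed
  then show ?thesis
    by (intro nonneg_bdd_above_summable_on[OF assms(1)] bdd_aboveI2[where M = C]) auto
qed

text \<open>The weight \<open>n powr (- \<sigma>)\<close> is multiplicative, so the inequality,
  weighted and cut off at N, reads V \<le> Q + c V. The truncated sum V is finite, hence c V may be
  subtracted, and Q / (1 - c) bounds it for all N.\<close>

lemma dabs_of_dconv_bound:
  fixes p q v :: "nat \<Rightarrow> real"
  assumes nonneg: "\<And>n. p n \<ge> 0" "\<And>n. q n \<ge> 0" "\<And>n. v n \<ge> 0"
    and bound: "\<And>n. n \<ge> 1 \<Longrightarrow> v n \<le> q n + dconv p v n"
    and p: "dabs p \<sigma>" "(\<Sum>\<^sub>\<infinity>n. p n * real n powr (- \<sigma>)) \<le> c" "c < 1"
    and q: "dabs q \<sigma>"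
  shows "dabs v \<sigma>"
proof -
  define e where "e n = real n powr (- \<sigma>)" for n
  have e: "e n \<ge> 0" "e 0 = 0" for n by (auto simp: e_def)
  define Q where "Q = (\<Sum>\<^sub>\<infinity>n. q n * e n)"
  have p': "(\<lambda>n. p n * e n) summable_on UNIV" and q': "(\<lambda>n. q n * e n) summable_on UNIV"
    using p(1) q nonneg by (auto simp: dabs_def e_def)
  have "(\<Sum>n\<in>{1..N}. v n * e n) \<le> Q / (1 - c)" for N
  proof -
    define V where "V = (\<Sum>n\<in>{1..N}. v n * e n)"
    have "V \<le> (\<Sum>n\<in>{1..N}. q n * e n + dconv p v n * e n)"
      unfolding V_def using bound e by (intro sum_mono) (auto simp flip: distrib_right intro!: mult_right_mono)
    also have "\<dots> = (\<Sum>n\<in>{1..N}. q n * e n) + (\<Sum>n\<in>{1..N}. \<Sum>d | d dvd n. (p d * e d) * (v (n div d) * e (n div d)))"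
      unfolding sum.distrib dconv_def sum_distrib_right
      by (intro arg_cong2[where f="(+)"] refl sum.cong)
        (auto simp: e_def powr_mult elim!: dvdE)
    also have "(\<Sum>n\<in>{1..N}. \<Sum>d | d dvd n. (p d * e d) * (v (n div d) * e (n div d)))
        \<le> (\<Sum>d\<in>{1..N}. \<Sum>k\<in>{1..N}. (p d * e d) * (v k * e k))"
      by (rule sum_divisors_le_sum_square) (use nonneg e in auto)
    also have "\<dots> = (\<Sum>d\<in>{1..N}. p d * e d) * V" by (simp add: V_def sum_product)
    also have "(\<Sum>d\<in>{1..N}. p d * e d) * V \<le> c * V"
    proof (rule mult_right_mono)
      have "(\<Sum>d\<in>{1..N}. p d * e d) \<le> (\<Sum>\<^sub>\<infinity>n. p n * e n)"
        using p' nonneg e by (intro finite_sum_le_infsum) auto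
      then show "(\<Sum>d\<in>{1..N}. p d * e d) \<le> c" using p(2) by (simp add: e_def)
      show "V \<ge> 0" unfolding V_def using nonneg e by (intro sum_nonneg) auto
    qed
    also have "(\<Sum>n\<in>{1..N}. q n * e n) \<le> Q"
      unfolding Q_def using q' nonneg e by (intro finite_sum_le_infsum) auto
    finally have "V * (1 - c) \<le> Q" by (simp add: algebra_simps)
    then show ?thesis using p(3) by (simp add: V_def pos_le_divide_eq)
  qed
  then have "(\<lambda>n. v n * e n) summable_on UNIV"
    using nonneg e by (intro summable_on_nat_bounded) auto
  then show ?thesis using nonneg by (simp add: dabs_def e_def)
qed

lemma dabs_tail_le:
  assumes "dabs a \<sigma>" "t \<ge> 0" "\<And>n. n < m \<Longrightarrow> a n = 0" "m \<ge> 1"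
  shows "(\<Sum>\<^sub>\<infinity>n. norm (a n) * real n powr (- (\<sigma> + t))) \<le>
    real m powr (- t) * (\<Sum>\<^sub>\<infinity>n. norm (a n) * real n powr (- \<sigma>))"
  unfolding infsum_cmult_right'[symmetric]
proof (rule infsum_mono)
  show "(\<lambda>n. norm (a n) * real n powr (- (\<sigma> + t))) summable_on UNIV"
    using dabs_mono[OF assms(1), of "\<sigma> + t"] assms(2) by (simp add: dabs_def)
  show "(\<lambda>n. real m powr (- t) * (norm (a n) * real n powr (- \<sigma>))) summable_on UNIV"
    using assms(1) unfolding dabs_def by (rule summable_on_cmult_right)
  show "norm (a n) * real n powr (- (\<sigma> + t)) \<le> real m powr (- t) * (norm (a n) * real n powr (- \<sigma>))" for n
  proof (cases "n < m")
    case False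
    then have "real n powr (- t) \<le> real m powr (- t)"
      using assms(2,4) by (intro powr_mono2') auto
    then have "norm (a n) * real n powr (- \<sigma>) * real n powr (- t) \<le> norm (a n) * real n powr (- \<sigma>) * real m powr (- t)"
      by (intro mult_left_mono) auto
    then show ?thesis by (simp add: powr_add mult_ac powr_diff powr_minus divide_simps)
  qed (simp add: assms(3))
qed

text \<open>The first possible coefficient sits at 2, so a shift by t to the right gains the factor
  \<open>2 powr (- t)\<close>.\<close>

lemma dabs_small:
  assumes "dabs a \<sigma>0" "a 0 = 0" "a 1 = 0" "\<epsilon> > 0"
  shows "\<exists>\<sigma>1\<ge>\<sigma>0. \<forall>\<sigma>\<ge>\<sigma>1. (\<Sum>\<^sub>\<infinity>n. norm (a n) * real n powr (- \<sigma>)) \<le> \<epsilon>"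
proof -
  define C where "C = (\<Sum>\<^sub>\<infinity>n. norm (a n) * real n powr (- \<sigma>0))"
  have C: "C \<ge> 0" unfolding C_def by (intro infsum_nonneg) auto
  have "(\<lambda>k. (1/2) ^ k * C) \<longlonglongrightarrow> 0 * C"
    by (intro tendsto_mult LIMSEQ_power_zero tendsto_const) auto
  then have "\<forall>\<^sub>F k in sequentially. (1/2) ^ k * C < \<epsilon>"
    using assms(4) by (intro order_tendstoD) auto
  then obtain k where k: "(1/2) ^ k * C < \<epsilon>" by (auto simp: eventually_sequentially)
  have "(\<Sum>\<^sub>\<infinity>n. norm (a n) * real n powr (- \<sigma>)) \<le> \<epsilon>" if "\<sigma> \<ge> \<sigma>0 + real k" for \<sigma>
  proof -
    have "a n = 0" if "n < 2" for n using that assms(2,3) less_2_cases by auto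
    then have "(\<Sum>\<^sub>\<infinity>n. norm (a n) * real n powr (- \<sigma>)) \<le> 2 powr (- (\<sigma> - \<sigma>0)) * C"
      using dabs_tail_le[OF assms(1), of "\<sigma> - \<sigma>0" 2] that by (simp add: C_def)
    also have "\<dots> \<le> 2 powr (- real k) * C"
      using that C by (intro mult_right_mono powr_mono) auto
    also have "2 powr (- real k) = (1/2 :: real) ^ k"
      by (simp add: powr_minus powr_realpow power_one_over inverse_eq_divide)
    finally show ?thesis using k by simp
  qed
  then show ?thesis by (intro exI[of _ "\<sigma>0 + real k"]) auto
qed

text \<open>Relative to the \<open>m\<close>-th term the rest of the series decays at least like (m
  / (m + 1)) ^ k.\<close>

lemma dser_leading_coeff:
  assumes "dabs a (Re s)" "\<And>n. n < m \<Longrightarrow> a n = 0" "m \<ge> 1"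
  shows "(\<lambda>k. of_nat m powr (s + of_nat k) * dser a (s + of_nat k)) \<longlonglongrightarrow> a m"
proof -
  define a' where "a' = a(m := 0)"
  define C where "C = (\<Sum>\<^sub>\<infinity>n. norm (a' n) * real n powr (- Re s))"
  have a': "dabs a' (Re s)" by (rule dabs_comparison[OF assms(1)]) (auto simp: a'_def)
  have "norm (of_nat m powr (s + of_nat k) * dser a (s + of_nat k) - a m) \<le>
      real m powr Re s * C * (real m / real (Suc m)) ^ k" for k :: nat
  proof -
    let ?s = "s + of_nat k"
    have da: "dabs a (Re ?s)" "dabs a' (Re ?s)"
      using dabs_mono[OF assms(1)] dabs_mono[OF a'] by auto
    have pm: "of_nat m powr ?s * of_nat m powr (- ?s) = (1 :: complex)"
      unfolding powr_add[symmetric] using assms(3) by simp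
    have "((\<lambda>n. if n = m then a m * of_nat m powr (- ?s) else 0) has_sum a m * of_nat m powr (- ?s)) UNIV"
      by (rule has_sum_finite_neutralI[of "{m}"]) auto
    from has_sum_add[OF this dser_has_sum[OF da(2)]]
    have "((\<lambda>n. a n * of_nat n powr (- ?s)) has_sum a m * of_nat m powr (- ?s) + dser a' ?s) UNIV"
      by (rule has_sum_cong[THEN iffD1, rotated]) (auto simp: a'_def)
    then have "dser a ?s = a m * of_nat m powr (- ?s) + dser a' ?s"
      using dser_has_sum[OF da(1)] has_sum_unique by blast
    then have "of_nat m powr ?s * dser a ?s - a m = of_nat m powr ?s * dser a' ?s"
      using pm by (simp add: algebra_simps)
    then have "norm (of_nat m powr ?s * dser a ?s - a m) = real m powr Re ?s * norm (dser a' ?s)"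
      by (simp add: norm_mult norm_of_nat_powr)
    also have "norm (dser a' ?s) \<le> (\<Sum>\<^sub>\<infinity>n. norm (a' n) * real n powr (- (Re s + real k)))"
      unfolding dser_def using norm_infsum_bound[OF da(2)[unfolded dabs_iff_norm_summable]]
      by (simp add: norm_mult norm_of_nat_powr)
    also have "\<dots> \<le> real (Suc m) powr (- real k) * C"
      unfolding C_def using assms(2) by (intro dabs_tail_le[OF a']) (auto simp: a'_def less_Suc_eq)
    also have "real m powr Re ?s * (real (Suc m) powr (- real k) * C) = real m powr Re s * C * (real m / real (Suc m)) ^ k"
      using assms(3) by (simp add: powr_add powr_realpow powr_minus power_divide divide_simps del: of_nat_Suc)
    finally show ?thesis by (simp add: mult_left_mono)
  qed
  note bound = this
  have "(\<lambda>k. real m powr Re s * C * (real m / real (Suc m)) ^ k) \<longlonglongrightarrow> 0"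
    by (intro tendsto_mult_right_zero LIMSEQ_power_zero) auto
  then have "(\<lambda>k. of_nat m powr (s + of_nat k) * dser a (s + of_nat k) - a m) \<longlonglongrightarrow> 0"
    by (rule Lim_null_comparison[OF always_eventually[OF allI[OF bound]]])
  then show ?thesis by (simp add: LIM_zero_iff)
qed

text \<open>Uniqueness of the coefficients from one arithmetic progression of points: once the
  smaller ones vanish, \<open>a n\<close> is the limit of a zero sequence.\<close>

lemma dser_eq_zero_imp:
  assumes "dabs a (Re s)" "a 0 = 0" "\<And>k :: nat. dser a (s + of_nat k) = 0"
  shows "a n = 0"
proof (induction n rule: less_induct)
  case (less n)
  show ?case
  proof (cases "n = 0")
    case False
    then show ?thesis
      using dser_leading_coeff[OF assms(1) less] assms(3) by (simp add: LIMSEQ_const_iff)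
  qed (simp add: assms(2))
qed

text \<open>Solves the matrix equation U = Q + P U, with convolution as product, coefficient by
  coefficient. The guard \<open>1 < d\<close> makes \<open>n div d\<close> smaller than
  \<open>n\<close>; the guard \<open>0 < n\<close> empties the sum at 0, where the recursion would
  not descend.\<close>

function dconv_solution ::
  "(nat \<Rightarrow> nat \<Rightarrow> nat \<Rightarrow> 'a::comm_ring_1) \<Rightarrow> (nat \<Rightarrow> nat \<Rightarrow> 'a) \<Rightarrow> nat \<Rightarrow> nat \<Rightarrow> nat \<Rightarrow> 'a" where
  "dconv_solution P Q r l n = Q l n +
     (\<Sum>l'<r. \<Sum>d\<in>{d. d dvd n \<and> 1 < d \<and> 0 < n}. P l l' d * dconv_solution P Q r l' (n div d))"
  by auto
termination
  by (relation "Wellfounded.measure (\<lambda>(P, Q, r, l, n). n)") auto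

declare dconv_solution.simps [simp del]

text \<open>The divisor 1 skipped by the recursion carries the coefficient
  \<open>P l l' 1 = 0\<close>.\<close>

lemma dconv_solution:
  assumes "\<And>l l'. P l l' 1 = 0"
  shows "dconv_solution P Q r l n = Q l n + (\<Sum>l'<r. dconv (P l l') (dconv_solution P Q r l') n)"
proof (cases "n = 0")
  case False
  have "(\<Sum>d\<in>{d. d dvd n \<and> 1 < d \<and> 0 < n}. P l l' d * dconv_solution P Q r l' (n div d)) =
      dconv (P l l') (dconv_solution P Q r l') n" for l'
  proof -
    have "P l l' d = 0" if "d dvd n" "\<not> 1 < d" for d
    proof -
      have "d = 0 \<or> d = 1" using that(2) by linarith
      then show ?thesis using that(1) False assms by auto
    qed
    then show ?thesis
      unfolding dconv_def using False finite_divisors_nat[of n]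
      by (intro sum.mono_neutral_left) auto
  qed
  then show ?thesis by (subst dconv_solution.simps) simp
qed (subst dconv_solution.simps, simp)

section \<open>Reproducing kernel Hilbert spaces of square-summable expansions\<close>

definition l2 :: "'i set \<Rightarrow> ('i \<Rightarrow> complex) set" where
  "l2 I = {c. (\<forall>i. i \<notin> I \<longrightarrow> c i = 0) \<and> (\<lambda>i. (cmod (c i))\<^sup>2) summable_on UNIV}"

definition l2_ip :: "('i \<Rightarrow> complex) \<Rightarrow> ('i \<Rightarrow> complex) \<Rightarrow> complex" where
  "l2_ip c d = (\<Sum>\<^sub>\<infinity>i. c i * cnj (d i))"

lemma square_summable_mult:
  fixes c d :: "'i \<Rightarrow> complex"
  assumes "(\<lambda>i. (cmod (c i))\<^sup>2) summable_on A" "(\<lambda>i. (cmod (d i))\<^sup>2) summable_on A"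
  shows "(\<lambda>i. norm (c i * d i)) summable_on A"
proof -
  have "(\<lambda>i. norm (c i * c i)) summable_on A" "(\<lambda>i. norm (d i * d i)) summable_on A"
    using assms by (simp_all add: norm_mult power2_eq_square)
  then show ?thesis by (rule abs_summable_product)
qed

lemma square_summable_add:
  fixes c d :: "'i \<Rightarrow> complex"
  assumes "(\<lambda>i. (cmod (c i))\<^sup>2) summable_on A" "(\<lambda>i. (cmod (d i))\<^sup>2) summable_on A"
  shows "(\<lambda>i. (cmod (c i + d i))\<^sup>2) summable_on A"
proof (rule summable_on_comparison_test)
  show "(\<lambda>i. 2 * (cmod (c i))\<^sup>2 + 2 * (cmod (d i))\<^sup>2) summable_on A"
    by (intro summable_on_add summable_on_cmult_right assms)
  fix i
  have "(cmod (c i + d i))\<^sup>2 \<le> (cmod (c i) + cmod (d i))\<^sup>2"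
    by (intro power_mono norm_triangle_ineq) auto
  also have "\<dots> \<le> 2 * (cmod (c i))\<^sup>2 + 2 * (cmod (d i))\<^sup>2"
    using sum_squares_bound[of "cmod (c i)" "cmod (d i)"] by (simp add: power2_sum)
  finally show "(cmod (c i + d i))\<^sup>2 \<le> 2 * (cmod (c i))\<^sup>2 + 2 * (cmod (d i))\<^sup>2" .
qed auto

lemma l2_add: "c \<in> l2 I \<Longrightarrow> d \<in> l2 I \<Longrightarrow> (\<lambda>i. c i + d i) \<in> l2 I"
  unfolding l2_def using square_summable_add[of c UNIV d] by auto

lemma l2_scale: "c \<in> l2 I \<Longrightarrow> (\<lambda>i. k * c i) \<in> l2 I"
  using summable_on_cmult_right[of "\<lambda>i. (cmod (c i))\<^sup>2" UNIV "(cmod k)\<^sup>2"]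
  by (auto simp: l2_def norm_mult power_mult_distrib)

lemma l2_zero: "(\<lambda>_. 0) \<in> l2 I"
  by (simp add: l2_def)

lemma l2_diff: "c \<in> l2 I \<Longrightarrow> d \<in> l2 I \<Longrightarrow> (\<lambda>i. c i - d i) \<in> l2 I"
  using l2_add[of c I "\<lambda>i. -1 * d i"] l2_scale[of d I "-1"] by simp

lemma l2_ip_has_sum:
  assumes "c \<in> l2 I" "d \<in> l2 I"
  shows "((\<lambda>i. c i * cnj (d i)) has_sum l2_ip c d) UNIV"
proof -
  have "(\<lambda>i. norm (c i * cnj (d i))) summable_on UNIV"
    by (rule square_summable_mult) (use assms in \<open>auto simp: l2_def\<close>)
  then show ?thesis unfolding l2_ip_def by (rule has_sum_infsum[OF abs_summable_summable])
qed

lemma l2_ip_self: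
  assumes "c \<in> l2 I"
  shows "l2_ip c c = of_real (\<Sum>\<^sub>\<infinity>i. (cmod (c i))\<^sup>2)"
proof -
  have "(\<lambda>i. (cmod (c i))\<^sup>2) summable_on UNIV" using assms by (simp add: l2_def)
  then have "((\<lambda>i. complex_of_real ((cmod (c i))\<^sup>2)) has_sum of_real (\<Sum>\<^sub>\<infinity>i. (cmod (c i))\<^sup>2)) UNIV"
    by (intro has_sum_of_real has_sum_infsum)
  then show ?thesis
    unfolding complex_norm_square l2_ip_def by (rule infsumI)
qed

lemma ip_norm_l2:
  assumes "c \<in> l2 I"
  shows "(ip_norm l2_ip c)\<^sup>2 = (\<Sum>\<^sub>\<infinity>i. (cmod (c i))\<^sup>2)"
  using infsum_nonneg[of UNIV "\<lambda>i. (cmod (c i))\<^sup>2"] by (simp add: ip_norm_def l2_ip_self[OF assms])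

text \<open>Limits are taken coordinatewise. The Cauchy estimate passes to the limit on each finite
  set of indices, and only then is the supremum over these sets formed.\<close>

lemma l2_complete:
  assumes F: "\<And>m. F m \<in> l2 I"
    and cauchy: "\<And>\<epsilon>. \<epsilon> > 0 \<Longrightarrow> \<exists>N. \<forall>m\<ge>N. \<forall>k\<ge>N. ip_norm l2_ip (\<lambda>i. F m i - F k i) < \<epsilon>"
  shows "\<exists>c\<in>l2 I. (\<lambda>m. ip_norm l2_ip (\<lambda>i. F m i - c i)) \<longlonglongrightarrow> 0"
proof -
  have fin: "(\<Sum>i\<in>X. (cmod (F m i - F k i))\<^sup>2) \<le> (ip_norm l2_ip (\<lambda>i. F m i - F k i))\<^sup>2"
    if "finite X" for X m k
  proof -
    have "(\<lambda>i. F m i - F k i) \<in> l2 I" by (rule l2_diff[OF F F])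
    then show ?thesis using that
      by (subst ip_norm_l2) (auto simp: l2_def intro!: finite_sum_le_infsum)
  qed
  have nonneg: "ip_norm l2_ip (\<lambda>i. F m i - F k i) \<ge> 0" for m k
  proof -
    have "(\<lambda>i. F m i - F k i) \<in> l2 I" by (rule l2_diff[OF F F])
    then show ?thesis using infsum_nonneg[of UNIV "\<lambda>i. (cmod (F m i - F k i))\<^sup>2"]
      by (simp add: ip_norm_def l2_ip_self)
  qed
  have "Cauchy (\<lambda>m. F m i)" for i
  proof (rule metric_CauchyI)
    fix \<epsilon> :: real assume "\<epsilon> > 0"
    from cauchy[OF this] obtain N where
      N: "\<And>m k. m \<ge> N \<Longrightarrow> k \<ge> N \<Longrightarrow> ip_norm l2_ip (\<lambda>i. F m i - F k i) < \<epsilon>" by blast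
    have "dist (F m i) (F k i) < \<epsilon>" if "m \<ge> N" "k \<ge> N" for m k
    proof -
      have "(cmod (F m i - F k i))\<^sup>2 \<le> (ip_norm l2_ip (\<lambda>i. F m i - F k i))\<^sup>2"
        using fin[of "{i}" m k] by simp
      then have "cmod (F m i - F k i) \<le> ip_norm l2_ip (\<lambda>i. F m i - F k i)"
        using nonneg[of m k] by (rule power2_le_imp_le)
      then show ?thesis using N[OF that] by (simp add: dist_norm)
    qed
    then show "\<exists>M. \<forall>m\<ge>M. \<forall>n\<ge>M. dist (F m i) (F n i) < \<epsilon>" by blast
  qed
  then have "\<exists>l. (\<lambda>m. F m i) \<longlonglongrightarrow> l" for i
    by (simp add: Cauchy_convergent_iff convergent_def)
  then obtain c where c: "\<And>i. (\<lambda>m. F m i) \<longlonglongrightarrow> c i" by metis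
  have key: "(\<lambda>i. F m i - c i) \<in> l2 I \<and> ip_norm l2_ip (\<lambda>i. F m i - c i) \<le> \<epsilon>"
    if "\<epsilon> > 0" and N: "\<And>m k. m \<ge> N \<Longrightarrow> k \<ge> N \<Longrightarrow> ip_norm l2_ip (\<lambda>i. F m i - F k i) < \<epsilon>" and m: "m \<ge> N"
    for \<epsilon> N m
  proof -
    have bound: "(\<Sum>i\<in>X. (cmod (F m i - c i))\<^sup>2) \<le> \<epsilon>\<^sup>2" if X: "finite X" for X
    proof (rule Lim_bounded)
      show "(\<lambda>k. \<Sum>i\<in>X. (cmod (F m i - F k i))\<^sup>2) \<longlonglongrightarrow> (\<Sum>i\<in>X. (cmod (F m i - c i))\<^sup>2)"
        by (intro tendsto_sum tendsto_power tendsto_norm tendsto_diff tendsto_const c)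
      show "\<forall>k\<ge>N. (\<Sum>i\<in>X. (cmod (F m i - F k i))\<^sup>2) \<le> \<epsilon>\<^sup>2"
      proof (intro allI impI)
        fix k assume "k \<ge> N"
        then have "(ip_norm l2_ip (\<lambda>i. F m i - F k i))\<^sup>2 \<le> \<epsilon>\<^sup>2"
          using N[OF m, of k] nonneg[of m k] by (intro power_mono) auto
        then show "(\<Sum>i\<in>X. (cmod (F m i - F k i))\<^sup>2) \<le> \<epsilon>\<^sup>2" using fin[OF X, of m k] by linarith
      qed
    qed
    have "c i = 0" if "i \<notin> I" for i
    proof -
      have "(\<lambda>m. F m i) = (\<lambda>m. 0)" using F that by (auto simp: l2_def)
      then show ?thesis using c[of i] by (simp add: LIMSEQ_const_iff)
    qed
    moreover have sum: "(\<lambda>i. (cmod (F m i - c i))\<^sup>2) summable_on UNIV"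
      using bound by (intro nonneg_bdd_above_summable_on bdd_aboveI2[where M = "\<epsilon>\<^sup>2"]) auto
    ultimately have mem: "(\<lambda>i. F m i - c i) \<in> l2 I" using F by (auto simp: l2_def)
    have "(ip_norm l2_ip (\<lambda>i. F m i - c i))\<^sup>2 \<le> \<epsilon>\<^sup>2"
      unfolding ip_norm_l2[OF mem] using bound by (intro infsum_le_finite_sums sum)
    then show ?thesis using mem that(1) by (auto intro: power2_le_imp_le)
  qed
  have "\<exists>N. \<forall>m\<ge>N. (\<lambda>i. F m i - c i) \<in> l2 I \<and> ip_norm l2_ip (\<lambda>i. F m i - c i) \<le> \<epsilon>" if "\<epsilon> > 0" for \<epsilon>
    using key[OF that] cauchy[OF that] by metis
  note conv = this
  have "c \<in> l2 I"
  proof -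
    obtain N where "(\<lambda>i. F N i - c i) \<in> l2 I" using conv[of 1] by auto
    from l2_diff[OF F[of N] this] show ?thesis by simp
  qed
  moreover have "(\<lambda>m. ip_norm l2_ip (\<lambda>i. F m i - c i)) \<longlonglongrightarrow> 0"
  proof (rule LIMSEQ_I)
    fix \<epsilon> :: real assume "\<epsilon> > 0"
    then have "\<epsilon> / 2 > 0" by simp
    from conv[OF this] obtain N
      where N: "\<forall>m\<ge>N. (\<lambda>i. F m i - c i) \<in> l2 I \<and> ip_norm l2_ip (\<lambda>i. F m i - c i) \<le> \<epsilon> / 2"
      by blast
    have "ip_norm l2_ip (\<lambda>i. F m i - c i) \<ge> 0" for m
      using l2_ip_self[OF l2_diff[OF F[of m] \<open>c \<in> l2 I\<close>]] infsum_nonneg[of UNIV "\<lambda>i. (cmod (F m i - c i))\<^sup>2"]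
      by (simp add: ip_norm_def)
    then show "\<exists>no. \<forall>m\<ge>no. norm (ip_norm l2_ip (\<lambda>i. F m i - c i) - 0) < \<epsilon>"
      using N \<open>\<epsilon> > 0\<close> by (intro exI[of _ N]) fastforce
  qed
  ultimately show ?thesis by blast
qed

text \<open>The \<open>e i\<close> with \<open>i\<close> in \<open>I\<close> become an orthonormal
  basis of a space transported from \<open>l2 I\<close>. Assumption \<open>independent\<close> makes
  expansions unique, so the inner product can be read off the coefficients; \<open>I\<close> leaves
  out indices whose function vanishes.\<close>

locale l2_expansion =
  fixes \<Omega> :: "'a set" and I :: "'i set" and e :: "'i \<Rightarrow> 'a \<Rightarrow> complex"
  assumes square_summable: "x \<in> \<Omega> \<Longrightarrow> (\<lambda>i. cnj (e i x)) \<in> l2 I"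
    and independent: "c \<in> l2 I \<Longrightarrow> (\<And>x. x \<in> \<Omega> \<Longrightarrow> (\<Sum>\<^sub>\<infinity>i. c i * e i x) = 0) \<Longrightarrow> c = (\<lambda>_. 0)"
begin

definition synth :: "('i \<Rightarrow> complex) \<Rightarrow> 'a \<Rightarrow> complex" where
  "synth c x = (if x \<in> \<Omega> then \<Sum>\<^sub>\<infinity>i. c i * e i x else 0)"

definition space :: "('a \<Rightarrow> complex) set" where
  "space = synth ` l2 I"

definition coeffs :: "('a \<Rightarrow> complex) \<Rightarrow> 'i \<Rightarrow> complex" where
  "coeffs = the_inv_into (l2 I) synth"

definition ip :: "('a \<Rightarrow> complex) \<Rightarrow> ('a \<Rightarrow> complex) \<Rightarrow> complex" where
  "ip f g = l2_ip (coeffs f) (coeffs g)"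

lemma synth_has_sum:
  assumes "c \<in> l2 I" "x \<in> \<Omega>"
  shows "((\<lambda>i. c i * e i x) has_sum synth c x) UNIV"
  using l2_ip_has_sum[OF assms(1) square_summable[OF assms(2)]] assms(2)
  by (simp add: synth_def l2_ip_def)

lemma synth_add:
  assumes "c \<in> l2 I" "d \<in> l2 I"
  shows "synth (\<lambda>i. c i + d i) = (\<lambda>x. synth c x + synth d x)"
proof
  fix x
  show "synth (\<lambda>i. c i + d i) x = synth c x + synth d x"
  proof (cases "x \<in> \<Omega>")
    case True
    from has_sum_add[OF synth_has_sum[OF assms(1) True] synth_has_sum[OF assms(2) True]]
    have "(\<Sum>\<^sub>\<infinity>i. (c i + d i) * e i x) = synth c x + synth d x"
      by (intro infsumI) (simp add: distrib_right)
    then show ?thesis using True by (simp add: synth_def)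
  qed (simp add: synth_def)
qed

lemma synth_scale: "synth (\<lambda>i. k * c i) = (\<lambda>x. k * synth c x)"
  by (auto simp: synth_def mult.assoc infsum_cmult_right')

lemma synth_diff:
  assumes "c \<in> l2 I" "d \<in> l2 I"
  shows "synth (\<lambda>i. c i - d i) = (\<lambda>x. synth c x - synth d x)"
  using synth_add[OF assms(1) l2_scale[OF assms(2), of "-1"]] synth_scale[of "-1" d] by simp

lemma inj_on_synth: "inj_on synth (l2 I)"
proof (rule inj_onI)
  fix c d assume *: "c \<in> l2 I" "d \<in> l2 I" "synth c = synth d"
  have "(\<Sum>\<^sub>\<infinity>i. (c i - d i) * e i x) = 0" if "x \<in> \<Omega>" for x
    using fun_cong[OF synth_diff[OF *(1,2)], of x] *(3) that by (simp add: synth_def)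
  from independent[OF l2_diff[OF *(1,2)] this] show "c = d" by (simp add: fun_eq_iff)
qed

lemma coeffs_synth: "c \<in> l2 I \<Longrightarrow> coeffs (synth c) = c"
  unfolding coeffs_def by (rule the_inv_into_f_f[OF inj_on_synth])

lemma spaceE:
  assumes "f \<in> space"
  obtains "coeffs f \<in> l2 I" "f = synth (coeffs f)"
  using assms by (auto simp: space_def coeffs_synth)

lemma synth_in_space: "c \<in> l2 I \<Longrightarrow> synth c \<in> space"
  by (simp add: space_def)

lemma ip_synth: "c \<in> l2 I \<Longrightarrow> d \<in> l2 I \<Longrightarrow> ip (synth c) (synth d) = l2_ip c d"
  by (simp add: ip_def coeffs_synth)

lemma rkhs:
  assumes K: "\<And>x y. x \<in> \<Omega> \<Longrightarrow> y \<in> \<Omega> \<Longrightarrow> K x y = (\<Sum>\<^sub>\<infinity>i. cnj (e i y) * e i x)"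
  shows "rkhs \<Omega> K space ip"
proof
  show "f x = 0" if "f \<in> space" "x \<notin> \<Omega>" for f x
    using that by (auto simp: space_def synth_def)
  show "(\<lambda>x. 0) \<in> space"
    using synth_in_space[OF l2_zero] synth_scale[of 0 "\<lambda>_. 0"] by simp
  show "(\<lambda>x. f x + g x) \<in> space" if "f \<in> space" "g \<in> space" for f g
    using that by (auto simp: space_def synth_add[symmetric] intro!: imageI l2_add)
  show "(\<lambda>x. a * f x) \<in> space" if "f \<in> space" for f a
    using that by (auto simp: space_def synth_scale[symmetric] intro!: imageI l2_scale)
  show "ip (\<lambda>x. f x + g x) h = ip f h + ip g h" if fgh: "f \<in> space" "g \<in> space" "h \<in> space" for f g h
  proof -
    obtain c d k where *: "c \<in> l2 I" "d \<in> l2 I" "k \<in> l2 I" "f = synth c" "g = synth d" "h = synth k"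
      using fgh by (auto simp: space_def)
    have "l2_ip (\<lambda>i. c i + d i) k = l2_ip c k + l2_ip d k"
      using has_sum_add[OF l2_ip_has_sum[OF *(1,3)] l2_ip_has_sum[OF *(2,3)]]
      unfolding l2_ip_def by (intro infsumI) (simp add: distrib_right)
    then show ?thesis using *
      by (simp add: ip_synth synth_add[symmetric] l2_add)
  qed
  show "ip (\<lambda>x. a * f x) h = a * ip f h" if fh: "f \<in> space" "h \<in> space" for f h a
  proof -
    obtain c k where *: "c \<in> l2 I" "k \<in> l2 I" "f = synth c" "h = synth k"
      using fh by (auto simp: space_def)
    have "l2_ip (\<lambda>i. a * c i) k = a * l2_ip c k"
      unfolding l2_ip_def mult.assoc by (rule infsum_cmult_right')
    then show ?thesis using *
      by (simp add: ip_synth synth_scale[symmetric] l2_scale)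
  qed
  show "ip g f = cnj (ip f g)" for f g
    by (simp add: ip_def l2_ip_def infsum_cnj[symmetric] mult.commute)
  show "ip f f \<in> \<real>\<^sub>\<ge>\<^sub>0" if "f \<in> space" for f
    using that by (auto elim!: spaceE simp: ip_def l2_ip_self intro!: infsum_nonneg)
  show "f = (\<lambda>x. 0)" if f: "f \<in> space" "ip f f = 0" for f
  proof -
    obtain c where c: "c \<in> l2 I" "f = synth c" using f(1) by (auto simp: space_def)
    have 0: "(\<Sum>\<^sub>\<infinity>i. (cmod (c i))\<^sup>2) = 0" using f(2) c by (simp add: ip_synth l2_ip_self)
    have "(cmod (c i))\<^sup>2 = 0" for i
      by (rule nonneg_infsum_le_0D[of _ UNIV]) (use 0 c(1) in \<open>auto simp: l2_def\<close>)
    then have "c = (\<lambda>_. 0)" by auto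
    then show ?thesis using c by (simp add: synth_def fun_eq_iff)
  qed
  show "\<exists>g\<in>space. (\<lambda>m. ip_norm ip (\<lambda>x. F m x - g x)) \<longlonglongrightarrow> 0"
    if F: "\<And>m. F m \<in> space"
      and cauchy: "\<And>\<epsilon>. \<epsilon> > 0 \<Longrightarrow> \<exists>N. \<forall>m\<ge>N. \<forall>k\<ge>N. ip_norm ip (\<lambda>x. F m x - F k x) < \<epsilon>" for F
  proof -
    define C where "C m = coeffs (F m)" for m
    have C: "C m \<in> l2 I" "F m = synth (C m)" for m
      using F[of m] by (auto elim!: spaceE simp: C_def)
    have norm: "ip_norm ip (\<lambda>x. F m x - synth c x) = ip_norm l2_ip (\<lambda>i. C m i - c i)"
      if "c \<in> l2 I" for m c
      using C that by (simp add: ip_norm_def synth_diff[symmetric] ip_synth l2_diff)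
    have "ip_norm ip (\<lambda>x. F m x - F k x) = ip_norm l2_ip (\<lambda>i. C m i - C k i)" for m k
      using norm[OF C(1)[of k], of m] unfolding C(2)[symmetric] .
    then have "\<exists>N. \<forall>m\<ge>N. \<forall>k\<ge>N. ip_norm l2_ip (\<lambda>i. C m i - C k i) < \<epsilon>" if "\<epsilon> > 0" for \<epsilon>
      using cauchy[OF that] by simp
    from l2_complete[OF C(1) this] obtain c where
      "c \<in> l2 I" "(\<lambda>m. ip_norm l2_ip (\<lambda>i. C m i - c i)) \<longlonglongrightarrow> 0" by blast
    then show ?thesis using norm by (intro bexI[of _ "synth c"]) (auto simp: space_def)
  qed
  \<comment> \<open>The kernel section has the conjugated basis values at \<open>y\<close> as
    coefficients, so the reproducing identity is the expansion of \<open>f\<close> itself.\<close>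
  have sect: "(\<lambda>x. if x \<in> \<Omega> then K x y else 0) = synth (\<lambda>i. cnj (e i y))" if "y \<in> \<Omega>" for y
    using K that by (auto simp: synth_def)
  show "(\<lambda>x. if x \<in> \<Omega> then K x y else 0) \<in> space" if "y \<in> \<Omega>" for y
    unfolding sect[OF that] by (rule synth_in_space[OF square_summable[OF that]])
  show "ip f (\<lambda>x. if x \<in> \<Omega> then K x y else 0) = f y" if "f \<in> space" "y \<in> \<Omega>" for f y
    unfolding sect[OF that(2)] using that square_summable[OF that(2)]
    by (auto simp: space_def ip_synth l2_ip_def synth_def)
qed

end

section \<open>Multipliers from contractive columns\<close>

lemma L2_set_norm_sum:
  fixes z :: "'d \<Rightarrow> 'l \<Rightarrow> complex"
  shows "L2_set (\<lambda>l. cmod (\<Sum>d\<in>S. z d l)) X \<le> (\<Sum>d\<in>S. L2_set (\<lambda>l. cmod (z d l)) X)"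
proof (induction S rule: infinite_finite_induct)
  case (insert d S)
  have "L2_set (\<lambda>l. cmod (\<Sum>d\<in>insert d S. z d l)) X \<le> L2_set (\<lambda>l. cmod (z d l) + cmod (\<Sum>d\<in>S. z d l)) X"
    using insert.hyps by (intro L2_set_mono) (auto intro: norm_triangle_ineq)
  also have "\<dots> \<le> L2_set (\<lambda>l. cmod (z d l)) X + L2_set (\<lambda>l. cmod (\<Sum>d\<in>S. z d l)) X"
    by (rule L2_set_triangle_ineq)
  finally show ?case using insert by simp
qed (auto simp: L2_set_def)

lemma infsum_nat_bounded:
  fixes f :: "nat \<Rightarrow> real"
  assumes nonneg: "\<And>n. f n \<ge> 0" and "f 0 = 0" and bound: "\<And>N. (\<Sum>n\<in>{1..N}. f n) \<le> C"
  shows "(\<Sum>\<^sub>\<infinity>n. f n) \<le> C"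
proof (rule infsum_le_finite_sums)
  show "f summable_on UNIV" by (rule summable_on_nat_bounded[OF assms])
  fix F :: "nat set" assume "finite F"
  then obtain N where N: "F \<subseteq> {..N}" using finite_nat_iff_bounded_le by blast
  have "sum f F \<le> sum f {..N}" using N nonneg by (intro sum_mono2) auto
  also have "\<dots> = sum f {1..N}"
    using assms(2) by (intro sum.mono_neutral_right) (auto simp: not_le)
  finally show "sum f F \<le> C" using bound[of N] by simp
qed

text \<open>The entries of the transfer function are controlled through \<open>sqrt (g n)\<close>
  rather than \<open>g n\<close>; 1/2 stands for a contraction factor below 1. The exponent doubles
  for \<open>g\<close> and \<open>w\<close> because the kernel is evaluated at s + cnj u.\<close>

locale renewal_weights =
  fixes g w :: "nat \<Rightarrow> real" and \<rho> :: real
  assumes g_nonneg: "g n \<ge> 0" and g_0: "g 0 = 0" and g_1: "g 1 = 0"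
    and w_nonneg: "w n \<ge> 0" and w_eq: "w n = delta1 n + dconv g w n"
    and sqrt_g_abs: "dabs (\<lambda>n. sqrt (g n)) \<rho>"
    and sqrt_g_small: "(\<Sum>\<^sub>\<infinity>n. sqrt (g n) * real n powr (- \<rho>)) \<le> 1 / 2"
    and g_abs: "dabs g (2 * \<rho>)" and w_abs: "dabs w (2 * \<rho>)"
begin

abbreviation "\<Omega> \<equiv> half_plane \<rho>"

definition G :: "complex \<Rightarrow> complex" where "G = dser (\<lambda>n. of_real (g n))"

definition D :: "complex \<Rightarrow> complex" where "D = dser (\<lambda>n. of_real (w n))"

lemma w_0: "w 0 = 0"
  using w_eq[of 0] by (simp add: delta1_def)

lemma half_plane_add:
  assumes "s \<in> \<Omega>" "u \<in> \<Omega>"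
  shows "2 * \<rho> \<le> Re (s + cnj u)"
  using assms by (simp add: half_plane_def)

lemma D_eq:
  assumes "2 * \<rho> \<le> Re z"
  shows "D z * (1 - G z) = 1"
  unfolding D_def G_def
  by (rule dser_renewal[OF dabs_mono[OF g_abs assms] dabs_mono[OF w_abs assms] w_eq])

text \<open>The orthonormal basis for the norm \<Sum> |a n|^2 / w n; it is zero where
  \<open>w n = 0\<close>.\<close>

definition e :: "nat \<Rightarrow> complex \<Rightarrow> complex" where
  "e n s = of_real (sqrt (w n)) * of_nat n powr (- s)"

lemma cnj_e: "cnj (e n s) = of_real (sqrt (w n)) * of_nat n powr (- cnj s)"
  by (simp add: e_def cnj_powr)

lemma e_mult: "cnj (e n u) * e n s = of_real (w n) * of_nat n powr (- (s + cnj u))"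
proof -
  have "complex_of_real (sqrt (w n)) * of_real (sqrt (w n)) = of_real (w n)"
    unfolding of_real_mult[symmetric] using w_nonneg[of n] by simp
  then show ?thesis unfolding cnj_e unfolding e_def minus_add_distrib
    by (cases "n = 0") (simp_all add: w_0 powr_add mult_ac powr_diff powr_minus divide_inverse)
qed

lemma e_square_summable:
  assumes "s \<in> \<Omega>"
  shows "(\<lambda>n. cnj (e n s)) \<in> l2 {n. w n > 0}"
proof -
  have "(cmod (e n s))\<^sup>2 = w n * real n powr (- (2 * Re s))" for n
  proof -
    have "(real n powr - Re s)\<^sup>2 = real n powr (- (2 * Re s))"
      unfolding power2_eq_square powr_add[symmetric] by simp
    then show ?thesis
      using w_nonneg[of n] by (simp add: e_def norm_mult power_mult_distrib norm_of_nat_powr)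
  qed
  moreover have "dabs w (2 * Re s)" using dabs_mono[OF w_abs] assms by (auto simp: half_plane_def)
  ultimately have "(\<lambda>n. (cmod (e n s))\<^sup>2) summable_on UNIV"
    using w_nonneg by (simp add: dabs_def)
  moreover have "e n s = 0" if "\<not> w n > 0" for n
    using w_nonneg[of n] that by (simp add: e_def)
  ultimately show ?thesis by (auto simp: l2_def)
qed

lemma dabs_l2:
  assumes "c \<in> l2 I" "s \<in> \<Omega>"
  shows "dabs (\<lambda>n. c n * of_real (sqrt (w n))) (Re s)"
proof -
  have "(\<lambda>n. norm (c n * e n s)) summable_on UNIV"
    using assms(1) e_square_summable[OF assms(2)] by (intro square_summable_mult) (auto simp: l2_def)
  then show ?thesis by (simp add: dabs_iff_norm_summable e_def mult.assoc)
qed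

text \<open>A combination vanishing on \<Omega> is a Dirichlet series with zeros at \<rho> + 1 + k,
  so all \<open>c n * sqrt (w n)\<close> vanish, and on the index set \<open>sqrt (w n)\<close> can
  be cancelled.\<close>

sublocale H: l2_expansion \<Omega> "{n. w n > 0}" e
proof
  show "(\<lambda>n. cnj (e n s)) \<in> l2 {n. w n > 0}" if "s \<in> \<Omega>" for s
    by (rule e_square_summable[OF that])
  fix c assume c: "c \<in> l2 {n. w n > 0}" and zero: "\<And>s. s \<in> \<Omega> \<Longrightarrow> (\<Sum>\<^sub>\<infinity>n. c n * e n s) = 0"
  define s where "s = complex_of_real (\<rho> + 1)"
  have s: "s + of_nat k \<in> \<Omega>" for k by (simp add: s_def half_plane_def)
  have "c n * of_real (sqrt (w n)) = 0" for n
  proof (rule dser_eq_zero_imp[of "\<lambda>n. c n * of_real (sqrt (w n))" s])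
    show "dabs (\<lambda>n. c n * of_real (sqrt (w n))) (Re s)" using dabs_l2[OF c s[of 0]] by simp
    show "dser (\<lambda>n. c n * of_real (sqrt (w n))) (s + of_nat k) = 0" for k
      using zero[OF s[of k]] by (simp add: dser_def e_def mult.assoc)
  qed (simp add: w_0)
  then have "c n = 0" if "w n > 0" for n
    using that by (metis mult_eq_0_iff of_real_eq_0_iff real_sqrt_eq_zero_cancel_iff less_irrefl)
  then show "c = (\<lambda>_. 0)" using c by (auto simp: l2_def)
qed

lemma synth_eq_dser:
  "s \<in> \<Omega> \<Longrightarrow> H.synth c s = dser (\<lambda>n. c n * of_real (sqrt (w n))) s"
  by (simp add: H.synth_def dser_def e_def mult.assoc)

lemma rkhs_dirichlet:
  assumes "\<And>s u. s \<in> \<Omega> \<Longrightarrow> u \<in> \<Omega> \<Longrightarrow> K s u = D (s + cnj u)"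
  shows "rkhs \<Omega> K H.space H.ip"
  by (rule H.rkhs) (simp add: assms D_def dser_def e_mult)

end

text \<open>\<open>P\<close> and \<open>Q\<close> below are the Dirichlet series \<open>\<Sum>\<^sub>d \<surd>(g d) A\<^sub>d d\<^sup>-\<^sup>s\<close> and
  \<open>\<Sum>\<^sub>d \<surd>(g d) B\<^sub>d d\<^sup>-\<^sup>s\<close>, and \<open>\<Phi> = C U + E\<close> with \<open>U = P U + Q\<close> is the transfer function of the
  contractive column. Since \<open>g 1 = 0\<close>, the equation for \<open>U\<close> is solved recursively in the coefficients,
  so that no resolvent is needed and all estimates are made on truncations \<open>n \<le> N\<close>.\<close>

locale contractive_column = renewal_weights +
  fixes r p q :: nat
    and A :: "nat \<Rightarrow> nat \<Rightarrow> nat \<Rightarrow> complex" and B :: "nat \<Rightarrow> nat \<Rightarrow> nat \<Rightarrow> complex"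
    and C :: "nat \<Rightarrow> nat \<Rightarrow> complex" and E :: "nat \<Rightarrow> nat \<Rightarrow> complex"
  assumes contraction: "finite J \<Longrightarrow>
    (\<Sum>d\<in>J. \<Sum>l<r. (cmod ((\<Sum>l'<r. A d l l' * x l') + (\<Sum>k<q. B d l k * y k)))\<^sup>2)
      + (\<Sum>i<p. (cmod ((\<Sum>l<r. C i l * x l) + (\<Sum>k<q. E i k * y k)))\<^sup>2)
    \<le> (\<Sum>l<r. (cmod (x l))\<^sup>2) + (\<Sum>k<q. (cmod (y k))\<^sup>2)"
begin

definition P :: "nat \<Rightarrow> nat \<Rightarrow> nat \<Rightarrow> complex" where
  "P l l' d = of_real (sqrt (g d)) * A d l l'"

definition Q :: "nat \<Rightarrow> nat \<Rightarrow> nat \<Rightarrow> complex" where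
  "Q l k d = of_real (sqrt (g d)) * B d l k"

definition U :: "nat \<Rightarrow> nat \<Rightarrow> nat \<Rightarrow> complex" where
  "U k l = dconv_solution P (\<lambda>l. Q l k) r l"

definition \<Phi> :: "nat \<Rightarrow> nat \<Rightarrow> nat \<Rightarrow> complex" where
  "\<Phi> i k n = (\<Sum>l<r. C i l * U k l n) + E i k * delta1 n"

definition \<phi> :: "complex \<Rightarrow> complex mat" where
  "\<phi> s = mat p q (\<lambda>(i,k). dser (\<Phi> i k) s)"

lemma U_eq: "U k l n = Q l k n + (\<Sum>l'<r. dconv (P l l') (U k l') n)"
  unfolding U_def using g_1 by (intro dconv_solution) (simp add: P_def)

text \<open>A linear system driven by the input series \<open>a\<close>: \<open>state\<close> is U
  applied to \<open>a\<close>, \<open>branch a d\<close> is the signal returned by the block of the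
  column at frequency \<open>d\<close>, and \<open>out\<close> is \<Phi> applied to
  \<open>a\<close>.\<close>

definition state :: "(nat \<Rightarrow> nat \<Rightarrow> complex) \<Rightarrow> nat \<Rightarrow> nat \<Rightarrow> complex" where
  "state a l n = (\<Sum>k<q. dconv (U k l) (a k) n)"

definition branch :: "(nat \<Rightarrow> nat \<Rightarrow> complex) \<Rightarrow> nat \<Rightarrow> nat \<Rightarrow> nat \<Rightarrow> complex" where
  "branch a d l n = (\<Sum>l'<r. A d l l' * state a l' n) + (\<Sum>k<q. B d l k * a k n)"

definition out :: "(nat \<Rightarrow> nat \<Rightarrow> complex) \<Rightarrow> nat \<Rightarrow> nat \<Rightarrow> complex" where
  "out a i n = (\<Sum>k<q. dconv (\<Phi> i k) (a k) n)"

text \<open>Energies carry the weight 1 / w n, which evaluates to 0 where \<open>w n = 0\<close>.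
  Inputs that vanish there lose no energy by this convention.\<close>

context
  fixes a :: "nat \<Rightarrow> nat \<Rightarrow> complex"
  assumes a: "\<And>k n. k < q \<Longrightarrow> w n = 0 \<Longrightarrow> a k n = 0"
begin

lemma state_eq: "state a l n = (\<Sum>d | d dvd n. of_real (sqrt (g d)) * branch a d l (n div d))"
proof -
  have "state a l n = (\<Sum>k<q. dconv (\<lambda>n. Q l k n + (\<Sum>l'<r. dconv (P l l') (U k l') n)) (a k) n)"
    unfolding state_def U_eq[symmetric] ..
  also have "\<dots> = (\<Sum>k<q. dconv (Q l k) (a k) n) + (\<Sum>k<q. \<Sum>l'<r. dconv (P l l') (dconv (U k l') (a k)) n)"
    by (simp add: dconv_add_left dconv_sum_left sum.distrib dconv_assoc)
  also have "(\<Sum>k<q. \<Sum>l'<r. dconv (P l l') (dconv (U k l') (a k)) n) = (\<Sum>l'<r. dconv (P l l') (state a l') n)"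
    unfolding state_def[abs_def] dconv_sum_right by (rule sum.swap)
  also have "(\<Sum>k<q. dconv (Q l k) (a k) n) + (\<Sum>l'<r. dconv (P l l') (state a l') n) =
      (\<Sum>d | d dvd n. (\<Sum>k<q. Q l k d * a k (n div d)) + (\<Sum>l'<r. P l l' d * state a l' (n div d)))"
    unfolding dconv_def sum.distrib by (intro arg_cong2[where f="(+)"] sum.swap)
  also have "\<dots> = (\<Sum>d | d dvd n. of_real (sqrt (g d)) * branch a d l (n div d))"
    by (simp add: branch_def P_def Q_def distrib_left sum_distrib_left mult.assoc add.commute)
  finally show ?thesis .
qed

lemma out_eq: "out a i n = (\<Sum>l<r. C i l * state a l n) + (\<Sum>k<q. E i k * a k n)"
proof -
  have "dconv (delta1 :: nat \<Rightarrow> complex) (a k) n = a k n" if "k < q" for k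
    using a[OF that w_0] by (subst dconv_commute) (simp add: dconv_delta1_right)
  moreover have "out a i n = (\<Sum>k<q. \<Sum>l<r. C i l * dconv (U k l) (a k) n)
      + (\<Sum>k<q. E i k * dconv delta1 (a k) n)"
    by (simp add: out_def \<Phi>_def[abs_def] dconv_add_left dconv_sum_left dconv_cmult_left sum.distrib)
  moreover have "(\<Sum>k<q. \<Sum>l<r. C i l * dconv (U k l) (a k) n) = (\<Sum>l<r. C i l * state a l n)"
    unfolding state_def sum_distrib_left by (rule sum.swap)
  ultimately show ?thesis by simp
qed

text \<open>The convolution in the renewal equation has nonnegative terms, so \<open>w n = 0\<close>
  forces \<open>w (n div d) = 0\<close> for each divisor with \<open>g d \<noteq> 0\<close>. Such
  \<open>d\<close> exceed 1, and the equation for the state descends.\<close>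

lemma state_eq_0: "w n = 0 \<Longrightarrow> state a l n = 0"
proof (induction n arbitrary: l rule: less_induct)
  case (less n)
  show ?case
  proof (cases "n = 0")
    case True
    then show ?thesis by (simp add: state_def)
  next
    case False
    have "of_real (sqrt (g d)) * branch a d l (n div d) = 0" if d: "d dvd n" for d
    proof (cases "g d = 0")
      case gd: False
      then have d1: "1 < d" using g_0 g_1 by (metis less_one linorder_neqE_nat)
      have "dconv g w n = 0"
        using w_eq[of n] less.prems sum_nonneg[of "{d. d dvd n}" "\<lambda>d. g d * w (n div d)"] g_nonneg w_nonneg
        by (simp add: delta1_def dconv_def split: if_splits)
      then have "g d * w (n div d) = 0"
        unfolding dconv_def using g_nonneg w_nonneg d False
        by (subst (asm) sum_nonneg_eq_0_iff) (auto simp: finite_divisors_nat)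
      then have "w (n div d) = 0" using gd by simp
      moreover have "n div d < n" using d1 False by simp
      ultimately show ?thesis using less.IH a by (simp add: branch_def)
    qed simp
    then show ?thesis unfolding state_eq by (intro sum.neutral) auto
  qed
qed

lemma branch_eq_0: "w n = 0 \<Longrightarrow> branch a d l n = 0"
  using a state_eq_0 by (simp add: branch_def)

lemma out_eq_0: "w n = 0 \<Longrightarrow> out a i n = 0"
  using a state_eq_0 by (simp add: out_eq)

text \<open>This is where the row with entries \<open>sqrt (g d) * d powr (- s)\<close> is
  contractive: Cauchy-Schwarz with weights \<open>g d * w (n div d)\<close>, whose sum over the
  divisors is at most \<open>w n\<close> by the renewal equation.\<close>

lemma cmod_state_le:
  "(cmod (state a l n))\<^sup>2 / w n \<le> (\<Sum>d | d dvd n. (cmod (branch a d l (n div d)))\<^sup>2 / w (n div d))"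
proof (cases "w n = 0")
  case True
  then show ?thesis using w_nonneg by (simp add: sum_nonneg)
next
  case False
  define S where "S = (\<Sum>d | d dvd n. (cmod (branch a d l (n div d)))\<^sup>2 / w (n div d))"
  have S: "S \<ge> 0" unfolding S_def using w_nonneg by (intro sum_nonneg) auto
  have "cmod (state a l n) \<le> (\<Sum>d | d dvd n. sqrt (g d) * cmod (branch a d l (n div d)))"
    unfolding state_eq using g_nonneg by (intro order.trans[OF norm_sum]) (simp add: norm_mult)
  \<comment> \<open>Multiplying and dividing by \<open>sqrt (w (n div d))\<close> is legitimate even
    when this is 0, since the branch vanishes there.\<close>
  also have "\<dots> = (\<Sum>d | d dvd n. sqrt (g d * w (n div d)) * (cmod (branch a d l (n div d)) / sqrt (w (n div d))))"
    using branch_eq_0 by (intro sum.cong refl) (auto simp: real_sqrt_mult)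
  finally have "(cmod (state a l n))\<^sup>2 \<le>
      (\<Sum>d | d dvd n. sqrt (g d * w (n div d)) * (cmod (branch a d l (n div d)) / sqrt (w (n div d))))\<^sup>2"
    by (intro power_mono) auto
  also have "\<dots> \<le> (\<Sum>d | d dvd n. (sqrt (g d * w (n div d)))\<^sup>2) *
      (\<Sum>d | d dvd n. (cmod (branch a d l (n div d)) / sqrt (w (n div d)))\<^sup>2)"
    by (rule Cauchy_Schwarz_ineq_sum)
  also have "\<dots> = dconv g w n * S"
    unfolding dconv_def S_def using g_nonneg w_nonneg by (simp add: power_divide)
  also have "\<dots> \<le> w n * S"
    using w_eq[of n] S by (intro mult_right_mono) (auto simp: delta1_def)
  finally show ?thesis using False w_nonneg[of n] by (simp add: S_def field_simps)
qed

text \<open>Energy balance: the contraction bounds branch plus output energy by state plus input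
  energy, and the row estimate bounds state energy by branch energy. Up to N all of them are finite,
  so the internal energies cancel.\<close>

lemma out_partial_sum_le:
  "(\<Sum>n\<in>{1..N}. \<Sum>i<p. (cmod (out a i n))\<^sup>2 / w n) \<le> (\<Sum>n\<in>{1..N}. \<Sum>k<q. (cmod (a k n))\<^sup>2 / w n)"
proof -
  define f where "f d n = (\<Sum>l<r. (cmod (branch a d l n))\<^sup>2 / w n)" for d n
  have "(\<Sum>n\<in>{1..N}. \<Sum>l<r. (cmod (state a l n))\<^sup>2 / w n) \<le> (\<Sum>n\<in>{1..N}. \<Sum>d | d dvd n. f d (n div d))"
  proof (rule sum_mono)
    fix n
    have "(\<Sum>l<r. (cmod (state a l n))\<^sup>2 / w n) \<le>
        (\<Sum>l<r. \<Sum>d | d dvd n. (cmod (branch a d l (n div d)))\<^sup>2 / w (n div d))"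
      by (intro sum_mono cmod_state_le)
    also have "\<dots> = (\<Sum>d | d dvd n. f d (n div d))" unfolding f_def by (rule sum.swap)
    finally show "(\<Sum>l<r. (cmod (state a l n))\<^sup>2 / w n) \<le> (\<Sum>d | d dvd n. f d (n div d))" .
  qed
  also have "\<dots> \<le> (\<Sum>d\<in>{1..N}. \<Sum>n\<in>{1..N}. f d n)"
    using w_nonneg by (intro sum_divisors_le_sum_square) (auto simp: f_def intro!: sum_nonneg)
  also have "\<dots> = (\<Sum>n\<in>{1..N}. \<Sum>d\<in>{1..N}. f d n)" by (rule sum.swap)
  finally have state: "(\<Sum>n\<in>{1..N}. \<Sum>l<r. (cmod (state a l n))\<^sup>2 / w n) \<le> \<dots>" .
  have "(\<Sum>n\<in>{1..N}. (\<Sum>d\<in>{1..N}. f d n) + (\<Sum>i<p. (cmod (out a i n))\<^sup>2 / w n)) \<le>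
      (\<Sum>n\<in>{1..N}. (\<Sum>l<r. (cmod (state a l n))\<^sup>2 / w n) + (\<Sum>k<q. (cmod (a k n))\<^sup>2 / w n))"
  proof (rule sum_mono)
    fix n
    from divide_right_mono[OF contraction[of "{1..N}" "\<lambda>l. state a l n" "\<lambda>k. a k n"] w_nonneg[of n]]
    show "(\<Sum>d\<in>{1..N}. f d n) + (\<Sum>i<p. (cmod (out a i n))\<^sup>2 / w n) \<le>
        (\<Sum>l<r. (cmod (state a l n))\<^sup>2 / w n) + (\<Sum>k<q. (cmod (a k n))\<^sup>2 / w n)"
      by (simp add: f_def branch_def out_eq add_divide_distrib sum_divide_distrib)
  qed
  then show ?thesis using state by (simp add: sum.distrib)
qed

end

text \<open>The contraction is tested with \<open>J = {d}\<close> on unit vectors.\<close>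

lemma norm_A_B_le:
  assumes "l < r"
  shows "l' < r \<Longrightarrow> cmod (A d l l') \<le> 1" "k < q \<Longrightarrow> cmod (B d l k) \<le> 1"
proof -
  have *: "(cmod ((\<Sum>l'<r. A d l l' * x l') + (\<Sum>k<q. B d l k * y k)))\<^sup>2
      \<le> (\<Sum>l<r. (cmod (x l))\<^sup>2) + (\<Sum>k<q. (cmod (y k))\<^sup>2)" for x y
  proof -
    have "(cmod ((\<Sum>l'<r. A d l l' * x l') + (\<Sum>k<q. B d l k * y k)))\<^sup>2 \<le>
        (\<Sum>l<r. (cmod ((\<Sum>l'<r. A d l l' * x l') + (\<Sum>k<q. B d l k * y k)))\<^sup>2)"
      using assms by (intro member_le_sum) auto
    also have "\<dots> \<le> (\<Sum>d\<in>{d}. \<Sum>l<r. (cmod ((\<Sum>l'<r. A d l l' * x l') + (\<Sum>k<q. B d l k * y k)))\<^sup>2)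
      + (\<Sum>i<p. (cmod ((\<Sum>l<r. C i l * x l) + (\<Sum>k<q. E i k * y k)))\<^sup>2)"
      by (simp add: sum_nonneg)
    finally show ?thesis using contraction[of "{d}" x y] by simp
  qed
  have delta: "(\<Sum>j<m. f j * (if j = i then 1 else 0)) = f i"
    "(\<Sum>j<m. (cmod (if j = i then 1 else 0))\<^sup>2) = 1" if "i < m" for f :: "nat \<Rightarrow> complex" and i m
    using that by (simp_all add: if_distrib[of "\<lambda>x. _ * x"] if_distrib[of cmod] if_distrib[of "\<lambda>x. x\<^sup>2"] cong: if_cong)
  show "cmod (A d l l') \<le> 1" if "l' < r"
    using *[of "\<lambda>j. if j = l' then 1 else 0" "\<lambda>_. 0"] that
    by (simp add: delta power_le_one_iff abs_square_le_1 del: sum.delta sum.delta')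
  show "cmod (B d l k) \<le> 1" if "k < q"
    using *[of "\<lambda>_. 0" "\<lambda>j. if j = k then 1 else 0"] that
    by (simp add: delta power_le_one_iff abs_square_le_1 del: sum.delta sum.delta')
qed

section \<open>Absolute convergence of the transfer function and interpolation\<close>

lemma dabs_P: "l < r \<Longrightarrow> l' < r \<Longrightarrow> \<rho> \<le> \<sigma> \<Longrightarrow> dabs (P l l') \<sigma>"
  using norm_A_B_le(1) g_nonneg
  by (intro dabs_comparison[OF dabs_mono[OF sqrt_g_abs]]) (auto simp: P_def norm_mult intro!: mult_left_le)

lemma dabs_Q: "l < r \<Longrightarrow> k < q \<Longrightarrow> \<rho> \<le> \<sigma> \<Longrightarrow> dabs (Q l k) \<sigma>"
  using norm_A_B_le(2) g_nonneg
  by (intro dabs_comparison[OF dabs_mono[OF sqrt_g_abs]]) (auto simp: Q_def norm_mult intro!: mult_left_le)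

text \<open>The impulse \<open>delta1\<close> in channel \<open>k\<close> makes the state equal to
  \<open>U k\<close>. Since every block is a contraction, the Euclidean norm \<open>v\<close> of the
  state obeys a renewal inequality with kernel \<open>sqrt g\<close>, whatever \<open>r\<close> is;
  a bound entry by entry would cost a factor depending on \<open>r\<close>.\<close>

lemma dabs_U:
  assumes "k < q" "l < r" "\<rho> \<le> \<sigma>"
  shows "dabs (U k l) \<sigma>"
proof -
  define a where "a k' n = (if k' = k then delta1 n else 0 :: complex)" for k' n
  have "w 1 > 0"
    using w_eq[of 1] sum_nonneg[of "{d. d dvd 1}" "\<lambda>d. g d * w (1 div d)"] g_nonneg w_nonneg g_1
    by (simp add: delta1_def dconv_def)
  then have a: "a k' n = 0" if "k' < q" "w n = 0" for k' n
    using that by (auto simp: a_def delta1_def)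
  have a_eq: "a k = delta1" "\<And>k'. k' \<noteq> k \<Longrightarrow> a k' = (\<lambda>_. 0)"
    by (auto simp: a_def fun_eq_iff)
  have state: "state a l n = U k l n" if "n \<ge> 1" for l n
  proof -
    have "state a l n = (\<Sum>k'<q. if k' = k then dconv (U k l) delta1 n else 0)"
      unfolding state_def by (intro sum.cong refl) (auto simp: a_eq dconv_def)
    then show ?thesis using assms that by (simp add: dconv_delta1_right)
  qed
  define v where "v n = L2_set (\<lambda>l. cmod (U k l n)) {..<r}" for n
  have branch: "L2_set (\<lambda>l. cmod (branch a d l m)) {..<r} \<le> v m + delta1 m" if "m \<ge> 1" for d m
  proof -
    have "(\<Sum>l<r. (cmod (branch a d l m))\<^sup>2) \<le>
      (\<Sum>d\<in>{d}. \<Sum>l<r. (cmod (branch a d l m))\<^sup>2)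
        + (\<Sum>i<p. (cmod ((\<Sum>l<r. C i l * state a l m) + (\<Sum>k<q. E i k * a k m)))\<^sup>2)"
      by (simp add: sum_nonneg)
    also have "\<dots> \<le> (\<Sum>l<r. (cmod (state a l m))\<^sup>2) + (\<Sum>k<q. (cmod (a k m))\<^sup>2)"
      unfolding branch_def by (rule contraction) simp
    also have "(\<Sum>k<q. (cmod (a k m))\<^sup>2) = (\<Sum>k'<q. if k' = k then (delta1 m)\<^sup>2 else 0)"
      by (intro sum.cong refl) (auto simp: a_def delta1_def)
    also have "\<dots> = (delta1 m)\<^sup>2" using assms by simp
    finally have "L2_set (\<lambda>l. cmod (branch a d l m)) {..<r} \<le>
        sqrt ((\<Sum>l<r. (cmod (state a l m))\<^sup>2) + (delta1 m)\<^sup>2)"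
      unfolding L2_set_def by (rule real_sqrt_le_mono)
    also have "\<dots> \<le> sqrt (\<Sum>l<r. (cmod (state a l m))\<^sup>2) + sqrt ((delta1 m)\<^sup>2)"
      by (rule sqrt_add_le_add_sqrt) (auto intro: sum_nonneg)
    also have "\<dots> = v m + delta1 m"
      using state[OF that] by (simp add: v_def L2_set_def delta1_def)
    finally show ?thesis .
  qed
  have "dabs v \<sigma>"
  proof (rule dabs_of_dconv_bound[where p = "\<lambda>n. sqrt (g n)" and q = "\<lambda>n. sqrt (g n)" and c = "1/2"])
    fix n :: nat assume n: "n \<ge> 1"
    have "v n = L2_set (\<lambda>l. cmod (\<Sum>d | d dvd n. of_real (sqrt (g d)) * branch a d l (n div d))) {..<r}"
      unfolding v_def using trans[OF state[OF n, symmetric] state_eq[of a, OF a]] by simp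
    also have "\<dots> \<le> (\<Sum>d | d dvd n. L2_set (\<lambda>l. cmod (of_real (sqrt (g d)) * branch a d l (n div d))) {..<r})"
      by (rule L2_set_norm_sum)
    also have "\<dots> = (\<Sum>d | d dvd n. sqrt (g d) * L2_set (\<lambda>l. cmod (branch a d l (n div d))) {..<r})"
      using g_nonneg by (simp add: norm_mult L2_set_right_distrib)
    also have "\<dots> \<le> (\<Sum>d | d dvd n. sqrt (g d) * (v (n div d) + delta1 (n div d)))"
    proof (intro sum_mono mult_left_mono branch)
      show "1 \<le> n div d" if "d \<in> {d. d dvd n}" for d using that n by (auto elim!: dvdE)
    qed (use g_nonneg in auto)
    also have "\<dots> = dconv (\<lambda>n. sqrt (g n)) v n + dconv (\<lambda>n. sqrt (g n)) delta1 n"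
      by (simp add: dconv_def distrib_left sum.distrib)
    also have "\<dots> = sqrt (g n) + dconv (\<lambda>n. sqrt (g n)) v n"
      using n by (simp add: dconv_delta1_right)
    finally show "v n \<le> sqrt (g n) + dconv (\<lambda>n. sqrt (g n)) v n" .
  next
    have "(\<Sum>\<^sub>\<infinity>n. sqrt (g n) * real n powr - \<sigma>) \<le> (\<Sum>\<^sub>\<infinity>n. sqrt (g n) * real n powr - \<rho>)"
      using dabs_tail_le[OF sqrt_g_abs, of "\<sigma> - \<rho>" 1] assms(3) g_0 g_nonneg by simp
    then show "(\<Sum>\<^sub>\<infinity>n. sqrt (g n) * real n powr - \<sigma>) \<le> 1 / 2" using sqrt_g_small by simp
  qed (use g_nonneg dabs_mono[OF sqrt_g_abs assms(3)] in \<open>auto simp: v_def\<close>)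
  then show ?thesis
  proof (rule dabs_comparison)
    show "norm (U k l n) \<le> norm (v n)" for n
      using assms(2) member_le_L2_set[of "{..<r}" l "\<lambda>l. cmod (U k l n)"] by (simp add: v_def)
  qed
qed

lemma dser_U:
  assumes "k < q" "l < r" "\<rho> \<le> Re s"
  shows "dser (U k l) s = dser (Q l k) s + (\<Sum>l'<r. dser (P l l') s * dser (U k l') s)"
proof -
  have 1: "dabs (dconv (P l l') (U k l')) (Re s)" if "l' < r" for l'
    using assms that by (intro dabs_dconv dabs_P dabs_U)
  have "dser (U k l) s = dser (\<lambda>n. Q l k n + (\<Sum>l'<r. dconv (P l l') (U k l') n)) s"
    by (rule arg_cong[where f = "\<lambda>a. dser a s"]) (rule ext, rule U_eq)
  also have "\<dots> = dser (Q l k) s + dser (\<lambda>n. \<Sum>l'<r. dconv (P l l') (U k l') n) s"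
    by (rule dser_add[OF dabs_Q dabs_sum]) (use assms 1 in auto)
  also have "dser (\<lambda>n. \<Sum>l'<r. dconv (P l l') (U k l') n) s = (\<Sum>l'<r. dser (dconv (P l l') (U k l')) s)"
    by (rule dser_sum) (use 1 in auto)
  also have "(\<Sum>l'<r. dser (dconv (P l l') (U k l')) s) = (\<Sum>l'<r. dser (P l l') s * dser (U k l') s)"
    using assms by (intro sum.cong refl dser_dconv dabs_P dabs_U) auto
  finally show ?thesis .
qed

lemma dabs_\<Phi>: "k < q \<Longrightarrow> \<rho> \<le> \<sigma> \<Longrightarrow> dabs (\<Phi> i k) \<sigma>"
  unfolding \<Phi>_def[abs_def] by (intro dabs_add dabs_sum dabs_cmult dabs_U dabs_delta1) auto

lemma dser_\<Phi>:
  assumes "k < q" "\<rho> \<le> Re s"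
  shows "dser (\<Phi> i k) s = (\<Sum>l<r. C i l * dser (U k l) s) + E i k"
proof -
  have U: "dabs (\<lambda>n. C i l * U k l n) (Re s)" if "l < r" for l
    using assms that by (intro dabs_cmult dabs_U)
  have "dser (\<Phi> i k) s = dser (\<lambda>n. \<Sum>l<r. C i l * U k l n) s + dser (\<lambda>n. E i k * delta1 n) s"
    unfolding \<Phi>_def[abs_def]
    by (rule dser_add[OF dabs_sum dabs_cmult[OF dabs_delta1]]) (use U in auto)
  also have "dser (\<lambda>n. \<Sum>l<r. C i l * U k l n) s = (\<Sum>l<r. dser (\<lambda>n. C i l * U k l n) s)"
    by (rule dser_sum) (use U in auto)
  finally show ?thesis by (simp add: dser_cmult dser_delta1)
qed

text \<open>From L P + C = L and U = P U + Q follows L U = L Q + (L - C) U, that is C U = L Q. Hence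
  C U + E = L Q + E = W.\<close>

lemma \<phi>_interpolates:
  assumes "s \<in> \<Omega>" "i < p" "k < q"
    and L: "\<And>l'. l' < r \<Longrightarrow> (\<Sum>l<r. L l * dser (P l l') s) + C i l' = L l'"
    and W: "(\<Sum>l<r. L l * dser (Q l k) s) + E i k = W"
  shows "\<phi> s $$ (i, k) = W"
proof -
  have s: "\<rho> \<le> Re s" using assms(1) by (simp add: half_plane_def)
  have PL: "(\<Sum>l<r. L l * dser (P l l') s) = L l' - C i l'" if "l' < r" for l'
    using L[OF that] by (simp add: eq_diff_eq)
  have "(\<Sum>l<r. L l * dser (U k l) s) =
      (\<Sum>l<r. L l * (dser (Q l k) s + (\<Sum>l'<r. dser (P l l') s * dser (U k l') s)))"
    by (intro sum.cong refl arg_cong2[where f = "(*)"] dser_U[OF assms(3) _ s]) simp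
  also have "\<dots> = (\<Sum>l<r. L l * dser (Q l k) s) + (\<Sum>l<r. \<Sum>l'<r. L l * dser (P l l') s * dser (U k l') s)"
    by (simp add: distrib_left sum.distrib sum_distrib_left mult.assoc)
  also have "(\<Sum>l<r. \<Sum>l'<r. L l * dser (P l l') s * dser (U k l') s) =
      (\<Sum>l'<r. (L l' - C i l') * dser (U k l') s)"
    by (subst sum.swap, intro sum.cong refl) (simp add: PL flip: sum_distrib_right)
  finally have "(\<Sum>l<r. C i l * dser (U k l) s) = (\<Sum>l<r. L l * dser (Q l k) s)"
    by (simp add: left_diff_distrib sum_subtractf)
  then show ?thesis using W assms by (simp add: \<phi>_def dser_\<Phi>[OF assms(3) s])
qed

section \<open>The transfer function as a contractive multiplier\<close>

lemma ip_norm_synth: "c \<in> l2 {n. w n > 0} \<Longrightarrow> (ip_norm H.ip (H.synth c))\<^sup>2 = (\<Sum>\<^sub>\<infinity>n. (cmod (c n))\<^sup>2)"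
  using ip_norm_l2[of c] by (simp add: ip_norm_def H.ip_synth)

text \<open>In the coordinates a / sqrt w the weighted energies are plain square sums, so the
  truncated energy balance yields both membership and the norm bound as N grows.\<close>

lemma multiplier:
  assumes f: "\<And>k. k < q \<Longrightarrow> f k \<in> H.space"
  shows "i < p \<Longrightarrow> mult_op q \<phi> f i \<in> H.space"
    and "tuple_norm H.ip p (mult_op q \<phi> f) \<le> tuple_norm H.ip q f"
proof -
  define c where "c k = H.coeffs (f k)" for k
  have c: "c k \<in> l2 {n. w n > 0}" "f k = H.synth (c k)" if "k < q" for k
    using f[OF that] by (auto elim!: H.spaceE simp: c_def)
  define a where "a k n = c k n * of_real (sqrt (w n))" for k n
  have a: "a k n = 0" if "k < q" "w n = 0" for k n using that by (simp add: a_def)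
  define b where "b i n = out a i n / of_real (sqrt (w n))" for i n
  have norm_c: "(cmod (c k n))\<^sup>2 = (cmod (a k n))\<^sup>2 / w n" if "k < q" for k n
    using c(1)[OF that] w_nonneg[of n]
    by (cases "w n = 0") (auto simp: a_def norm_mult power_mult_distrib l2_def)
  have norm_b: "(cmod (b i n))\<^sup>2 = (cmod (out a i n))\<^sup>2 / w n" for i n
    using w_nonneg[of n] by (simp add: b_def norm_divide power_divide)
  have b_out: "b i n * of_real (sqrt (w n)) = out a i n" for i n
    using out_eq_0[of a, OF a] by (cases "w n = 0") (auto simp: b_def)
  define T where "T = (\<Sum>k<q. \<Sum>\<^sub>\<infinity>n. (cmod (c k n))\<^sup>2)"
  have bound: "(\<Sum>n\<in>{1..N}. \<Sum>i<p. (cmod (b i n))\<^sup>2) \<le> T" for N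
  proof -
    have "(\<Sum>n\<in>{1..N}. \<Sum>i<p. (cmod (b i n))\<^sup>2) \<le> (\<Sum>n\<in>{1..N}. \<Sum>k<q. (cmod (c k n))\<^sup>2)"
      using out_partial_sum_le[of a N, OF a] by (simp add: norm_b norm_c)
    also have "\<dots> = (\<Sum>k<q. \<Sum>n\<in>{1..N}. (cmod (c k n))\<^sup>2)" by (rule sum.swap)
    also have "\<dots> \<le> T"
      unfolding T_def using c(1) by (intro sum_mono finite_sum_le_infsum) (auto simp: l2_def)
    finally show ?thesis .
  qed
  have b_0: "b i 0 = 0" for i by (simp add: b_def w_0)
  have b: "b i \<in> l2 {n. w n > 0}" if "i < p" for i
  proof -
    have "(\<lambda>n. (cmod (b i n))\<^sup>2) summable_on UNIV"
    proof (rule summable_on_nat_bounded)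
      show "(\<Sum>n\<in>{1..N}. (cmod (b i n))\<^sup>2) \<le> T" for N
      proof (rule order.trans[OF sum_mono bound])
        show "(cmod (b i n))\<^sup>2 \<le> (\<Sum>i<p. (cmod (b i n))\<^sup>2)" for n
          using that by (intro member_le_sum[of i _ "\<lambda>i. (cmod (b i n))\<^sup>2"]) auto
      qed
    qed (simp_all add: b_0)
    moreover have "b i n = 0" if "\<not> w n > 0" for n
      using that w_nonneg[of n] by (simp add: b_def)
    ultimately show ?thesis by (auto simp: l2_def)
  qed
  have op: "mult_op q \<phi> f i = H.synth (b i)" if i: "i < p" for i
  proof
    fix s
    show "mult_op q \<phi> f i s = H.synth (b i) s"
    proof (cases "s \<in> \<Omega>")
      case True
      then have s: "\<rho> \<le> Re s" by (simp add: half_plane_def)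
      have da: "dabs (a k) (Re s)" if "k < q" for k
        unfolding a_def[abs_def] by (rule dabs_l2[OF c(1)[OF that] True])
      have "mult_op q \<phi> f i s = (\<Sum>k<q. dser (\<Phi> i k) s * dser (a k) s)"
        unfolding mult_op_def using i c(2) True
        by (intro sum.cong) (auto simp: \<phi>_def synth_eq_dser a_def[abs_def])
      also have "\<dots> = (\<Sum>k<q. dser (dconv (\<Phi> i k) (a k)) s)"
        using da dabs_\<Phi>[OF _ s] by (intro sum.cong refl) (simp add: dser_dconv)
      also have "\<dots> = dser (\<lambda>n. \<Sum>k<q. dconv (\<Phi> i k) (a k) n) s"
        using da dabs_\<Phi>[OF _ s] by (subst dser_sum) (auto intro: dabs_dconv)
      also have "\<dots> = dser (out a i) s" unfolding out_def[abs_def] ..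
      also have "\<dots> = H.synth (b i) s" by (simp add: synth_eq_dser[OF True] b_out)
      finally show ?thesis .
    next
      case False
      then show ?thesis using c(2) by (simp add: mult_op_def H.synth_def)
    qed
  qed
  show "mult_op q \<phi> f i \<in> H.space" if "i < p" for i
    unfolding op[OF that] by (rule H.synth_in_space[OF b[OF that]])
  have "(\<Sum>i<p. \<Sum>\<^sub>\<infinity>n. (cmod (b i n))\<^sup>2) = (\<Sum>\<^sub>\<infinity>n. \<Sum>i<p. (cmod (b i n))\<^sup>2)"
  proof -
    have "((\<lambda>n. \<Sum>i<p. (cmod (b i n))\<^sup>2) has_sum (\<Sum>i<p. \<Sum>\<^sub>\<infinity>n. (cmod (b i n))\<^sup>2)) UNIV"
      using b by (intro has_sum_finite_sum has_sum_infsum) (auto simp: l2_def)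
    then show ?thesis by (rule infsumI[symmetric])
  qed
  also have "\<dots> \<le> T"
    by (rule infsum_nat_bounded[OF _ _ bound]) (auto simp: b_0 intro: sum_nonneg)
  finally show "tuple_norm H.ip p (mult_op q \<phi> f) \<le> tuple_norm H.ip q f"
    unfolding tuple_norm_def using b c
    by (simp add: op ip_norm_synth T_def)
qed

end

section \<open>Solving Pick problems\<close>

context renewal_weights
begin

text \<open>Multiplied by 1 - G, the Pick identity says that N plus the product of W with its
  adjoint equals G N + I. Both sides are Gram matrices: of the vectors \<open>v a\<close> made of L
  and W, and of the vectors made of \<open>V a d\<close> for all frequencies together with the unit
  vector of index \<open>snd a\<close>. Sending one family to the other is isometric on the span of
  the \<open>v a\<close>; set to 0 on the orthogonal complement, it is the contractive
  column.\<close>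

lemma pick_problem_solvable:
  assumes K: "\<And>s u. s \<in> \<Omega> \<Longrightarrow> u \<in> \<Omega> \<Longrightarrow> K s u = D (s + cnj u)"
    and F: "finite F" "F \<subseteq> \<Omega>" and W: "\<And>x. x \<in> F \<Longrightarrow> W x \<in> carrier_mat p q"
    and pick: "psd_kernel (F \<times> {..<p}) (pick_matrix K p W)"
  shows "\<exists>\<phi>. is_multiplier \<Omega> H.space p q \<phi> \<and> mult_norm_le_one H.space H.ip p q \<phi> \<and> (\<forall>x\<in>F. \<phi> x = W x)"
proof -
  define X where "X = F \<times> {..<p}"
  have X: "finite X" using F by (simp add: X_def)
  obtain r :: nat and L
    where L: "\<And>a b. a \<in> X \<Longrightarrow> b \<in> X \<Longrightarrow> pick_matrix K p W a b = (\<Sum>l<r. L a l * cnj (L b l))"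
    using psd_kernel_gram[OF _ pick] X unfolding X_def by blast
  define S :: "(nat + nat) set" where "S = {..<r} <+> {..<q}"
  have sum_S: "(\<Sum>j\<in>S. f j) = (\<Sum>l<r. f (Inl l)) + (\<Sum>k<q. f (Inr k))" for f :: "nat + nat \<Rightarrow> complex"
    unfolding S_def by (simp add: sum.Plus)
  have S: "finite S" by (simp add: S_def)
  \<comment> \<open>Conjugated, so that \<open>ip x (v a)\<close> pairs \<open>x\<close> with the
    entries of L and W themselves.\<close>
  define v :: "complex \<times> nat \<Rightarrow> nat + nat \<Rightarrow> complex" where
    "v a = case_sum (\<lambda>l. cnj (L a l)) (\<lambda>k. cnj (W (fst a) $$ (snd a, k)))" for a
  define ip where "ip = (\<lambda>x y :: nat + nat \<Rightarrow> complex. \<Sum>j\<in>S. x j * cnj (y j))"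
  have "\<exists>\<gamma>. \<forall>b\<in>X. (\<Sum>a\<in>X. \<gamma> a * ip (v a) (v b)) = ip (\<lambda>i. if i = j then 1 else 0) (v b)" for j
    unfolding ip_def by (rule normal_equations_solvable[OF S X])
  then have "\<forall>j. \<exists>\<gamma>. \<forall>b\<in>X. (\<Sum>a\<in>X. \<gamma> a * ip (v a) (v b)) = ip (\<lambda>i. if i = j then 1 else 0) (v b)" ..
  from choice[OF this] obtain \<gamma> where \<gamma>0:
    "\<forall>j. \<forall>b\<in>X. (\<Sum>a\<in>X. \<gamma> j a * ip (v a) (v b)) = ip (\<lambda>i. if i = j then 1 else 0) (v b)" ..
  \<comment> \<open>\<open>\<gamma> j\<close> expands the projection of the \<open>j\<close>-th unit
    vector onto the span of the \<open>v a\<close>.\<close>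
  have \<gamma>: "(\<Sum>a\<in>X. \<gamma> j a * ip (v a) (v b)) = cnj (v b j)" if "b \<in> X" "j \<in> S" for j b
  proof -
    have "ip (\<lambda>i. if i = j then 1 else 0) (v b) = (\<Sum>i\<in>S. if i = j then cnj (v b i) else 0)"
      unfolding ip_def by (intro sum.cong) auto
    then show ?thesis using \<gamma>0 that S by simp
  qed
  define N where "N a b = (\<Sum>l<r. L b l * cnj (L a l))" for a b
  have gram: "ip (v a) (v b) = G (fst b + cnj (fst a)) * N a b + (if snd a = snd b then 1 else 0)"
    if "a \<in> X" "b \<in> X" for a b
  proof -
    obtain x t y t' where ab: "a = (x, t)" "b = (y, t')" by (cases a; cases b)
    then have xy: "x \<in> F" "y \<in> F" "t < p" "t' < p" using that by (auto simp: X_def)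
    define z where "z = y + cnj x"
    define V where "V = (\<Sum>k<q. W y $$ (t', k) * cnj (W x $$ (t, k)))"
    have "N a b = pick_matrix K p W b a" unfolding N_def using L[OF that(2,1)] by simp
    also have "\<dots> = ((if t' = t then 1 else 0) - V) * D z"
      unfolding V_def ab pick_matrix_def prod.case z_def using xy F(2)
      by (simp add: index_one_minus_mult_adjoint[OF W W] K subset_iff)
    finally have "N a b * (1 - G z) = ((if t' = t then 1 else 0) - V) * (D z * (1 - G z))" by simp
    also have "D z * (1 - G z) = 1"
      using xy F(2) unfolding z_def by (intro D_eq half_plane_add) auto
    finally have "N a b + V = G z * N a b + (if t = t' then 1 else 0)"
      by (auto simp: algebra_simps)
    moreover have "ip (v a) (v b) = N a b + V"
      unfolding ip_def sum_S N_def V_def by (simp add: v_def ab mult.commute)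
    ultimately show ?thesis by (simp add: ab z_def)
  qed
  define V where "V a d l = of_real (sqrt (g d)) * cnj (of_nat d powr (- fst a)) * cnj (L a l)" for a d l
  \<comment> \<open>Matrix entries of the column: the image of the projected \<open>j\<close>-th
    unit vector, at frequency \<open>d\<close> in \<open>T\<close> and in the last \<open>p\<close>
    coordinates in \<open>R\<close>.\<close>
  define T where "T d l j = (\<Sum>a\<in>X. \<gamma> j a * V a d l)" for d l j
  define R where "R i j = (\<Sum>x\<in>F. \<gamma> j (x, i))" for i j
  have snd_delta: "(\<Sum>a\<in>X. f a * (if snd a = i then 1 else 0)) = (\<Sum>x\<in>F. f (x, i))"
    if "i < p" for f :: "complex \<times> nat \<Rightarrow> complex" and i
  proof -
    have "(\<Sum>a\<in>X. f a * (if snd a = i then 1 else 0)) = (\<Sum>x\<in>F. \<Sum>t<p. if t = i then f (x, t) else 0)"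
      unfolding X_def sum.cartesian_product[symmetric]
      by (subst sum.cartesian_product) (auto intro!: sum.cong)
    then show ?thesis using that by simp
  qed
  have sqrt_g: "complex_of_real (sqrt (g d)) * of_real (sqrt (g d)) = of_real (g d)" for d
    unfolding of_real_mult[symmetric] using g_nonneg[of d] by simp
  have G_has_sum: "((\<lambda>d. of_real (g d) * (of_nat d powr (- y) * cnj (of_nat d powr (- x)))) has_sum G (y + cnj x)) UNIV"
    if "x \<in> F" "y \<in> F" for x y
  proof -
    have "2 * \<rho> \<le> Re (y + cnj x)" using that F(2) by (intro half_plane_add) auto
    then have "dabs (\<lambda>d. complex_of_real (g d)) (Re (y + cnj x))"
      using dabs_mono[OF g_abs] by (simp add: dabs_of_real)
    from dser_has_sum[OF this] show ?thesis
      unfolding G_def minus_add_distrib powr_add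
      by (simp add: cnj_powr)
  qed
  interpret M: contractive_column g w \<rho> r p q
    "\<lambda>d l l'. T d l (Inl l')" "\<lambda>d l k. T d l (Inr k)" "\<lambda>i l. R i (Inl l)" "\<lambda>i k. R i (Inr k)"
  proof
    fix J :: "nat set" and x y :: "nat \<Rightarrow> complex" assume J: "finite J"
    define z where "z = case_sum x y"
    define \<Gamma> where "\<Gamma> a = (\<Sum>j\<in>S. z j * \<gamma> j a)" for a
    have T_z: "(\<Sum>l'<r. T d l (Inl l') * x l') + (\<Sum>k<q. T d l (Inr k) * y k) = (\<Sum>a\<in>X. \<Gamma> a * V a d l)" for d l
    proof -
      have "(\<Sum>l'<r. T d l (Inl l') * x l') + (\<Sum>k<q. T d l (Inr k) * y k) = (\<Sum>j\<in>S. T d l j * z j)"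
        by (simp add: sum_S z_def)
      also have "\<dots> = (\<Sum>j\<in>S. \<Sum>a\<in>X. z j * \<gamma> j a * V a d l)"
        unfolding T_def sum_distrib_right by (intro sum.cong refl) (simp add: mult_ac)
      also have "\<dots> = (\<Sum>a\<in>X. \<Gamma> a * V a d l)"
        unfolding \<Gamma>_def sum_distrib_right by (rule sum.swap)
      finally show ?thesis .
    qed
    have R_z: "(\<Sum>l<r. R i (Inl l) * x l) + (\<Sum>k<q. R i (Inr k) * y k) = (\<Sum>x\<in>F. \<Gamma> (x, i))" for i
    proof -
      have "(\<Sum>l<r. R i (Inl l) * x l) + (\<Sum>k<q. R i (Inr k) * y k) = (\<Sum>j\<in>S. R i j * z j)"
        by (simp add: sum_S z_def)
      also have "\<dots> = (\<Sum>j\<in>S. \<Sum>x\<in>F. z j * \<gamma> j (x, i))"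
        unfolding R_def sum_distrib_right by (intro sum.cong refl) (simp add: mult_ac)
      also have "\<dots> = (\<Sum>x\<in>F. \<Gamma> (x, i))"
        unfolding \<Gamma>_def by (rule sum.swap)
      finally show ?thesis .
    qed
    \<comment> \<open>The projection of \<open>z\<close> onto the span of the
      \<open>v a\<close>.\<close>
    define z' where "z' j = (\<Sum>a\<in>X. \<Gamma> a * v a j)" for j
    have \<Gamma>_ip: "(\<Sum>a\<in>X. \<Gamma> a * ip (v a) (v b)) = ip z (v b)" if "b \<in> X" for b
    proof -
      have "(\<Sum>a\<in>X. \<Gamma> a * ip (v a) (v b)) = (\<Sum>j\<in>S. z j * (\<Sum>a\<in>X. \<gamma> j a * ip (v a) (v b)))"
        unfolding \<Gamma>_def sum_distrib_left sum_distrib_right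
        by (subst sum.swap) (simp add: mult.assoc)
      also have "\<dots> = (\<Sum>j\<in>S. z j * cnj (v b j))"
        using \<gamma>[OF that] by simp
      also have "\<dots> = ip z (v b)" by (simp add: ip_def)
      finally show ?thesis .
    qed
    have z'_ip: "ip z' u = (\<Sum>a\<in>X. \<Gamma> a * ip (v a) u)" for u
      unfolding ip_def z'_def sum_distrib_left sum_distrib_right
      by (subst sum.swap) (simp add: mult.assoc)
    have ip_z': "ip u z' = (\<Sum>b\<in>X. cnj (\<Gamma> b) * ip u (v b))" for u
      unfolding ip_def z'_def cnj_sum sum_distrib_left complex_cnj_mult
      by (subst sum.swap) (simp add: mult_ac)
    have zz': "ip z' z' = ip z z'"
      unfolding ip_z' using \<Gamma>_ip by (intro sum.cong refl) (simp add: z'_ip)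
    have expand: "ip z' z' = (\<Sum>a\<in>X. \<Sum>b\<in>X. \<Gamma> a * cnj (\<Gamma> b) * ip (v a) (v b))"
      unfolding z'_ip unfolding ip_z' sum_distrib_left by (simp add: mult_ac)
    \<comment> \<open>The squared norm of the image of \<open>z'\<close> splits into
      \<open>h\<close>, a series over all frequencies, and \<open>h'\<close>, the part in the last
      \<open>p\<close> coordinates.\<close>
    define h where "h = (\<Sum>a\<in>X. \<Sum>b\<in>X. \<Gamma> a * cnj (\<Gamma> b) * (G (fst b + cnj (fst a)) * N a b))"
    define h' where "h' = (\<Sum>a\<in>X. \<Sum>b\<in>X. \<Gamma> a * cnj (\<Gamma> b) * (if snd a = snd b then 1 else 0))"
    have hh': "ip z' z' = h + h'"
      unfolding expand h_def h'_def sum.distrib[symmetric]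
      by (intro sum.cong refl) (simp add: gram distrib_left)
    have "((\<lambda>d. \<Sum>a\<in>X. \<Sum>b\<in>X. \<Gamma> a * cnj (\<Gamma> b) *
        (of_real (g d) * (of_nat d powr (- fst b) * cnj (of_nat d powr (- fst a))) * N a b)) has_sum h) UNIV"
      unfolding h_def
      by (intro has_sum_finite_sum has_sum_cmult_right has_sum_cmult_left G_has_sum) (auto simp: X_def)
    also have "(\<lambda>d. \<Sum>a\<in>X. \<Sum>b\<in>X. \<Gamma> a * cnj (\<Gamma> b) *
        (of_real (g d) * (of_nat d powr (- fst b) * cnj (of_nat d powr (- fst a))) * N a b)) =
        (\<lambda>d. of_real (\<Sum>l<r. (cmod (\<Sum>a\<in>X. \<Gamma> a * V a d l))\<^sup>2))"
    proof
      fix d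
      have VV: "V a d l * cnj (V b d l) =
          of_real (g d) * (of_nat d powr (- fst b) * cnj (of_nat d powr (- fst a))) * (L b l * cnj (L a l))" for a b l
        by (simp add: V_def mult_ac flip: sqrt_g)
      have "of_real (\<Sum>l<r. (cmod (\<Sum>a\<in>X. \<Gamma> a * V a d l))\<^sup>2) =
          (\<Sum>l<r. \<Sum>a\<in>X. \<Sum>b\<in>X. \<Gamma> a * cnj (\<Gamma> b) * (V a d l * cnj (V b d l)))"
        unfolding of_real_sum complex_norm_square cnj_sum sum_product
        by (intro sum.cong refl) (simp add: mult_ac)
      also have "\<dots> = (\<Sum>a\<in>X. \<Sum>b\<in>X. \<Sum>l<r. \<Gamma> a * cnj (\<Gamma> b) * (V a d l * cnj (V b d l)))"
        by (subst sum.swap, intro sum.cong refl, rule sum.swap)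
      also have "\<dots> = (\<Sum>a\<in>X. \<Sum>b\<in>X. \<Gamma> a * cnj (\<Gamma> b) *
        (of_real (g d) * (of_nat d powr (- fst b) * cnj (of_nat d powr (- fst a))) * N a b))"
        unfolding VV N_def sum_distrib_left ..
      finally show "(\<Sum>a\<in>X. \<Sum>b\<in>X. \<Gamma> a * cnj (\<Gamma> b) *
        (of_real (g d) * (of_nat d powr (- fst b) * cnj (of_nat d powr (- fst a))) * N a b)) =
        of_real (\<Sum>l<r. (cmod (\<Sum>a\<in>X. \<Gamma> a * V a d l))\<^sup>2)" by simp
    qed
    finally have "((\<lambda>d. \<Sum>l<r. (cmod (\<Sum>a\<in>X. \<Gamma> a * V a d l))\<^sup>2) has_sum Re h) UNIV"
      by (drule_tac has_sum_Re) simp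
    then have h_le: "(\<Sum>d\<in>J. \<Sum>l<r. (cmod (\<Sum>a\<in>X. \<Gamma> a * V a d l))\<^sup>2) \<le> Re h"
      using J by (intro finite_sum_le_has_sum) (auto intro: sum_nonneg)
    have "h' = (\<Sum>a\<in>X. \<Gamma> a * cnj (\<Sum>y\<in>F. \<Gamma> (y, snd a)))"
    proof -
      have "(\<Sum>b\<in>X. \<Gamma> a * cnj (\<Gamma> b) * (if snd a = snd b then 1 else 0)) = \<Gamma> a * cnj (\<Sum>y\<in>F. \<Gamma> (y, snd a))"
        if "a \<in> X" for a
        using snd_delta[of "snd a" "\<lambda>b. \<Gamma> a * cnj (\<Gamma> b)"] that
        by (auto simp: X_def sum_distrib_left eq_commute[of "snd a"])
      then show ?thesis unfolding h'_def by simp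
    qed
    also have "\<dots> = (\<Sum>i<p. \<Sum>x\<in>F. \<Gamma> (x, i) * cnj (\<Sum>y\<in>F. \<Gamma> (y, i)))"
      unfolding X_def by (subst sum.swap) (simp add: sum.cartesian_product case_prod_unfold)
    also have "\<dots> = of_real (\<Sum>i<p. (cmod (\<Sum>x\<in>F. \<Gamma> (x, i)))\<^sup>2)"
      unfolding of_real_sum complex_norm_square sum_distrib_right ..
    finally have h': "(\<Sum>i<p. (cmod (\<Sum>x\<in>F. \<Gamma> (x, i)))\<^sup>2) = Re h'" by simp
    \<comment> \<open>A projection does not increase the norm, because
      \<open>ip z' z' = ip z z'\<close>.\<close>
    have "0 \<le> (\<Sum>j\<in>S. (cmod (z j - z' j))\<^sup>2)" by (intro sum_nonneg) auto
    also have "\<dots> = Re (\<Sum>j\<in>S. (z j - z' j) * cnj (z j - z' j))"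
      unfolding complex_norm_square[symmetric] by simp
    also have "(\<Sum>j\<in>S. (z j - z' j) * cnj (z j - z' j)) = ip z z - ip z z' - cnj (ip z z') + ip z' z'"
      unfolding ip_def by (simp add: algebra_simps sum.distrib sum_subtractf)
    finally have "Re (ip z' z') \<le> Re (ip z z)" by (simp add: zz'[symmetric])
    also have "Re (ip z z) = (\<Sum>l<r. (cmod (x l))\<^sup>2) + (\<Sum>k<q. (cmod (y k))\<^sup>2)"
      unfolding ip_def sum_S complex_norm_square[symmetric] by (simp add: z_def)
    finally show "(\<Sum>d\<in>J. \<Sum>l<r. (cmod ((\<Sum>l'<r. T d l (Inl l') * x l') + (\<Sum>k<q. T d l (Inr k) * y k)))\<^sup>2)
      + (\<Sum>i<p. (cmod ((\<Sum>l<r. R i (Inl l) * x l) + (\<Sum>k<q. R i (Inr k) * y k)))\<^sup>2)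
      \<le> (\<Sum>l<r. (cmod (x l))\<^sup>2) + (\<Sum>k<q. (cmod (y k))\<^sup>2)"
      unfolding T_z R_z using h_le h' hh' by simp
  qed
  \<comment> \<open>The Gram identity paired with \<open>v (y, t)\<close>. For
    \<open>j = Inl l'\<close> it reads L P + C = L at \<open>y\<close>, for \<open>j = Inr k\<close>
    it reads L Q + E = W: the two hypotheses of the interpolation lemma.\<close>
  have intertwine: "(\<Sum>l<r. L (y, t) l * dser (\<lambda>d. of_real (sqrt (g d)) * T d l j) y) + R t j = cnj (v (y, t) j)"
    if "y \<in> F" "t < p" "j \<in> S" for y t j
  proof -
    have yt: "(y, t) \<in> X" using that by (simp add: X_def)
    have dser_T: "dser (\<lambda>d. of_real (sqrt (g d)) * T d l j) y =
        (\<Sum>a\<in>X. \<gamma> j a * (G (y + cnj (fst a)) * cnj (L a l)))" for l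
    proof -
      have "((\<lambda>d. \<Sum>a\<in>X. \<gamma> j a * (of_real (g d) * (of_nat d powr (- y) * cnj (of_nat d powr (- fst a))) * cnj (L a l)))
          has_sum (\<Sum>a\<in>X. \<gamma> j a * (G (y + cnj (fst a)) * cnj (L a l)))) UNIV"
        using that(1)
        by (intro has_sum_finite_sum has_sum_cmult_right has_sum_cmult_left G_has_sum) (auto simp: X_def)
      then show ?thesis
        unfolding dser_def
        by (intro infsumI)
          (simp add: T_def V_def sum_distrib_left sum_distrib_right mult_ac flip: sqrt_g)
    qed
    have "(\<Sum>l<r. L (y, t) l * dser (\<lambda>d. of_real (sqrt (g d)) * T d l j) y) =
        (\<Sum>a\<in>X. \<gamma> j a * (G (y + cnj (fst a)) * N a (y, t)))"
      unfolding dser_T N_def sum_distrib_left by (subst sum.swap) (simp add: mult_ac)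
    moreover have "R t j = (\<Sum>a\<in>X. \<gamma> j a * (if snd a = t then 1 else 0))"
      unfolding R_def using snd_delta[OF that(2)] by simp
    moreover have "(\<Sum>a\<in>X. \<gamma> j a * ip (v a) (v (y, t))) =
        (\<Sum>a\<in>X. \<gamma> j a * (G (y + cnj (fst a)) * N a (y, t)) + \<gamma> j a * (if snd a = t then 1 else 0))"
      by (intro sum.cong refl) (simp add: gram[OF _ yt] distrib_left)
    ultimately have "(\<Sum>l<r. L (y, t) l * dser (\<lambda>d. of_real (sqrt (g d)) * T d l j) y) + R t j =
        (\<Sum>a\<in>X. \<gamma> j a * ip (v a) (v (y, t)))"
      unfolding sum.distrib by simp
    then show ?thesis using \<gamma>[OF yt that(3)] by simp
  qed
  have "M.\<phi> x = W x" if "x \<in> F" for x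
  proof (rule eq_matI)
    fix i k assume "i < dim_row (W x)" "k < dim_col (W x)"
    then have ik: "i < p" "k < q" using W[OF that] by auto
    show "M.\<phi> x $$ (i, k) = W x $$ (i, k)"
    proof (rule M.\<phi>_interpolates[OF _ ik, where L = "L (x, i)"])
      show "x \<in> \<Omega>" using that F(2) by blast
      show "(\<Sum>l<r. L (x, i) l * dser (M.P l l') x) + R i (Inl l') = L (x, i) l'" if "l' < r" for l'
        using intertwine[OF \<open>x \<in> F\<close> ik(1), of "Inl l'"] that by (simp add: M.P_def[abs_def] v_def S_def InlI)
      show "(\<Sum>l<r. L (x, i) l * dser (M.Q l k) x) + R i (Inr k) = W x $$ (i, k)"
        using intertwine[OF \<open>x \<in> F\<close> ik(1), of "Inr k"] ik by (simp add: M.Q_def[abs_def] v_def S_def InrI)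
    qed
  qed (use W[OF that] in \<open>auto simp: M.\<phi>_def\<close>)
  moreover have "is_multiplier \<Omega> H.space p q M.\<phi>"
    using M.multiplier(1) by (simp add: is_multiplier_def M.\<phi>_def)
  moreover have "mult_norm_le_one H.space H.ip p q M.\<phi>"
    using M.multiplier(2) by (simp add: mult_norm_le_one_def)
  ultimately show ?thesis by blast
qed

theorem cnp_kernel_renewal:
  assumes K: "\<And>s u. s \<in> \<Omega> \<Longrightarrow> u \<in> \<Omega> \<Longrightarrow> K s u = D (s + cnj u)"
  shows "cnp_kernel \<Omega> K"
proof -
  have rkhs: "rkhs \<Omega> K H.space H.ip" by (rule rkhs_dirichlet) (rule K)
  show ?thesis
    unfolding cnp_kernel_def
  proof (intro conjI exI[of _ H.space] exI[of _ H.ip] rkhs allI impI)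
    show "psd_kernel \<Omega> K" by (rule rkhs.psd_kernel[OF rkhs])
  qed (rule pick_problem_solvable, auto intro: K)
qed

end

section \<open>Positivity of the coefficients\<close>

lemma psd_kernel_family:
  assumes "psd_kernel \<Omega> K" "finite I" "inj_on x I" "x ` I \<subseteq> \<Omega>"
  shows "(\<Sum>i\<in>I. \<Sum>j\<in>I. cnj (c i) * c j * K (x i) (x j)) \<in> \<real>\<^sub>\<ge>\<^sub>0"
proof -
  have "(\<Sum>s\<in>x ` I. \<Sum>u\<in>x ` I. cnj (c (the_inv_into I x s)) * c (the_inv_into I x u) * K s u) =
      (\<Sum>i\<in>I. \<Sum>j\<in>I. cnj (c i) * c j * K (x i) (x j))"
    unfolding sum.reindex[OF assms(3)] o_def
    by (intro sum.cong refl) (simp add: the_inv_into_f_f[OF assms(3)])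
  then show ?thesis
    using psd_kernelD[OF assms(1) finite_imageI[OF assms(2)] assms(4), of "\<lambda>s. c (the_inv_into I x s)"] by simp
qed

text \<open>Testing the kernel on the points \<open>\<eta> + k / 2 + i\<close> with the coefficients of the polynomial
  \<open>\<Prod>\<^sub>n\<^sub><\<^sub>m (X - 1 / n)\<close> annihilates the terms with \<open>n < m\<close>, so that for large \<open>k\<close> the \<open>m\<close>-th term
  determines the sign.\<close>

lemma psd_kernel_dser_nonneg:
  fixes g :: "nat \<Rightarrow> real"
  assumes psd: "psd_kernel (half_plane \<tau>) (\<lambda>s u. dser (\<lambda>n. of_real (g n)) (s + cnj u))"
    and g: "dabs g \<sigma>" "g 0 = 0"
  shows "g m \<ge> 0"
proof (cases "m = 0")
  case False
  define P where "P = (\<Prod>n\<in>{1..<m}. [:- 1 / real n, 1:])"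
  define N where "N = degree P"
  define c where "c i = complex_of_real (coeff P i)" for i
  \<comment> \<open>The test points lie in the half-plane, and
    \<open>2 * \<eta> \<ge> \<sigma>\<close> holds for either sign of \<sigma>, so the series
    converges at sums of two of them.\<close>
  define \<eta> where "\<eta> = max \<tau> \<bar>\<sigma>\<bar> + 1"
  define z where "z k = complex_of_real (2 * \<eta>) + of_nat k" for k :: nat
  \<comment> \<open>Half of \<open>k\<close> in each point, so that sums of two points move by
    \<open>k\<close>.\<close>
  define x where "x k i = complex_of_real (\<eta> + real k / 2 + real i)" for k i :: nat
  have x: "inj_on (x k) {..N}" "x k ` {..N} \<subseteq> half_plane \<tau>" for k
    by (auto simp: inj_on_def x_def half_plane_def \<eta>_def simp flip: of_real_add)
  have xx: "x k i + cnj (x k j) = z k + of_nat i + of_nat j" for k i j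
    by (simp add: x_def z_def complex_eq_iff)
  \<comment> \<open>The sum of points i and j contributes n^-(i+j), so the form is again a Dirichlet
    series, with \<open>g n\<close> multiplied by the squared polynomial value at 1 / n.\<close>
  define a where "a n = g n * (poly P (1 / real n))\<^sup>2" for n
  define M where "M = (\<Sum>i\<le>N. \<bar>coeff P i\<bar>)"
  have "\<bar>poly P (1 / real n)\<bar> \<le> M" if "n \<ge> 1" for n
    unfolding poly_altdef M_def N_def
  proof (rule order.trans[OF sum_abs sum_mono])
    fix i
    have "(1 / real n) ^ i \<le> 1" using that by (intro power_le_one) auto
    then show "\<bar>coeff P i * (1 / real n) ^ i\<bar> \<le> \<bar>coeff P i\<bar>"
      by (simp add: abs_mult mult_left_le)
  qed
  then have "(poly P (1 / real n))\<^sup>2 \<le> M\<^sup>2" if "n \<ge> 1" for n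
    using that by (metis abs_ge_zero power2_abs power_mono)
  then have a_le: "\<bar>a n\<bar> \<le> \<bar>M\<^sup>2 * g n\<bar>" if "n \<ge> 1" for n
    using that by (simp add: a_def abs_mult mult.commute mult_left_mono)
  have "dabs (\<lambda>n. complex_of_real (M\<^sup>2) * of_real (g n)) \<sigma>"
    using g(1) by (intro dabs_cmult) (simp add: dabs_of_real)
  then have "dabs (\<lambda>n. complex_of_real (a n)) \<sigma>"
    by (rule dabs_comparison) (use a_le in \<open>simp add: norm_mult norm_power abs_mult\<close>)
  then have a: "dabs (\<lambda>n. complex_of_real (a n)) (Re (z 0))"
    by (rule dabs_mono) (simp add: z_def \<eta>_def)
  have g': "dabs (\<lambda>n. complex_of_real (g n)) \<sigma>'" if "\<sigma>' \<ge> \<sigma>" for \<sigma>'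
    using dabs_mono[OF g(1) that] by (simp add: dabs_of_real)
  have form: "(\<Sum>i\<le>N. \<Sum>j\<le>N. cnj (c i) * c j * dser (\<lambda>n. of_real (g n)) (x k i + cnj (x k j))) =
      dser (\<lambda>n. of_real (a n)) (z k)" for k
  proof -
    have "((\<lambda>n. \<Sum>i\<le>N. \<Sum>j\<le>N. cnj (c i) * c j * (of_real (g n) * of_nat n powr (- (x k i + cnj (x k j))))) has_sum
        (\<Sum>i\<le>N. \<Sum>j\<le>N. cnj (c i) * c j * dser (\<lambda>n. of_real (g n)) (x k i + cnj (x k j)))) UNIV"
      unfolding xx by (intro has_sum_finite_sum has_sum_cmult_right dser_has_sum g') (simp add: z_def \<eta>_def)
    moreover have "(\<Sum>i\<le>N. \<Sum>j\<le>N. cnj (c i) * c j * (of_real (g n) * of_nat n powr (- (x k i + cnj (x k j))))) =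
        of_real (a n) * of_nat n powr (- z k)" for n
    proof (cases "n = 0")
      case True
      then show ?thesis by simp
    next
      case False
      have pow: "of_nat n powr (- (x k i + cnj (x k j))) =
          of_nat n powr (- z k) * (1 / of_nat n) ^ i * ((1 / of_nat n) ^ j :: complex)" for i j
        unfolding xx minus_add_distrib powr_add using False
        by (simp add: powr_minus powr_nat power_one_over inverse_eq_divide)
      have "complex_of_real (poly P (1 / real n)) = (\<Sum>i\<le>N. c i * (1 / of_nat n) ^ i)"
        unfolding poly_altdef N_def c_def by simp
      then have "of_real (a n) * of_nat n powr (- z k) =
          of_real (g n) * ((\<Sum>i\<le>N. c i * (1 / of_nat n) ^ i) * (\<Sum>j\<le>N. c j * (1 / of_nat n) ^ j)) * of_nat n powr (- z k)"
        by (simp add: a_def power2_eq_square)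
      also have "\<dots> = (\<Sum>i\<le>N. \<Sum>j\<le>N. cnj (c i) * c j * (of_real (g n) * of_nat n powr (- (x k i + cnj (x k j)))))"
        unfolding sum_product sum_distrib_left sum_distrib_right pow
        by (intro sum.cong refl) (simp add: c_def mult_ac)
      finally show ?thesis by simp
    qed
    ultimately show ?thesis unfolding dser_def by (intro infsumI[symmetric]) simp
  qed
  have "poly P (1 / real n) = 0" if "n < m" "n \<noteq> 0" for n
    using that unfolding P_def poly_prod by (intro prod_zero) (auto intro!: bexI[of _ n])
  then have a_0: "a n = 0" if "n < m" for n
    using that g(2) by (cases "n = 0") (simp_all add: a_def)
  have "(\<lambda>k. of_nat m powr (z 0 + of_nat k) * dser (\<lambda>n. of_real (a n)) (z 0 + of_nat k)) \<longlonglongrightarrow> complex_of_real (a m)"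
    using False by (intro dser_leading_coeff[OF a]) (auto simp: a_0)
  moreover have "of_nat m powr (z 0 + of_nat k) * dser (\<lambda>n. of_real (a n)) (z 0 + of_nat k) \<in> \<real>\<^sub>\<ge>\<^sub>0" for k
  proof (rule nonneg_Reals_mult_I)
    have zk: "z 0 + of_nat k = z k" by (simp add: z_def)
    show "dser (\<lambda>n. of_real (a n)) (z 0 + of_nat k) \<in> \<real>\<^sub>\<ge>\<^sub>0"
      unfolding zk form[symmetric] by (rule psd_kernel_family[OF psd _ x]) simp
    have "of_nat m powr z k = complex_of_real (real m powr (2 * \<eta> + real k))"
      unfolding z_def by (subst powr_of_real[symmetric]) simp_all
    then show "of_nat m powr (z 0 + of_nat k) \<in> \<real>\<^sub>\<ge>\<^sub>0" unfolding zk by simp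
  qed
  ultimately have "complex_of_real (a m) \<in> \<real>\<^sub>\<ge>\<^sub>0"
    by (intro Lim_in_closed_set[OF closed_nonneg_Reals_complex _ trivial_limit_sequentially]) auto
  then have "a m \<ge> 0" by simp
  moreover have "poly P (1 / real m) \<noteq> 0"
    unfolding P_def poly_prod by (subst prod_zero_iff) auto
  ultimately show ?thesis by (simp add: a_def zero_le_mult_iff)
qed (use g in simp)

text \<open>A normalised series tends to 1 far to the right, so the quotient kernels with base point
  \<open>x k\<close> converge to 1 - 1 / K, which is G by the renewal equation. On finite sets
  positivity survives the pointwise limit.\<close>

lemma cnp_kernel_dser_nonneg:
  fixes w g :: "nat \<Rightarrow> real"
  assumes cnp: "cnp_kernel (half_plane \<rho>) K"
    and K: "\<And>s u. s \<in> half_plane \<rho> \<Longrightarrow> u \<in> half_plane \<rho> \<Longrightarrow> K s u = dser (\<lambda>n. of_real (w n)) (s + cnj u)"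
    and w: "dabs w \<sigma>" "w 0 = 0" "w 1 = 1"
    and g: "dabs g \<sigma>" "g 0 = 0" and wg: "\<And>n. w n = delta1 n + dconv g w n"
  shows "g m \<ge> 0"
proof -
  \<comment> \<open>Beyond this line both series converge at s + cnj u, which supplies the absence
    of zeros of \<open>K\<close> required for the quotients.\<close>
  define \<tau> where "\<tau> = max \<rho> \<bar>\<sigma>\<bar>"
  define W where "W = dser (\<lambda>n. of_real (w n))"
  define G where "G = dser (\<lambda>n. of_real (g n))"
  have K': "K s u = W (s + cnj u)" if "s \<in> half_plane \<tau>" "u \<in> half_plane \<tau>" for s u
    using that K by (simp add: half_plane_def \<tau>_def W_def)
  have Re: "\<sigma> \<le> Re (s + cnj u)" if "s \<in> half_plane \<tau>" "u \<in> half_plane \<tau>" for s u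
    using that by (simp add: half_plane_def \<tau>_def) linarith
  have WG: "W z * (1 - G z) = 1" if "\<sigma> \<le> Re z" for z
    unfolding W_def G_def by (rule dser_renewal[OF dabs_mono[OF g(1) that] dabs_mono[OF w(1) that] wg])
  have W_lim: "(\<lambda>k. W (z + of_nat k)) \<longlonglongrightarrow> 1" if "\<sigma> \<le> Re z" for z
  proof -
    have "dabs (\<lambda>n. complex_of_real (w n)) (Re z)"
      using dabs_mono[OF w(1) that] by (simp add: dabs_of_real)
    from dser_leading_coeff[OF this, of 1] show ?thesis
      using w by (simp add: W_def)
  qed
  have "psd_kernel F (\<lambda>s u. G (s + cnj u))" if F: "finite F" "F \<subseteq> half_plane \<tau>" for F
  proof (rule psd_kernel_LIMSEQ[OF F(1)])
    define x where "x k = complex_of_real (\<tau> + 1) + of_nat k" for k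
    have x: "x k \<in> half_plane \<tau>" for k by (simp add: x_def half_plane_def)
    show "psd_kernel F (\<lambda>s u. 1 - K s (x k) * K (x k) u / (K (x k) (x k) * K s u))" for k
    proof (rule cnp_kernel_quotient_psd[OF cnp _ _ F x])
      show "half_plane \<tau> \<subseteq> half_plane \<rho>" by (auto simp: half_plane_def \<tau>_def)
      show "K s u \<noteq> 0" if "s \<in> half_plane \<tau>" "u \<in> half_plane \<tau>" for s u
        using WG[OF Re[OF that]] K'[OF that] by auto
    qed
    fix s u assume "s \<in> F" "u \<in> F"
    then have su: "s \<in> half_plane \<tau>" "u \<in> half_plane \<tau>" using F by auto
    have x0: "complex_of_real (\<tau> + 1) \<in> half_plane \<tau>" using x[of 0] by (simp add: x_def)
    have 1: "(\<lambda>k. K s (x k)) \<longlonglongrightarrow> 1"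
      using W_lim[OF Re[OF su(1) x0]] unfolding K'[OF su(1) x] by (simp add: x_def add_ac)
    have 2: "(\<lambda>k. K (x k) u) \<longlonglongrightarrow> 1"
      using W_lim[OF Re[OF x0 su(2)]] unfolding K'[OF x su(2)] by (simp add: x_def add_ac)
    have 3: "(\<lambda>k. K (x k) (x k)) \<longlonglongrightarrow> 1"
    proof -
      \<comment> \<open>With both arguments at \<open>x k\<close> the sum moves by 2 k, a
        subsequence of the known limit.\<close>
      have "(\<lambda>k. W (of_real (\<tau> + 1) + cnj (of_real (\<tau> + 1)) + of_nat (k * 2))) \<longlonglongrightarrow> 1"
        by (rule LIMSEQ_linear[OF W_lim[OF Re[OF x0 x0]]]) simp
      then show ?thesis unfolding K'[OF x x] by (simp add: x_def algebra_simps)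
    qed
    have "(\<lambda>k. 1 - K s (x k) * K (x k) u / (K (x k) (x k) * K s u)) \<longlonglongrightarrow> 1 - 1 * 1 / (1 * K s u)"
      using WG[OF Re[OF su]] K'[OF su] by (intro tendsto_intros 1 2 3) auto
    also have "1 - 1 * 1 / (1 * K s u) = G (s + cnj u)"
    proof -
      have "W (s + cnj u) \<noteq> 0" using WG[OF Re[OF su]] by auto
      then have "1 / W (s + cnj u) = 1 - G (s + cnj u)"
        using WG[OF Re[OF su]] by (simp add: nonzero_divide_eq_eq mult.commute)
      then show ?thesis by (simp add: K'[OF su])
    qed
    finally show "(\<lambda>k. 1 - K s (x k) * K (x k) u / (K (x k) (x k) * K s u)) \<longlonglongrightarrow> G (s + cnj u)" .
  qed
  then have "psd_kernel (half_plane \<tau>) (\<lambda>s u. G (s + cnj u))"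
    unfolding psd_kernel_def by blast
  then show ?thesis unfolding G_def by (rule psd_kernel_dser_nonneg[OF _ g])
qed

section \<open>Weight and frequency data\<close>

lemma reindex_support:
  fixes f :: "nat \<Rightarrow> 'b::{topological_comm_monoid_add, t2_space}"
  assumes "bij_betw h I S" "\<And>m. m \<notin> S \<Longrightarrow> f m = 0"
  shows "(\<lambda>j. f (h j)) summable_on I \<longleftrightarrow> f summable_on UNIV"
    and "(\<Sum>\<^sub>\<infinity>j\<in>I. f (h j)) = (\<Sum>\<^sub>\<infinity>m. f m)"
proof -
  have "f summable_on S \<longleftrightarrow> f summable_on UNIV"
    by (rule summable_on_cong_neutral) (use assms(2) in auto)
  then show "(\<lambda>j. f (h j)) summable_on I \<longleftrightarrow> f summable_on UNIV"
    using summable_on_reindex_bij_betw[OF assms(1), of f] by simp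
  have "infsum f S = infsum f UNIV"
    by (rule infsum_cong_neutral) (use assms(2) in auto)
  then show "(\<Sum>\<^sub>\<infinity>j\<in>I. f (h j)) = (\<Sum>\<^sub>\<infinity>m. f m)"
    using infsum_reindex_bij_betw[OF assms(1), of f] by simp
qed

context
  fixes d :: enat and b :: "nat \<Rightarrow> real" and n :: "nat \<Rightarrow> nat" and g :: "nat \<Rightarrow> real" and S :: "nat set"
  assumes bij: "bij_betw n (indices d) S" and b: "\<And>j. j \<in> indices d \<Longrightarrow> b j = g (n j)"
    and g: "\<And>m. m \<notin> S \<Longrightarrow> g m = 0"
begin

lemma data_summable_iff:
  "(\<lambda>j. \<bar>b j\<bar> * real (n j) powr (- \<sigma>)) summable_on indices d \<longleftrightarrow> dabs g \<sigma>"
proof -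
  have "(\<lambda>j. \<bar>b j\<bar> * real (n j) powr (- \<sigma>)) summable_on indices d \<longleftrightarrow>
      (\<lambda>j. \<bar>g (n j)\<bar> * real (n j) powr (- \<sigma>)) summable_on indices d"
    by (rule summable_on_cong) (simp add: b)
  also have "\<dots> \<longleftrightarrow> dabs g \<sigma>"
    using reindex_support(1)[OF bij, of "\<lambda>m. \<bar>g m\<bar> * real m powr (- \<sigma>)"] g by (simp add: dabs_def)
  finally show ?thesis .
qed

lemma data_series_eq: "data_series d b n s u = dser (\<lambda>m. of_real (g m)) (s + cnj u)"
proof -
  have "data_series d b n s u = (\<Sum>\<^sub>\<infinity>j\<in>indices d. of_real (g (n j)) * of_nat (n j) powr (- s - cnj u))"
    unfolding data_series_def by (rule infsum_cong) (simp add: b)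
  also have "\<dots> = dser (\<lambda>m. of_real (g m)) (s + cnj u)"
    using reindex_support(2)[OF bij, of "\<lambda>m. complex_of_real (g m) * of_nat m powr (- s - cnj u)"] g
    by (simp add: dser_def)
  finally show ?thesis .
qed

lemma data_kernel_dirichlet:
  assumes w: "\<And>m. w m = delta1 m + dconv g w m"
    and abs: "\<And>\<sigma>. \<sigma> > 2 * \<rho> \<Longrightarrow> dabs g \<sigma> \<and> dabs w \<sigma>"
  shows "data_kernel_defined_on \<rho> d b n"
    and "s \<in> half_plane \<rho> \<Longrightarrow> u \<in> half_plane \<rho> \<Longrightarrow> data_kernel d b n s u = dser (\<lambda>m. of_real (w m)) (s + cnj u)"
proof -
  have abs': "dabs g (Re (s + cnj u))" "dabs w (Re (s + cnj u))"
    if "s \<in> half_plane \<rho>" "u \<in> half_plane \<rho>" for s u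
    using that abs by (auto simp: half_plane_def)
  have eq: "dser (\<lambda>m. of_real (w m)) (s + cnj u) * (1 - data_series d b n s u) = 1"
    if "s \<in> half_plane \<rho>" "u \<in> half_plane \<rho>" for s u
    unfolding data_series_eq by (rule dser_renewal[OF abs'[OF that] w])
  show "data_kernel d b n s u = dser (\<lambda>m. of_real (w m)) (s + cnj u)"
    if "s \<in> half_plane \<rho>" "u \<in> half_plane \<rho>"
  proof -
    have "1 - data_series d b n s u \<noteq> 0" using eq[OF that] by auto
    then show ?thesis
      using eq[OF that] by (simp add: data_kernel_def nonzero_divide_eq_eq)
  qed
  show "data_kernel_defined_on \<rho> d b n"
    unfolding data_kernel_defined_on_def
  proof (intro ballI conjI)
    fix s u assume su: "s \<in> half_plane \<rho>" "u \<in> half_plane \<rho>"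
    show "data_series d b n s u \<noteq> 1" using eq[OF su] by auto
    have "dabs (\<lambda>m. complex_of_real (g m)) (Re (s + cnj u))"
      using abs'[OF su] by (simp add: dabs_of_real)
    from dser_summable[OF this]
    have "(\<lambda>j. complex_of_real (g (n j)) * of_nat (n j) powr (- s - cnj u)) summable_on indices d"
      using reindex_support(1)[OF bij, of "\<lambda>m. complex_of_real (g m) * of_nat m powr (- s - cnj u)"] g by simp
    then show "(\<lambda>j. complex_of_real (b j) * of_nat (n j) powr (- s - cnj u)) summable_on indices d"
      by (rule summable_on_cong[THEN iffD1, rotated]) (simp add: b)
  qed
qed

end

lemma indices_bij:
  assumes "S \<noteq> {}"
  shows "\<exists>d h. 1 \<le> d \<and> bij_betw h (indices d) (S :: nat set)"
proof (cases "finite S")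
  case True
  then obtain h where "bij_betw h {1..card S} S" using ex_bij_betw_nat_finite_1 by blast
  moreover have "indices (enat (card S)) = {1..card S}" by (auto simp: indices_def)
  moreover have "1 \<le> enat (card S)"
    using True assms by (simp add: one_enat_def card_gt_0_iff Suc_le_eq)
  ultimately show ?thesis by metis
next
  case False
  \<comment> \<open>\<open>indices\<close> starts at 1, \<open>enumerate\<close> at 0.\<close>
  have "bij_betw (\<lambda>j. j - 1) {1..} (UNIV :: nat set)"
    by (rule bij_betw_byWitness[where f' = Suc]) auto
  then have "bij_betw (enumerate S \<circ> (\<lambda>j. j - 1)) {1..} S"
    using bij_enumerate[OF False] by (rule bij_betw_trans)
  moreover have "indices \<infinity> = {1..}" by (auto simp: indices_def)
  ultimately show ?thesis by (intro exI[of _ \<infinity>] exI) auto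
qed

lemma sigma_a_less_top_iff:
  "sigma_a I a \<nu> < \<infinity> \<longleftrightarrow> (\<exists>\<sigma>. (\<lambda>i. \<bar>a i\<bar> * real (\<nu> i) powr (- \<sigma>)) summable_on I)"
  unfolding sigma_a_def Inf_less_iff by auto

text \<open>Since \<open>g\<close> starts at 2, all the required sums become small far enough to the
  right; \<open>w\<close> then converges by the renewal bound.\<close>

lemma renewal_weights_exist:
  fixes g :: "nat \<Rightarrow> real"
  assumes nonneg: "\<And>n. g n \<ge> 0" and g0: "g 0 = 0" "g 1 = 0" and g: "dabs g \<sigma>"
  shows "\<exists>w \<rho>. renewal_weights g w \<rho>"
proof -
  define w where "w = dconv_solution (\<lambda>_ _. g) (\<lambda>_. delta1) 1 0"
  have w: "w n = delta1 n + dconv g w n" for n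
    unfolding w_def using g0(2) by (subst dconv_solution) auto
  have w_nonneg: "w n \<ge> 0" for n
  proof (induction n rule: less_induct)
    case (less n)
    have "g d * w (n div d) \<ge> 0" if "d dvd n" "n \<noteq> 0" for d
    proof (cases "d \<le> 1")
      case True
      then have "d = 0 \<or> d = 1" by linarith
      then show ?thesis using g0 by auto
    next
      case False
      then show ?thesis using less that nonneg by simp
    qed
    then have "dconv g w n \<ge> 0"
      by (cases "n = 0") (auto simp: dconv_def intro: sum_nonneg)
    then show ?case by (subst w) (simp add: delta1_def)
  qed
  \<comment> \<open>Chosen so that \<open>sqrt (g n) * n powr (- \<tau>)\<close> is the geometric
    mean of \<open>g n * n powr (- \<sigma>)\<close> and \<open>n powr (- 2)\<close>, both
    summable.\<close>
  define \<tau> where "\<tau> = \<sigma> / 2 + 1"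
  have sqrt_g: "dabs (\<lambda>n. sqrt (g n)) \<tau>"
    unfolding dabs_def
  proof (rule summable_on_comparison_test)
    have "summable (\<lambda>n. real n powr (- 2))" by (simp add: summable_real_powr_iff)
    then have "(\<lambda>n. real n powr (- 2)) summable_on UNIV"
      by (subst summable_on_UNIV_nonneg_real_iff) auto
    then show "(\<lambda>n. g n * real n powr (- \<sigma>) + real n powr (- 2)) summable_on UNIV"
      using g nonneg by (intro summable_on_add) (auto simp: dabs_def)
    fix n
    have "sqrt (g n) * real n powr (- \<tau>) = sqrt (g n * real n powr (- \<sigma>)) * sqrt (real n powr (- 2))"
    proof -
      have "real n powr (- \<tau>) = sqrt (real n powr (- \<sigma>) * real n powr (- 2))"
        unfolding powr_add[symmetric] powr_half_sqrt[symmetric, OF powr_ge_zero] powr_powr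
        by (rule arg_cong[where f = "\<lambda>t. real n powr t"]) (simp add: \<tau>_def field_simps)
      then show ?thesis by (simp add: real_sqrt_mult)
    qed
    also have "\<dots> \<le> (g n * real n powr (- \<sigma>) + real n powr (- 2)) / 2"
      unfolding real_sqrt_mult[symmetric] using nonneg by (intro arith_geo_mean_sqrt) auto
    also have "\<dots> \<le> g n * real n powr (- \<sigma>) + real n powr (- 2)" using nonneg[of n] by simp
    finally show "norm (sqrt (g n)) * real n powr (- \<tau>) \<le> g n * real n powr (- \<sigma>) + real n powr (- 2)"
      using nonneg by simp
  qed (use nonneg in auto)
  obtain \<sigma>1 where \<sigma>1: "\<sigma>1 \<ge> \<tau>"
    "\<And>\<sigma>. \<sigma> \<ge> \<sigma>1 \<Longrightarrow> (\<Sum>\<^sub>\<infinity>n. norm (sqrt (g n)) * real n powr (- \<sigma>)) \<le> 1 / 2"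
    using dabs_small[OF sqrt_g, of "1 / 2"] g0 by auto
  obtain \<sigma>2 where \<sigma>2: "\<sigma>2 \<ge> \<sigma>"
    "\<And>\<sigma>. \<sigma> \<ge> \<sigma>2 \<Longrightarrow> (\<Sum>\<^sub>\<infinity>n. norm (g n) * real n powr (- \<sigma>)) \<le> 1 / 2"
    using dabs_small[OF g, of "1 / 2"] g0 by auto
  \<comment> \<open>The absolute value secures \<open>2 * \<rho> \<ge> \<sigma>2\<close> for
    negative \<sigma>2 as well.\<close>
  define \<rho> where "\<rho> = max \<sigma>1 \<bar>\<sigma>2\<bar>"
  have \<rho>: "\<rho> \<ge> \<sigma>1" "2 * \<rho> \<ge> \<sigma>2" by (auto simp: \<rho>_def)
  have g': "dabs g (2 * \<rho>)" using dabs_mono[OF g] \<rho> \<sigma>2 by simp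
  have "renewal_weights g w \<rho>"
  proof
    show "dabs (\<lambda>n. sqrt (g n)) \<rho>" using dabs_mono[OF sqrt_g] \<rho> \<sigma>1 by simp
    show "(\<Sum>\<^sub>\<infinity>n. sqrt (g n) * real n powr (- \<rho>)) \<le> 1 / 2" using \<sigma>1(2)[OF \<rho>(1)] nonneg by simp
    have sum_g: "(\<Sum>\<^sub>\<infinity>n. g n * real n powr (- (2 * \<rho>))) \<le> 1 / 2" using \<sigma>2(2)[OF \<rho>(2)] nonneg by simp
    show "dabs w (2 * \<rho>)"
    proof (rule dabs_of_dconv_bound[where p = g and q = delta1 and c = "1/2"])
      show "w n \<le> delta1 n + dconv g w n" for n by (rule eq_refl[OF w])
    qed (use nonneg w_nonneg g' sum_g in \<open>auto simp: delta1_def intro: dabs_delta1\<close>)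
  qed (use nonneg g0 w_nonneg w g' in auto)
  then show ?thesis by blast
qed

lemma data_kernel_cnp:
  assumes data: "weight_frequency_data d b n" and \<sigma>: "sigma_a (indices d) b n < \<infinity>"
  shows "\<exists>\<rho>. data_kernel_defined_on \<rho> d b n \<and> cnp_kernel (half_plane \<rho>) (data_kernel d b n)"
proof -
  have inj: "inj_on n (indices d)" using data by (simp add: weight_frequency_data_def)
  define S where "S = n ` indices d"
  have bij: "bij_betw n (indices d) S" using inj by (simp add: S_def inj_on_imp_bij_betw)
  define g where "g m = (if m \<in> S then b (the_inv_into (indices d) n m) else 0)" for m
  have g_n: "b j = g (n j)" if "j \<in> indices d" for j
    using that by (simp add: g_def S_def the_inv_into_f_f[OF inj])
  have g_S: "g m = 0" if "m \<notin> S" for m using that by (simp add: g_def)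
  have nonneg: "g m \<ge> 0" for m
  proof (cases "m \<in> S")
    case True
    then obtain j where "j \<in> indices d" "m = n j" by (auto simp: S_def)
    then show ?thesis
      using data g_n[of j] by (auto simp: weight_frequency_data_def intro: less_imp_le)
  qed (simp add: g_S)
  have "0 \<notin> S" "1 \<notin> S" using data by (auto simp: S_def weight_frequency_data_def) 
  then have g0: "g 0 = 0" "g 1 = 0" by (simp_all add: g_S)
  have "(\<lambda>j. \<bar>b j\<bar> * real (n j) powr (- \<sigma>)) summable_on indices d \<longleftrightarrow> dabs g \<sigma>" for \<sigma>
    by (rule data_summable_iff[where S = S]) (rule bij | erule g_n | erule g_S)+
  then obtain \<sigma> where "dabs g \<sigma>"
    using \<sigma> unfolding sigma_a_less_top_iff by blast
  then obtain w \<rho> where rw: "renewal_weights g w \<rho>" using renewal_weights_exist[OF nonneg g0] by blast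
  then interpret renewal_weights g w \<rho> .
  have abs: "dabs g \<sigma> \<and> dabs w \<sigma>" if "\<sigma> > 2 * \<rho>" for \<sigma>
    using that dabs_mono[OF g_abs] dabs_mono[OF w_abs] by simp
  have defined: "data_kernel_defined_on \<rho> d b n"
    by (rule data_kernel_dirichlet(1)[where S = S and g = g and w = w])
      (rule bij w_eq | erule g_n | erule g_S | erule abs)+
  have kernel: "data_kernel d b n s u = D (s + cnj u)" if "s \<in> \<Omega>" "u \<in> \<Omega>" for s u
    unfolding D_def
    by (rule data_kernel_dirichlet(2)[where S = S and g = g and w = w])
      (rule bij w_eq that | erule g_n | erule g_S | erule abs)+
  have "cnp_kernel (half_plane \<rho>) (data_kernel d b n)"
    by (rule cnp_kernel_renewal) (rule kernel)
  then show ?thesis using defined by blast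
qed

lemma cnp_dirichlet_kernel_data:
  fixes w :: "nat \<Rightarrow> real"
  assumes nonneg: "\<And>m. m \<ge> 1 \<Longrightarrow> w m \<ge> 0" and w1: "w 1 = 1"
    and \<sigma>: "sigma_a {1..} w (\<lambda>m. m) < \<infinity>" "sigma_a {1..} w (\<lambda>m. m) \<le> ereal (2 * \<rho>)"
    and nonconst: "\<not> (\<lambda>(s, u). dirichlet_kernel w s u) constant_on (half_plane \<rho> \<times> half_plane \<rho>)"
    and cnp: "cnp_kernel (half_plane \<rho>) (dirichlet_kernel w)"
  shows "\<exists>d b n. weight_frequency_data d b n \<and> sigma_a (indices d) b n < \<infinity> \<and>
    data_kernel_defined_on \<rho> d b n \<and>
    (\<forall>s\<in>half_plane \<rho>. \<forall>u\<in>half_plane \<rho>. dirichlet_kernel w s u = data_kernel d b n s u)"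
proof -
  \<comment> \<open>The kernel does not see \<open>w 0\<close>; convolution requires the value 0
    there.\<close>
  define w' where "w' n = (if n = 0 then 0 else w n)" for n
  have w'_nonneg: "w' n \<ge> 0" for n using nonneg by (simp add: w'_def)
  have kernel: "dirichlet_kernel w s u = dser (\<lambda>n. of_real (w' n)) (s + cnj u)" for s u
    unfolding dirichlet_kernel_def dser_def
    by (rule infsum_cong_neutral) (auto simp: w'_def not_le)
  have abs: "dabs w' \<sigma>" if "\<sigma> > 2 * \<rho>" for \<sigma>
  proof -
    have "sigma_a {1..} w (\<lambda>m. m) < ereal \<sigma>" using \<sigma>(2) that by (simp add: le_less_trans)
    then obtain \<sigma>0 where \<sigma>0: "\<sigma>0 < \<sigma>" "(\<lambda>m. \<bar>w m\<bar> * real m powr (- \<sigma>0)) summable_on {1..}"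
      unfolding sigma_a_def Inf_less_iff by auto
    have "(\<lambda>m. \<bar>w m\<bar> * real m powr (- \<sigma>0)) summable_on {1..} \<longleftrightarrow> dabs w' \<sigma>0"
      unfolding dabs_def by (rule summable_on_cong_neutral) (auto simp: w'_def not_le)
    then show ?thesis using dabs_mono \<sigma>0 by (metis less_imp_le)
  qed
  define v where "v n = w' n - delta1 n" for n
  have v: "v 0 = 0" "v 1 = 0" "v n \<ge> 0" for n
    using w1 w'_nonneg[of n] by (auto simp: v_def w'_def delta1_def)
  \<comment> \<open>The convolution inverse of 1 + v is 1 - g, in the recursive form g = v - v g.
    Commuted, this is the renewal equation for \<open>w'\<close>.\<close>
  define g where "g = dconv_solution (\<lambda>_ _ n. - v n) (\<lambda>_. v) 1 0"
  have g: "g n = v n - dconv v g n" for n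
  proof -
    have "g n = v n + dconv (\<lambda>n. - v n) g n" unfolding g_def using v(2) by (subst dconv_solution) auto
    then show ?thesis using dconv_cmult_left[of "-1" v g n] by simp
  qed
  have g0: "g 0 = 0" using g[of 0] v(1) by simp
  have w'_eq: "w' n = delta1 n + dconv g w' n" for n
  proof -
    have "dconv g w' n = dconv g (\<lambda>n. delta1 n + v n) n" by (simp add: v_def)
    also have "\<dots> = g n + dconv v g n"
      using g0 by (simp add: dconv_add_right dconv_delta1_right dconv_commute[of g v])
    finally show ?thesis using g[of n] by (simp add: v_def)
  qed
  have abs_v: "dabs v \<sigma>" if "\<sigma> > 2 * \<rho>" for \<sigma>
  proof (rule dabs_comparison[OF abs[OF that]])
    fix n
    have "v n \<le> w' n" by (simp add: v_def delta1_def)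
    then show "norm (v n) \<le> norm (w' n)" using v(3)[of n] w'_nonneg[of n] by simp
  qed
  obtain \<sigma>1 where \<sigma>1: "\<sigma>1 \<ge> 2 * \<rho> + 1" "(\<Sum>\<^sub>\<infinity>n. norm (v n) * real n powr (- \<sigma>1)) \<le> 1 / 2"
    using dabs_small[OF abs_v[of "2 * \<rho> + 1"], of "1 / 2"] v(1,2) by auto
  \<comment> \<open>The sign of \<open>g\<close> is still unknown, so convergence at one remote
    point comes from |g| \<le> v + v |g|.\<close>
  have "dabs (\<lambda>n. \<bar>g n\<bar>) \<sigma>1"
  proof (rule dabs_of_dconv_bound[where p = v and q = v and c = "1/2"])
    fix n
    have "\<bar>dconv v g n\<bar> \<le> dconv v (\<lambda>n. \<bar>g n\<bar>) n"
      unfolding dconv_def using v(3) by (intro order.trans[OF sum_abs]) (simp add: abs_mult)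
    then show "\<bar>g n\<bar> \<le> v n + dconv v (\<lambda>n. \<bar>g n\<bar>) n" using g[of n] v(3)[of n] by simp
  qed (use v \<sigma>1 abs_v in auto)
  then have abs_g1: "dabs g \<sigma>1" by (simp add: dabs_def)
  have g_nonneg: "g m \<ge> 0" for m
    using cnp kernel abs[of \<sigma>1] \<sigma>1 w1 abs_g1 g0 w'_eq
    by (intro cnp_kernel_dser_nonneg[of \<rho> "dirichlet_kernel w" w' \<sigma>1 g]) (auto simp: w'_def)
  \<comment> \<open>With \<open>g\<close> nonnegative, g = v - v g gives g \<le> v, which carries
    convergence back to the whole given half-plane.\<close>
  have abs_g: "dabs g \<sigma>" if "\<sigma> > 2 * \<rho>" for \<sigma>
  proof (rule dabs_comparison[OF abs_v[OF that]])
    fix n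
    have "dconv v g n \<ge> 0" unfolding dconv_def using v(3) g_nonneg by (intro sum_nonneg) auto
    then show "norm (g n) \<le> norm (v n)" using g[of n] g_nonneg[of n] by simp
  qed
  define S where "S = {m. g m > 0}"
  have g_S: "g m = 0" if "m \<notin> S" for m using that g_nonneg[of m] by (simp add: S_def)
  have S_ge: "m \<ge> 2" if "m \<in> S" for m
  proof -
    have "dconv v g 1 = 0" using v(2) by (simp add: dconv_def)
    then have "g 1 = 0" using g[of 1] v(2) by simp
    then have "m \<noteq> 0" "m \<noteq> 1" using that g0 unfolding S_def mem_Collect_eq by (metis less_irrefl)+
    then show ?thesis by linarith
  qed
  \<comment> \<open>Without frequencies the kernel would be constantly 1; non-constancy thus
    provides \<open>1 \<le> d\<close>.\<close>
  have "S \<noteq> {}"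
  proof
    assume "S = {}"
    then have "g n = 0" for n using g_S by simp
    then have "dconv g w' n = 0" for n by (simp add: dconv_def)
    then have "w' n = delta1 n" for n using w'_eq by simp
    then have "complex_of_real (w' n) = delta1 n" for n by (simp add: delta1_def)
    then have "dirichlet_kernel w s u = 1" for s u unfolding kernel by (simp add: dser_delta1)
    then show False using nonconst by (auto simp: constant_on_def)
  qed
  then obtain d n where d: "1 \<le> d" and bij: "bij_betw n (indices d) S" using indices_bij by blast
  define b where "b j = g (n j)" for j
  have mem: "n j \<in> S" if "j \<in> indices d" for j using bij that by (auto simp: bij_betw_def)
  have "weight_frequency_data d b n"
    using d bij mem S_ge by (auto simp: weight_frequency_data_def bij_betw_def b_def S_def)
  moreover have "(\<lambda>j. \<bar>b j\<bar> * real (n j) powr (- \<sigma>1)) summable_on indices d \<longleftrightarrow> dabs g \<sigma>1"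
    by (rule data_summable_iff[where S = S]) (rule bij b_def | erule g_S)+
  then have "sigma_a (indices d) b n < \<infinity>"
    unfolding sigma_a_less_top_iff using abs_g1 by blast
  moreover have both: "dabs g \<sigma> \<and> dabs w' \<sigma>" if "\<sigma> > 2 * \<rho>" for \<sigma>
    using abs_g[OF that] abs[OF that] by blast
  have "data_kernel_defined_on \<rho> d b n"
    by (rule data_kernel_dirichlet(1)[where S = S and g = g and w = w'])
      (rule bij w'_eq b_def | erule g_S | erule both)+
  moreover have "dirichlet_kernel w s u = data_kernel d b n s u"
    if "s \<in> half_plane \<rho>" "u \<in> half_plane \<rho>" for s u
    unfolding kernel
    by (rule data_kernel_dirichlet(2)[where S = S and g = g and w = w', symmetric])
      (rule bij w'_eq b_def that | erule g_S | erule both)+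
  ultimately show ?thesis by blast
qed

theorem theorem3p2:
  shows
    "(\<forall>(d :: enat) (b :: nat \<Rightarrow> real) (n :: nat \<Rightarrow> nat).
        weight_frequency_data d b n \<longrightarrow> sigma_a (indices d) b n < \<infinity> \<longrightarrow>
        (\<exists>\<rho> :: real. data_kernel_defined_on \<rho> d b n \<and>
           cnp_kernel (half_plane \<rho>) (data_kernel d b n)))
     \<and>
     (\<forall>(w :: nat \<Rightarrow> real) (\<rho> :: real).
        (\<forall>m\<ge>1. w m \<ge> 0) \<longrightarrow> w 1 = 1 \<longrightarrow>
        sigma_a {1..} w (\<lambda>m. m) < \<infinity> \<longrightarrow> sigma_a {1..} w (\<lambda>m. m) \<le> ereal (2 * \<rho>) \<longrightarrow>
        \<not> (\<lambda>(s, u). dirichlet_kernel w s u) constant_on (half_plane \<rho> \<times> half_plane \<rho>) \<longrightarrow>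
        cnp_kernel (half_plane \<rho>) (dirichlet_kernel w) \<longrightarrow>
        (\<exists>(d :: enat) (b :: nat \<Rightarrow> real) (n :: nat \<Rightarrow> nat).
           weight_frequency_data d b n \<and> sigma_a (indices d) b n < \<infinity> \<and>
           data_kernel_defined_on \<rho> d b n \<and>
           (\<forall>s\<in>half_plane \<rho>. \<forall>u\<in>half_plane \<rho>. dirichlet_kernel w s u = data_kernel d b n s u)))"
  using data_kernel_cnp cnp_dirichlet_kernel_data by simp

end
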